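(* Let $n\ge1$. For each compact pluripolar set $K$ in $\mathbb{P}^n$, the pluripolar hull $K^*$ is an $F_\sigma$ set (a countable union of closed sets).
   Context: Let $\omega:=dd^c\log|Z|=\frac{i}{2\pi}\partial\bar\partial\log(|Z_0|^2+\cdots+|Z_n|^2)$ be the Fubini–Study form on complex projective space $\mathbb{P}^n$, where $d^c=\frac{i}{2\pi}(\bar\partial-\partial)$. A function $\varphi:\mathbb{P}^n\to\mathbb{R}\cup\{-\infty\}$ is $\omega$-plurisubharmonic if $\varphi+\psi$ is plurisubharmonic on $U$ for each open $U\subset\mathbb{P}^n$ and each $C^\infty$ function $\psi$ on $U$ with $dd^c\psi=\omega$; the constant $-\infty$ is considered both plurisubharmonic and $\omega$-plurisubharmonic. $\mathrm{PSH}_\omega(\mathbb{P}^n)$ is the set of all such $\varphi$. A set $E\subset\mathbb{P}^n$ is pluripolar if there is $\varphi\in\mathrm{PSH}_\omega(\mathbb{P}^n)$, $\varphi\not\equiv-\infty$, with $E\subset\{\varphi=-\infty\}$. The pluripolar hull of a pluripolar set $E$ is $E^*=\bigcap\{Z\in\mathbb{P}^n:\varphi(Z)=-\infty\}$, the intersection being over all $\varphi\in\mathrm{PSH}_\omega(\mathbb{P}^n)$ that are $-\infty$ on $E$. *)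

theory Defs
  imports "HOL-Analysis.Analysis"
begin

text \<open>The index type \<open>'n\<close> stands for \<open>{1..n}\<close> and \<open>'n option\<close> for
  \<open>{0..n}\<close>, so that \<open>n = CARD('n) \<ge> 1\<close>; the index \<open>None\<close> plays the role of \<open>0\<close>.\<close>

definition homog_eq :: "complex ^ ('n::finite option) \<Rightarrow> complex ^ ('n option) \<Rightarrow> bool" where
  "homog_eq z w \<longleftrightarrow> z \<noteq> 0 \<and> w \<noteq> 0 \<and> (\<exists>c. w = c *s z)"

lemma part_equivp_homog_eq: "part_equivp (homog_eq :: complex ^ ('n::finite option) \<Rightarrow> _)"
proof (rule part_equivpI)
  show "\<exists>z :: complex ^ ('n option). homog_eq z z"
    by (rule exI[of _ "axis None 1"]) (auto simp: homog_eq_def axis_eq_0_iff intro: exI[of _ 1])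
  show "symp (homog_eq :: complex ^ ('n::finite option) \<Rightarrow> _)"
  proof (rule sympI)
    fix z w :: "complex ^ ('n option)"
    assume "homog_eq z w"
    then obtain c where c: "z \<noteq> 0" "w \<noteq> 0" "w = c *s z" by (auto simp: homog_eq_def)
    then have "c \<noteq> 0" by auto
    with c have "z = inverse c *s w" by (simp add: vector_smult_assoc)
    with c show "homog_eq w z" unfolding homog_eq_def by blast
  qed
  show "transp (homog_eq :: complex ^ ('n::finite option) \<Rightarrow> _)"
    by (rule transpI) (auto simp: homog_eq_def vector_smult_assoc)
qed

quotient_type (overloaded) 'n cproj = "complex ^ ('n::finite option)" / partial: homog_eq
  by (rule part_equivp_homog_eq)

text \<open>\<open>abs_cproj z\<close> is the point with homogeneous coordinates \<open>z\<close>; it is only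
  meaningful for \<open>z \<noteq> 0\<close>. The topology is the quotient topology of \<open>\<complex>\<^sup>n\<^sup>+\<^sup>1 - {0}\<close>.\<close>

instantiation cproj :: (finite) topological_space
begin

definition open_cproj :: "'a cproj set \<Rightarrow> bool" where
  "open_cproj U \<longleftrightarrow> open {z. z \<noteq> 0 \<and> abs_cproj z \<in> U}"

instance
proof
  show "open (UNIV :: 'a cproj set)"
  proof -
    have "{z. z \<noteq> 0} = - {0 :: complex ^ ('a option)}" by auto
    then show ?thesis using open_Compl[OF closed_singleton] by (simp add: open_cproj_def)
  qed
next
  fix S T :: "'a cproj set"
  assume "open S" "open T"
  then have "open ({z. z \<noteq> 0 \<and> abs_cproj z \<in> S} \<inter> {z. z \<noteq> 0 \<and> abs_cproj z \<in> T})"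
    unfolding open_cproj_def by (rule open_Int)
  moreover have "{z. z \<noteq> 0 \<and> abs_cproj z \<in> S} \<inter> {z. z \<noteq> 0 \<and> abs_cproj z \<in> T}
      = {z. z \<noteq> 0 \<and> abs_cproj z \<in> S \<inter> T}" by auto
  ultimately show "open (S \<inter> T)" by (simp add: open_cproj_def)
next
  fix K :: "'a cproj set set"
  assume "\<forall>S\<in>K. open S"
  then have "open (\<Union>S\<in>K. {z. z \<noteq> 0 \<and> abs_cproj z \<in> S})"
    unfolding open_cproj_def by (intro open_UN) auto
  moreover have "(\<Union>S\<in>K. {z. z \<noteq> 0 \<and> abs_cproj z \<in> S}) = {z. z \<noteq> 0 \<and> abs_cproj z \<in> \<Union>K}"
    by auto
  ultimately show "open (\<Union>K)" by (simp add: open_cproj_def)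
qed

end

text \<open>Affine chart on \<open>{Z\<^sub>j \<noteq> 0}\<close>: the coordinate \<open>Z\<^sub>j\<close> is set to \<open>1\<close>. In the chart
  \<open>j = Some k\<close> the \<open>k\<close>-th slot of \<open>w\<close>, which is then free, carries the coordinate \<open>Z\<^sub>0\<close>.\<close>

definition affine_vec :: "'n::finite option \<Rightarrow> complex ^ 'n \<Rightarrow> complex ^ ('n option)" where
  "affine_vec j w = (\<chi> i. if i = j then 1
     else (case i of Some l \<Rightarrow> w $ l | None \<Rightarrow> w $ (the j)))"

definition affine_chart :: "'n::finite option \<Rightarrow> complex ^ 'n \<Rightarrow> 'n cproj" where
  "affine_chart j w = abs_cproj (affine_vec j w)"


text \<open>Lebesgue integral (positive part minus negative part) of \<open>u\<close> over the circle
  \<open>{a + \<zeta> b | \<bar>\<zeta>\<bar> = 1}\<close>, normalised to total mass \<open>1\<close>. For an upper semicontinuous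
  \<open>u < \<infinity>\<close> the first integral is finite, so the difference is never \<open>\<infinity> - \<infinity>\<close>.\<close>

definition circle_mean :: "(complex ^ 'n \<Rightarrow> ereal) \<Rightarrow> complex ^ 'n \<Rightarrow> complex ^ 'n::finite \<Rightarrow> ereal" where
  "circle_mean u a b =
    (enn2ereal (\<integral>\<^sup>+\<theta>\<in>{0..2 * pi}. e2ennreal (u (a + cis \<theta> *s b)) \<partial>lborel)
     - enn2ereal (\<integral>\<^sup>+\<theta>\<in>{0..2 * pi}. e2ennreal (- u (a + cis \<theta> *s b)) \<partial>lborel))
    / ereal (2 * pi)"

text \<open>The function \<open>-\<infinity>\<close> is allowed.\<close>

definition psh_on :: "(complex ^ 'n::finite) set \<Rightarrow> (complex ^ 'n \<Rightarrow> ereal) \<Rightarrow> bool" where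
  "psh_on \<Omega> u \<longleftrightarrow> open \<Omega>
    \<and> (\<forall>z\<in>\<Omega>. u z < \<infinity>)
    \<and> (\<forall>c::ereal. open {z \<in> \<Omega>. u z < c})
    \<and> (\<forall>a b. (\<forall>\<zeta>\<in>cball 0 1. a + \<zeta> *s b \<in> \<Omega>) \<longrightarrow> u a \<le> circle_mean u a b)"

definition cproj_psh_on :: "'n::finite cproj set \<Rightarrow> ('n cproj \<Rightarrow> ereal) \<Rightarrow> bool" where
  "cproj_psh_on U u \<longleftrightarrow> (\<forall>j. psh_on (affine_chart j -` U) (u \<circ> affine_chart j))"


fun Ck_on :: "nat \<Rightarrow> 'a::real_normed_vector set \<Rightarrow> ('a \<Rightarrow> 'b::real_normed_vector) \<Rightarrow> bool" where
  "Ck_on 0 S f \<longleftrightarrow> continuous_on S f"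
| "Ck_on (Suc k) S f \<longleftrightarrow> (\<forall>x\<in>S. f differentiable (at x))
     \<and> (\<forall>v. Ck_on k S (\<lambda>x. frechet_derivative f (at x) v))"

definition smooth_on :: "'a::real_normed_vector set \<Rightarrow> ('a \<Rightarrow> 'b::real_normed_vector) \<Rightarrow> bool" where
  "smooth_on S f \<longleftrightarrow> (\<forall>k. Ck_on k S f)"

text \<open>A \<open>1\<close>-form on an open subset of \<open>\<complex>\<^sup>n\<close> is a function of a point and a tangent
  vector, a \<open>2\<close>-form a function of a point and two tangent vectors.\<close>

definition dolbeault_del :: "(complex ^ 'n::finite \<Rightarrow> complex) \<Rightarrow> complex ^ 'n \<Rightarrow> complex ^ 'n \<Rightarrow> complex" where
  "dolbeault_del f p v =
    (frechet_derivative f (at p) v - \<i> * frechet_derivative f (at p) (\<i> *s v)) / 2"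

definition dolbeault_delbar :: "(complex ^ 'n::finite \<Rightarrow> complex) \<Rightarrow> complex ^ 'n \<Rightarrow> complex ^ 'n \<Rightarrow> complex" where
  "dolbeault_delbar f p v =
    (frechet_derivative f (at p) v + \<i> * frechet_derivative f (at p) (\<i> *s v)) / 2"

definition dc :: "(complex ^ 'n::finite \<Rightarrow> complex) \<Rightarrow> complex ^ 'n \<Rightarrow> complex ^ 'n \<Rightarrow> complex" where
  "dc f p v = \<i> / (2 * pi) * (dolbeault_delbar f p v - dolbeault_del f p v)"

definition ext_deriv ::
  "(complex ^ 'n::finite \<Rightarrow> complex ^ 'n \<Rightarrow> complex) \<Rightarrow> complex ^ 'n \<Rightarrow> complex ^ 'n \<Rightarrow> complex ^ 'n \<Rightarrow> complex" where
  "ext_deriv \<alpha> p v w =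
    frechet_derivative (\<lambda>q. \<alpha> q w) (at p) v - frechet_derivative (\<lambda>q. \<alpha> q v) (at p) w"

definition ddc :: "(complex ^ 'n::finite \<Rightarrow> complex) \<Rightarrow> complex ^ 'n \<Rightarrow> complex ^ 'n \<Rightarrow> complex ^ 'n \<Rightarrow> complex" where
  "ddc f = ext_deriv (dc f)"

text \<open>The Fubini--Study form \<open>\<omega> = dd\<^sup>c log \<bar>Z\<bar>\<close> in the \<open>j\<close>-th chart, that is, the pullback of
  \<open>dd\<^sup>c log \<bar>Z\<bar>\<close> by the section \<open>affine_vec j\<close>.\<close>

definition fubini_study :: "'n::finite option \<Rightarrow> complex ^ 'n \<Rightarrow> complex ^ 'n \<Rightarrow> complex ^ 'n \<Rightarrow> complex" where
  "fubini_study j = ddc (\<lambda>w. of_real (ln (norm (affine_vec j w))))"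

text \<open>\<open>\<psi>\<close> is \<open>C\<^sup>\<infinity>\<close> on the open set \<open>U\<close> and \<open>dd\<^sup>c \<psi> = \<omega>\<close> there.\<close>

definition fs_potential_on :: "'n::finite cproj set \<Rightarrow> ('n cproj \<Rightarrow> real) \<Rightarrow> bool" where
  "fs_potential_on U \<psi> \<longleftrightarrow> open U
    \<and> (\<forall>j. smooth_on (affine_chart j -` U) (\<psi> \<circ> affine_chart j)
         \<and> (\<forall>p \<in> affine_chart j -` U.
              ddc (\<lambda>w. of_real (\<psi> (affine_chart j w))) p = fubini_study j p))"

definition PSH_omega :: "('n::finite cproj \<Rightarrow> ereal) set" where
  "PSH_omega = {\<phi>. (\<forall>Z. \<phi> Z \<noteq> \<infinity>)
    \<and> (\<forall>U \<psi>. fs_potential_on U \<psi> \<longrightarrow> cproj_psh_on U (\<lambda>Z. \<phi> Z + ereal (\<psi> Z)))}"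

definition pluripolar :: "'n::finite cproj set \<Rightarrow> bool" where
  "pluripolar E \<longleftrightarrow> (\<exists>\<phi>\<in>PSH_omega. \<phi> \<noteq> (\<lambda>_. -\<infinity>) \<and> E \<subseteq> {Z. \<phi> Z = -\<infinity>})"

definition pluripolar_hull :: "'n::finite cproj set \<Rightarrow> 'n cproj set" where
  "pluripolar_hull E = (\<Inter>\<phi>\<in>{\<phi>\<in>PSH_omega. \<forall>Z\<in>E. \<phi> Z = -\<infinity>}. {Z. \<phi> Z = -\<infinity>})"

end

theory Submission
  imports Defs "HOL-Complex_Analysis.Cauchy_Integral_Formula"
begin

text \<open>
  Let \<open>K\<close> be compact. For a real number \<open>M\<close> consider the functions \<open>\<phi> \<le> 0\<close> in \<open>PSH_omega\<close> with
  \<open>\<phi> \<le> -M\<close> on \<open>K\<close>, and let \<open>shallow_set K M\<close> be the union of the interiors of the sets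
  \<open>{\<phi> \<ge> -1}\<close>. This set is open by construction, and the theorem follows because the complement of
  the hull of \<open>K\<close> is the intersection of the sets \<open>shallow_set K m\<close> over all natural numbers \<open>m\<close>.

  If \<open>Z\<close> lies in all these sets, choose \<open>\<phi>\<^sub>k\<close> with \<open>\<phi>\<^sub>k \<le> -4\<^sup>k\<close> on \<open>K\<close> and \<open>\<phi>\<^sub>k Z \<ge> -1\<close>. The
  sum of the functions \<open>\<phi>\<^sub>k / 2\<^sup>k\<^sup>+\<^sup>1\<close> belongs to \<open>PSH_omega\<close>, is \<open>-\<infinity>\<close> on \<open>K\<close> and at least \<open>-1\<close>
  at \<open>Z\<close>, so \<open>Z\<close> is not in the hull (\<open>PSH_omega_infinite_sum\<close>).

  Conversely let \<open>\<phi>\<close> be \<open>-\<infinity>\<close> on \<open>K\<close> and finite at \<open>Z\<close>. After subtracting a constant and scaling,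
  \<open>\<phi> \<le> 0\<close> and \<open>\<phi> Z \<ge> -1/2\<close>. It remains to trade the lower bound at the point \<open>Z\<close> for one on
  a neighbourhood (\<open>PSH_omega_approx_near\<close>), keeping the upper bounds up to a small error. To this end, replace
  the lift \<open>u z = \<phi> [z] + log \<bar>z\<bar>\<close> of \<open>\<phi>\<close> by
  the maximum of \<open>u (z + z\<^sub>j v)\<close> over \<open>\<bar>v\<bar> \<le> r\<close>, where \<open>Z\<^sub>j \<noteq> 0\<close>. A maximum of this kind over a compact family of
  linear maps is again plurisubharmonic and logarithmically homogeneous. It is at least \<open>u z\<^sub>0\<close> at every \<open>z\<close>
  near \<open>z\<^sub>0\<close>, because some such shear carries \<open>z\<close> to \<open>z\<^sub>0\<close>. By upper semicontinuity it decreases to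
  \<open>u\<close> as \<open>r\<close> tends to \<open>0\<close>, so compactness of \<open>K\<close> keeps it below \<open>-M\<close> on \<open>K\<close> for small \<open>r\<close>.

  The argument lives on the cone \<open>\<complex>\<^sup>n\<^sup>+\<^sup>1 - {0}\<close>, so membership in \<open>PSH_omega\<close> is first shown to be the same as
  plurisubharmonicity of the lift there (\<open>PSH_omega_log_lift\<close>, \<open>log_lift_PSH_omega\<close>). Both directions need a
  form of the submean inequality that is local, insensitive to holomorphic changes of the parameter of a disc and
  stable under adding functions whose Levi form vanishes. This is the viscosity
  condition \<open>visc_subharmonic0\<close>; its equivalence with the submean inequality is \<open>psh_on_iff_visc\<close>.
\<close>

section \<open>Upper semicontinuous functions\<close>

lemma norm_smult: "norm (c *s (v :: complex ^ 'n::finite)) = norm c * norm v"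
  unfolding norm_vec_def vector_smult_component norm_mult
  by (simp add: L2_set_right_distrib)

lemma bounded_bilinear_smult:
  "bounded_bilinear ((*s) :: complex \<Rightarrow> complex ^ 'n \<Rightarrow> complex ^ 'n::finite)"
  by (rule bounded_bilinear.intro)
    (auto simp: vec_eq_iff algebra_simps norm_smult intro!: exI[of _ 1])

lemmas continuous_on_smult [continuous_intros] = bounded_bilinear.continuous_on[OF bounded_bilinear_smult]

text \<open>Stated relative to \<open>S\<close>, so that it applies to compact sets and circles as well as to open sets.\<close>

definition usc_on :: "'a::topological_space set \<Rightarrow> ('a \<Rightarrow> ereal) \<Rightarrow> bool" where
  "usc_on S u \<longleftrightarrow> (\<forall>c. openin (top_of_set S) {x \<in> S. u x < c})"

lemma usc_on_open: "open S \<Longrightarrow> usc_on S u \<longleftrightarrow> (\<forall>c. open {x \<in> S. u x < c})"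
  unfolding usc_on_def by (auto simp: openin_open_eq)

lemma usc_on_compose:
  assumes "usc_on S u" "continuous_on T f" "f ` T \<subseteq> S"
  shows "usc_on T (\<lambda>x. u (f x))"
  unfolding usc_on_def
proof
  fix c
  have "openin (top_of_set T) (T \<inter> f -` {x \<in> S. u x < c})"
    using assms continuous_openin_preimage[of T f S "{x \<in> S. u x < c}"]
    unfolding usc_on_def by (auto simp: Pi_iff image_subset_iff)
  also have "T \<inter> f -` {x \<in> S. u x < c} = {x \<in> T. u (f x) < c}" using assms(3) by auto
  finally show "openin (top_of_set T) {x \<in> T. u (f x) < c}" .
qed

lemma usc_on_subset: "usc_on S u \<Longrightarrow> T \<subseteq> S \<Longrightarrow> usc_on T u"
  using usc_on_compose[of S u T "\<lambda>x. x"] by (auto simp: continuous_on_id)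

lemma usc_on_cong: "(\<And>x. x \<in> S \<Longrightarrow> u x = v x) \<Longrightarrow> usc_on S u \<longleftrightarrow> usc_on S v"
  unfolding usc_on_def by (simp cong: conj_cong)

lemma usc_on_locally:
  assumes "open S" "\<And>x. x \<in> S \<Longrightarrow> \<exists>T. open T \<and> x \<in> T \<and> T \<subseteq> S \<and> usc_on T u"
  shows "usc_on S u"
  unfolding usc_on_open[OF assms(1)]
proof
  fix c
  show "open {x \<in> S. u x < c}"
  proof (subst open_subopen, safe)
    fix x assume x: "x \<in> S" "u x < c"
    then obtain T where T: "open T" "x \<in> T" "T \<subseteq> S" "usc_on T u" using assms(2) by blast
    then have "open {x \<in> T. u x < c}" by (simp add: usc_on_open)
    then show "\<exists>T. open T \<and> x \<in> T \<and> T \<subseteq> {x \<in> S. u x < c}" using T x by blast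
  qed
qed

lemma usc_on_continuous: "continuous_on S f \<Longrightarrow> usc_on S (\<lambda>x. ereal (f x))"
  unfolding usc_on_def
proof
  fix c assume f: "continuous_on S f"
  have "continuous_on S (\<lambda>x. ereal (f x))" using f by (simp add: continuous_on_ereal)
  from continuous_openin_preimage_gen[OF this open_lessThan[of c]]
  show "openin (top_of_set S) {x \<in> S. ereal (f x) < c}" by (simp add: vimage_def Int_def)
qed

text \<open>If \<open>u x + v x < c\<close>, a real number \<open>q\<close> separates the two summands; the sublevel set of the sum is
  therefore a union over \<open>q\<close> of intersections of sublevel sets.\<close>

lemma usc_on_add:
  assumes "usc_on S u" "usc_on S v" "\<And>x. x \<in> S \<Longrightarrow> u x < \<infinity>" "\<And>x. x \<in> S \<Longrightarrow> v x < \<infinity>"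
  shows "usc_on S (\<lambda>x. u x + v x)"
  unfolding usc_on_def
proof
  fix c
  have "{x \<in> S. u x + v x < c} = (\<Union>q. {x \<in> S. u x < ereal q} \<inter> {x \<in> S. v x < c - ereal q})"
    (is "?L = ?R")
  proof
    show "?L \<subseteq> ?R"
    proof
      fix x assume x: "x \<in> ?L"
      have "\<exists>q. u x < ereal q \<and> v x < c - ereal q"
      proof (cases "v x")
        case (real r)
        have "u x < c - ereal r" using x real by (cases "u x"; cases c) auto
        then obtain q where "u x < ereal q" "ereal q < c - ereal r" using ereal_dense2 by blast
        then show ?thesis using real by (intro exI[of _ q]) (cases c; auto)
      next
        case PInf then show ?thesis using assms(4) x by auto
      next
        case MInf
        obtain q where "u x < ereal q" using assms(3) x ereal_dense2 by blast
        moreover have "c \<noteq> - \<infinity>" using x by auto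
        ultimately show ?thesis using MInf by (intro exI[of _ q]) (cases c; auto)
      qed
      then show "x \<in> ?R" using x by auto
    qed
    show "?R \<subseteq> ?L"
    proof clarify
      fix x q assume "x \<in> S" "u x < ereal q" "v x < c - ereal q"
      then show "u x + v x < c" by (cases "u x"; cases "v x"; cases c) auto
    qed
  qed
  also have "openin (top_of_set S) ..."
    using assms(1,2) unfolding usc_on_def by (intro openin_Union) (auto intro!: openin_Int)
  finally show "openin (top_of_set S) {x \<in> S. u x + v x < c}" .
qed

lemma usc_on_attains_max:
  assumes "usc_on D u" "compact D" "D \<noteq> {}"
  obtains x where "x \<in> D" "\<And>y. y \<in> D \<Longrightarrow> u y \<le> u x"
proof (rule ccontr)
  assume "\<not> thesis"
  then have *: "\<And>x. x \<in> D \<Longrightarrow> \<exists>y\<in>D. u x < u y" using that by (meson not_le)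
  have "\<exists>T. open T \<and> {x \<in> D. u x < u y} = D \<inter> T" for y
    using assms(1) unfolding usc_on_def openin_open by blast
  then obtain T where T: "\<And>y. open (T y)" "\<And>y. {x \<in> D. u x < u y} = D \<inter> T y" by metis
  have "D \<subseteq> (\<Union>y\<in>D. T y)" using * T(2) by blast
  then obtain F where F: "F \<subseteq> D" "finite F" "D \<subseteq> (\<Union>y\<in>F. T y)"
    using compactE_image[OF assms(2), of D T] T(1) by metis
  have "F \<noteq> {}" using F assms(3) by auto
  then have "Max (u ` F) \<in> u ` F" using F by (intro Max_in) auto
  then obtain y where y: "y \<in> F" "u y = Max (u ` F)" by auto
  then obtain y' where y': "y' \<in> F" "y \<in> T y'" using F by blast
  then have "u y < u y'" using T(2)[of y'] y F by blast
  moreover have "u y' \<le> Max (u ` F)" using y' F by (intro Max_ge) auto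
  ultimately show False using y by simp
qed

section \<open>Circle means\<close>

text \<open>Cauchy's formula at the centre of the circle, reparametrised by \<open>\<theta> \<in> [0, 2\<pi>]\<close>.\<close>

lemma mean_value_Re_holomorphic:
  assumes "h holomorphic_on cball 0 r" "r > 0"
  shows "((\<lambda>\<theta>. Re (h (of_real r * cis \<theta>))) has_integral (2 * pi * Re (h 0))) {0..2 * pi}"
proof -
  have "((\<lambda>u. h u / (u - 0)) has_contour_integral (2 * of_real pi * \<i> * h 0)) (circlepath 0 r)"
    by (rule Cauchy_integral_circlepath_simple) (use assms in auto)
  then have "((\<lambda>x. h (circlepath 0 r x) / (circlepath 0 r x - 0) *
      vector_derivative (circlepath 0 r) (at x)) has_integral (2 * of_real pi * \<i> * h 0)) {0..1}"
    unfolding has_contour_integral by simp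
  then have "((\<lambda>x. 2 * pi * \<i> * h (of_real r * cis (2 * pi * x))) has_integral (2 * of_real pi * \<i> * h 0)) {0..1}"
    by (rule has_integral_eq[rotated])
      (use assms(2) in \<open>simp add: vector_derivative_circlepath, simp add: circlepath cis_conv_exp mult_ac\<close>)
  then have "((\<lambda>x. (1 / \<i>) * (2 * pi * \<i> * h (of_real r * cis (2 * pi * x)))) has_integral
     (1 / \<i>) * (2 * of_real pi * \<i> * h 0)) {0..1}"
    by (rule has_integral_mult_right)
  then have "((\<lambda>x. Re ((1 / \<i>) * (2 * pi * \<i> * h (of_real r * cis (2 * pi * x))))) has_integral
     Re ((1 / \<i>) * (2 * of_real pi * \<i> * h 0))) {0..1}"
    by (rule has_integral_Re)
  then have "((\<lambda>x. 2 * pi * Re (h (of_real r * cis (2 * pi * x)))) has_integral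
     (2 * pi * Re (h 0))) (cbox 0 (1::real))"
    by (simp add: field_simps)
  from has_integral_affinity'[OF this, of "1 / (2 * pi)" 0]
  have "((\<lambda>x. 2 * pi * Re (h (of_real r * cis x))) has_integral
     (2 * pi * (2 * pi * Re (h 0)))) {0..2 * pi}"
    by (simp add: mult_ac)
  from has_integral_mult_right[OF this, of "1 / (2 * pi)"]
  show ?thesis by (simp add: mult_ac)
qed

lemma usc_on_borel_measurable:
  fixes f :: "real \<Rightarrow> ereal"
  assumes "usc_on UNIV f"
  shows "f \<in> borel_measurable borel"
proof (rule borel_measurableI_less)
  fix y
  have "open {x. f x < y}" using assms by (simp add: usc_on_open)
  then show "{x \<in> space borel. f x < y} \<in> sets borel" by simp
qed

lemma usc_on_circle:
  fixes a b :: "complex ^ 'n::finite"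
  assumes "usc_on \<Omega> u" "\<And>\<theta>. a + cis \<theta> *s b \<in> \<Omega>"
  shows "(\<lambda>\<theta>. u (a + cis \<theta> *s b)) \<in> borel_measurable borel"
proof (rule usc_on_borel_measurable)
  have "continuous_on UNIV (\<lambda>\<theta>. a + cis \<theta> *s b)"
    by (intro continuous_intros)
  then show "usc_on UNIV (\<lambda>\<theta>. u (a + cis \<theta> *s b))"
    by (rule usc_on_compose[OF assms(1)]) (use assms(2) in auto)
qed

lemma usc_on_bounded_above:
  assumes "usc_on D u" "compact D" "\<And>x. x \<in> D \<Longrightarrow> u x < \<infinity>"
  obtains C where "C \<ge> 0" "\<And>x. x \<in> D \<Longrightarrow> u x \<le> ereal C"
proof (cases "D = {}")
  case True
  then show ?thesis using that[of 0] by auto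
next
  case False
  then obtain x where x: "x \<in> D" "\<And>y. y \<in> D \<Longrightarrow> u y \<le> u x"
    using usc_on_attains_max assms by blast
  then obtain r where "u x < ereal r" using assms(3) ereal_dense2 by blast
  then have "u y \<le> ereal (max r 0)" if "y \<in> D" for y
  proof -
    have "u y \<le> ereal r" using x(2)[OF that] \<open>u x < ereal r\<close> by simp
    also have "\<dots> \<le> ereal (max r 0)" by simp
    finally show ?thesis .
  qed
  then show ?thesis using that[of "max r 0"] by auto
qed

lemma usc_on_circle_bounded:
  fixes a b :: "complex ^ 'n::finite"
  assumes "usc_on \<Omega> u" "\<And>z. z \<in> \<Omega> \<Longrightarrow> u z < \<infinity>" "\<And>\<theta>. a + cis \<theta> *s b \<in> \<Omega>"
  obtains C where "C \<ge> 0" "\<And>\<theta>. u (a + cis \<theta> *s b) \<le> ereal C"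
proof -
  have c: "continuous_on (sphere 0 1) (\<lambda>\<zeta>. a + \<zeta> *s b)" by (intro continuous_intros)
  have s: "sphere 0 1 = range cis"
  proof (intro equalityI subsetI)
    fix z :: complex assume "z \<in> sphere 0 1"
    then have "cmod z = 1" "z \<noteq> 0" by auto
    then have "z = cis (Arg z)" by (simp add: cis_Arg sgn_div_norm)
    then show "z \<in> range cis" by (metis rangeI)
  qed auto
  define D where "D = (\<lambda>\<zeta>. a + \<zeta> *s b) ` sphere 0 1"
  have sub: "D \<subseteq> \<Omega>" using assms(3) unfolding s D_def by auto
  have "compact D" unfolding D_def using c by (rule compact_continuous_image) simp
  then obtain C where C: "C \<ge> 0" "\<And>x. x \<in> D \<Longrightarrow> u x \<le> ereal C"
    using usc_on_bounded_above[OF usc_on_subset[OF assms(1) sub]] assms(2) sub by blast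
  have "a + cis \<theta> *s b \<in> D" for \<theta> unfolding D_def by (rule imageI) simp
  then show ?thesis using that C by blast
qed

text \<open>Below a bound \<open>C\<close> the circle mean, defined as a difference of two integrals of extended reals, becomes a
  single integral of the nonnegative function \<open>C - u\<close>. All later limit arguments use this form, since monotone
  convergence applies to it directly.\<close>

lemma circle_mean_eq:
  assumes meas: "(\<lambda>\<theta>. u (a + cis \<theta> *s b)) \<in> borel_measurable borel"
    and C: "C \<ge> 0" "\<And>\<theta>. u (a + cis \<theta> *s b) \<le> ereal C"
  shows "circle_mean u a b = ereal C -
    enn2ereal (\<integral>\<^sup>+\<theta>\<in>{0..2 * pi}. e2ennreal (ereal C - u (a + cis \<theta> *s b)) \<partial>lborel) / ereal (2 * pi)"
proof -
  define f where "f = (\<lambda>\<theta>. u (a + cis \<theta> *s b))"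
  have [measurable]: "f \<in> borel_measurable borel" using meas by (simp add: f_def)
  have fC: "f \<theta> \<le> ereal C" for \<theta> using C(2) by (simp add: f_def)
  define I where "I = (\<integral>\<^sup>+\<theta>\<in>{0..2 * pi}. e2ennreal (ereal C - f \<theta>) \<partial>lborel)"
  define P where "P = (\<integral>\<^sup>+\<theta>\<in>{0..2 * pi}. e2ennreal (f \<theta>) \<partial>lborel)"
  define N where "N = (\<integral>\<^sup>+\<theta>\<in>{0..2 * pi}. e2ennreal (- f \<theta>) \<partial>lborel)"
  \<comment> \<open>\<open>(C - f) + f\<^sup>+ = C + f\<^sup>-\<close>, written without subtraction so that it survives the value \<open>\<infinity>\<close>\<close>
  have pt: "e2ennreal (ereal C - f \<theta>) + e2ennreal (f \<theta>) = ennreal C + e2ennreal (- f \<theta>)" for \<theta>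
  proof (cases "f \<theta>")
    case (real r)
    then show ?thesis using fC[of \<theta>] C(1)
      by (cases "r \<ge> 0") (simp_all add: ennreal_neg flip: ennreal_plus)
  qed (use fC[of \<theta>] in \<open>auto simp: e2ennreal_neg\<close>)
  have const: "(\<integral>\<^sup>+\<theta>\<in>{0..2 * pi}. ennreal C \<partial>lborel) = ennreal (2 * pi * C)"
    using C(1) by (simp add: nn_integral_cmult_indicator flip: ennreal_mult)
  have IP: "I + P = ennreal (2 * pi * C) + N"
  proof -
    have "I + P = (\<integral>\<^sup>+\<theta>. (e2ennreal (ereal C - f \<theta>) * indicator {0..2 * pi} \<theta>
        + e2ennreal (f \<theta>) * indicator {0..2 * pi} \<theta>) \<partial>lborel)"
      unfolding I_def P_def by (subst nn_integral_add) auto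
    also have "\<dots> = (\<integral>\<^sup>+\<theta>. (ennreal C * indicator {0..2 * pi} \<theta>
        + e2ennreal (- f \<theta>) * indicator {0..2 * pi} \<theta>) \<partial>lborel)"
      by (intro nn_integral_cong) (simp add: pt flip: distrib_right)
    also have "\<dots> = ennreal (2 * pi * C) + N"
      unfolding N_def const[symmetric] by (subst nn_integral_add) auto
    finally show ?thesis .
  qed
  have "P \<le> (\<integral>\<^sup>+\<theta>\<in>{0..2 * pi}. ennreal C \<partial>lborel)"
    unfolding P_def using fC
    by (intro nn_integral_mono mult_right_mono) (auto simp flip: e2ennreal_ereal intro: e2ennreal_mono)
  then have "P < \<infinity>" using const by (simp add: order.strict_trans1)
  then obtain p where p: "P = ennreal p" "p \<ge> 0" by (cases P) auto
  have "(enn2ereal P - enn2ereal N) / ereal (2 * pi) = ereal C - enn2ereal I / ereal (2 * pi)"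
  proof (cases N)
    case (real n)
    have "I < \<infinity>" using IP real C(1) p by (cases I) (auto simp flip: ennreal_plus)
    then obtain i where i: "I = ennreal i" "i \<ge> 0" by (cases I) auto
    have "ennreal (i + p) = ennreal (2 * pi * C + n)"
      using IP real p i C(1) by (simp add: ennreal_plus)
    then have "i + p = 2 * pi * C + n"
      using p i real C(1) by (subst (asm) ennreal_inj) (auto intro!: add_nonneg_nonneg)
    then show ?thesis using p i real by (simp add: field_simps enn2ereal_ennreal)
  next
    case top
    then have "I = \<infinity>" using IP p by (cases I) (auto simp flip: ennreal_plus)
    then show ?thesis using p top by (simp add: enn2ereal_ennreal)
  qed
  then show ?thesis by (simp add: circle_mean_def P_def N_def I_def f_def)
qed

lemma nn_integral_const_minus:
  assumes "(g has_integral G) {0..2 * pi}" "\<And>\<theta>. \<theta> \<in> {0..2 * pi} \<Longrightarrow> g \<theta> \<le> C"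
  shows "(\<integral>\<^sup>+\<theta>\<in>{0..2 * pi}. ennreal (C - g \<theta>) \<partial>lborel) = ennreal (2 * pi * C - G)"
    "G \<le> 2 * pi * C"
proof -
  have h: "((\<lambda>\<theta>. C - g \<theta>) has_integral (2 * pi * C - G)) {0..2 * pi}"
    using has_integral_diff[OF has_integral_const_real[of C 0 "2*pi"] assms(1)] by simp
  from nn_integral_has_integral_lebesgue'[OF _ h] assms(2)
  show "(\<integral>\<^sup>+\<theta>\<in>{0..2 * pi}. ennreal (C - g \<theta>) \<partial>lborel) = ennreal (2 * pi * C - G)" by auto
  show "G \<le> 2 * pi * C" using has_integral_nonneg[OF h] assms(2) by auto
qed

lemma circle_mean_le_integral:
  fixes a b :: "complex ^ 'n::finite"
  assumes u: "usc_on \<Omega> u" "\<And>z. z \<in> \<Omega> \<Longrightarrow> u z < \<infinity>" "\<And>\<theta>. a + cis \<theta> *s b \<in> \<Omega>"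
    and g: "(g has_integral G) {0..2 * pi}" "continuous_on {0..2 * pi} g"
      "\<And>\<theta>. \<theta> \<in> {0..2 * pi} \<Longrightarrow> u (a + cis \<theta> *s b) \<le> ereal (g \<theta>)"
  shows "circle_mean u a b \<le> ereal (G / (2 * pi))"
proof -
  obtain C0 where C0: "C0 \<ge> 0" "\<And>\<theta>. u (a + cis \<theta> *s b) \<le> ereal C0"
    using usc_on_circle_bounded[OF u] by blast
  have "bounded (g ` {0..2 * pi})"
    using g(2) compact_continuous_image compact_imp_bounded by blast
  then obtain C1 where C1: "\<And>\<theta>. \<theta> \<in> {0..2 * pi} \<Longrightarrow> g \<theta> \<le> C1"
    unfolding bounded_iff by (metis abs_le_iff imageI real_norm_def)
  define C where "C = max C0 C1"
  have C: "C \<ge> 0" "u (a + cis \<theta> *s b) \<le> ereal C" for \<theta>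
    using C0(1) C0(2)[of \<theta>] by (auto simp: C_def ereal_max[symmetric] intro: order.trans simp del: ereal_max)
  have gC: "\<And>\<theta>. \<theta> \<in> {0..2 * pi} \<Longrightarrow> g \<theta> \<le> C" using C1 unfolding C_def le_max_iff_disj by blast
  let ?I = "\<integral>\<^sup>+\<theta>\<in>{0..2 * pi}. e2ennreal (ereal C - u (a + cis \<theta> *s b)) \<partial>lborel"
  have "ennreal (2 * pi * C - G) = (\<integral>\<^sup>+\<theta>\<in>{0..2 * pi}. ennreal (C - g \<theta>) \<partial>lborel)"
    using nn_integral_const_minus(1)[OF g(1) gC] by simp
  also have "\<dots> \<le> ?I"
  proof (rule nn_integral_mono)
    fix \<theta>
    show "ennreal (C - g \<theta>) * indicator {0..2 * pi} \<theta>
      \<le> e2ennreal (ereal C - u (a + cis \<theta> *s b)) * indicator {0..2 * pi} \<theta>"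
    proof (cases "\<theta> \<in> {0..2 * pi}")
      case True
      have "ereal (C - g \<theta>) \<le> ereal C - u (a + cis \<theta> *s b)"
        using g(3)[OF True] by (cases "u (a + cis \<theta> *s b)") auto
      from e2ennreal_mono[OF this] show ?thesis using True by simp
    qed simp
  qed
  finally have "ereal (2 * pi * C - G) \<le> enn2ereal ?I"
    using nn_integral_const_minus(2)[OF g(1) gC] by (simp add: less_eq_ennreal.rep_eq enn2ereal_ennreal)
  moreover have "C - r / (2 * pi) \<le> G / (2 * pi)" if "2 * pi * C - G \<le> r" for r
  proof -
    have "(2 * pi * C - r) / (2 * pi) \<le> G / (2 * pi)" using that by (intro divide_right_mono) auto
    then show ?thesis by (simp add: diff_divide_distrib)
  qed
  ultimately have "ereal C - enn2ereal ?I / ereal (2 * pi) \<le> ereal (G / (2 * pi))"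
    by (cases "enn2ereal ?I") auto
  then show ?thesis using circle_mean_eq[OF usc_on_circle[OF u(1,3)] C] by simp
qed

text \<open>An upper semicontinuous function that is bounded above is a decreasing limit of continuous functions. The
  approximants are the Lipschitz regularisations \<open>g\<^sub>k z = sup\<^sub>y (max (w y) (-k) - k dist z y)\<close>, where the cutoff at \<open>-k\<close>
  keeps them finite.\<close>

lemma usc_on_continuous_majorants:
  fixes w :: "'a::metric_space \<Rightarrow> ereal"
  assumes w: "usc_on S w" "\<And>z. z \<in> S \<Longrightarrow> w z \<le> ereal C" and "bounded S" "C \<ge> 0"
  obtains g :: "nat \<Rightarrow> 'a \<Rightarrow> real" where
    "\<And>k. continuous_on S (g k)" "\<And>k z. z \<in> S \<Longrightarrow> g k z \<le> C"
    "\<And>k z. z \<in> S \<Longrightarrow> w z \<le> ereal (g k z)" "\<And>k z. z \<in> S \<Longrightarrow> g (Suc k) z \<le> g k z"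
    "\<And>z c. z \<in> S \<Longrightarrow> w z < ereal c \<Longrightarrow> \<exists>k. g k z \<le> c"
proof -
  define t where "t k y = real_of_ereal (max (w y) (- ereal (real k)))" for k y
  have t: "ereal (t k y) = max (w y) (- ereal (real k))" if "y \<in> S" for k y
    using w(2)[OF that] unfolding t_def by (cases "w y") (auto simp: max_def)
  have tC: "t k y \<le> C" if "y \<in> S" for k y
  proof -
    have "- ereal (real k) \<le> ereal C" using assms(4) by simp
    then have "ereal (t k y) \<le> ereal C" unfolding t[OF that] using w(2)[OF that] by simp
    then show ?thesis by simp
  qed
  have tmono: "t (Suc k) y \<le> t k y" if "y \<in> S" for k y
  proof -
    have "ereal (t (Suc k) y) \<le> ereal (t k y)" unfolding t[OF that] by (intro max.mono) auto
    then show ?thesis by simp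
  qed
  define g where "g k z = (SUP y\<in>S. t k y - real k * dist z y)" for k z
  have bdd: "bdd_above ((\<lambda>y. t k y - real k * dist z y) ` S)" for k z
    by (rule bdd_aboveI2[of _ _ C]) (smt (verit) tC mult_nonneg_nonneg of_nat_0_le_iff zero_le_dist)
  have up: "t k y - real k * dist z y \<le> g k z" if "y \<in> S" for k y z
    unfolding g_def by (rule cSUP_upper[OF that bdd])
  have least: "g k z \<le> M" if "S \<noteq> {}" "\<And>y. y \<in> S \<Longrightarrow> t k y - real k * dist z y \<le> M" for k z M
    unfolding g_def using that by (intro cSUP_least) auto
  show ?thesis
  proof (cases "S = {}")
    case True
    then show ?thesis using that[of "\<lambda>_ _. 0"] by auto
  next
    case S: False
    have lip: "g k z \<le> g k z' + real k * dist z z'" for k z z'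
    proof (rule least[OF S])
      fix y assume y: "y \<in> S"
      have "real k * dist z' y \<le> real k * (dist z z' + dist z y)"
        by (intro mult_left_mono) (metis dist_commute dist_triangle, simp)
      then show "t k y - real k * dist z y \<le> g k z' + real k * dist z z'"
        using up[OF y, of k z'] by (simp add: algebra_simps)
    qed
    have c: "continuous_on S (g k)" for k
    proof -
      have "\<bar>g k z - g k z'\<bar> \<le> real k * dist z z'" for z z'
        using lip[of k z z'] lip[of k z' z] by (simp add: dist_commute abs_le_iff)
      then have "(real k)-lipschitz_on S (g k)"
        by (intro lipschitz_onI) (auto simp: dist_real_def)
      then show ?thesis by (rule lipschitz_on_continuous_on)
    qed
    show ?thesis
    proof (rule that[of g])
      show "g k z \<le> C" if "z \<in> S" for k z
      proof (rule least[OF S])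
        fix y assume "y \<in> S"
        then have "t k y \<le> C" "real k * dist z y \<ge> 0" using tC by auto
        then show "t k y - real k * dist z y \<le> C" by linarith
      qed
      show "w z \<le> ereal (g k z)" if "z \<in> S" for k z
      proof -
        have "w z \<le> ereal (t k z)" unfolding t[OF that] by simp
        also have "t k z \<le> g k z" using up[OF that, of k z] by simp
        finally show ?thesis by simp
      qed
      show "g (Suc k) z \<le> g k z" if "z \<in> S" for k z
      proof (rule least[OF S])
        fix y assume y: "y \<in> S"
        have "real k * dist z y \<le> real (Suc k) * dist z y" by (intro mult_right_mono) auto
        then show "t (Suc k) y - real (Suc k) * dist z y \<le> g k z"
          using up[OF y, of k z] tmono[OF y, of k] by linarith
      qed
      show "\<exists>k. g k z \<le> c" if z: "z \<in> S" "w z < ereal c" for z c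
      proof -
        obtain T where T: "open T" "{x \<in> S. w x < ereal c} = S \<inter> T"
          using w(1) unfolding usc_on_def openin_open by metis
        then have "z \<in> T" using z by blast
        then obtain d where d: "d > 0" "ball z d \<subseteq> T" using T(1) openE by blast
        obtain k where "real k \<ge> max ((C - c) / d) (- c)" using real_arch_simple by blast
        then have k: "real k \<ge> (C - c) / d" "real k \<ge> - c" by auto
        show ?thesis
        proof (intro exI[of _ k] least[OF S])
          fix y assume y: "y \<in> S"
          show "t k y - real k * dist z y \<le> c"
          proof (cases "dist z y < d")
            case True
            then have "w y < ereal c" using T d y by auto
            then have "ereal (t k y) \<le> ereal c" unfolding t[OF y] using k(2) by auto
            then have "t k y \<le> c" by simp
            moreover have "real k * dist z y \<ge> 0" by simp
            ultimately show ?thesis by linarith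
          next
            case False
            have "C - c \<le> real k * d" using k(1) d by (simp add: field_simps)
            also have "\<dots> \<le> real k * dist z y" using False by (intro mult_left_mono) auto
            finally show ?thesis using tC[OF y, of k] by linarith
          qed
        qed
      qed
    qed (rule c)
  qed
qed

text \<open>A strict upper bound for the circle mean of \<open>u\<close> already holds for the mean of some continuous majorant,
  by monotone convergence along the regularisations.\<close>

lemma circle_mean_less_continuous:
  fixes a b :: "complex ^ 'n::finite"
  assumes u: "usc_on \<Omega> u" "\<And>z. z \<in> \<Omega> \<Longrightarrow> u z < \<infinity>" "\<And>\<zeta>. cmod \<zeta> = 1 \<Longrightarrow> a + \<zeta> *s b \<in> \<Omega>"
    and less: "circle_mean u a b < ereal x"
  obtains g G where "continuous_on (sphere 0 1) g" "\<And>\<zeta>. cmod \<zeta> = 1 \<Longrightarrow> u (a + \<zeta> *s b) \<le> ereal (g \<zeta>)"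
    "((\<lambda>\<theta>. g (cis \<theta>)) has_integral G) {0..2 * pi}" "G < 2 * pi * x"
proof -
  have u3: "\<And>\<theta>. a + cis \<theta> *s b \<in> \<Omega>" using u(3) by simp
  define w where "w \<zeta> = u (a + \<zeta> *s b)" for \<zeta>
  have w: "usc_on (sphere 0 1) w"
    unfolding w_def by (rule usc_on_compose[OF u(1)]) (use u(3) in \<open>auto intro!: continuous_intros\<close>)
  obtain C where C: "C \<ge> 0" "\<And>z. z \<in> sphere 0 1 \<Longrightarrow> w z \<le> ereal C"
    using usc_on_bounded_above[OF w] u by (auto simp: w_def)
  obtain g where g: "\<And>k. continuous_on (sphere 0 1) (g k)" "\<And>k z. z \<in> sphere 0 1 \<Longrightarrow> g k z \<le> C"
    "\<And>k z. z \<in> sphere 0 1 \<Longrightarrow> w z \<le> ereal (g k z)" "\<And>k z. z \<in> sphere 0 1 \<Longrightarrow> g (Suc k) z \<le> g k z"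
    "\<And>z c. z \<in> sphere 0 1 \<Longrightarrow> w z < ereal c \<Longrightarrow> \<exists>k::nat. g k z \<le> c"
    using usc_on_continuous_majorants[OF w C(2) _ C(1)] by (metis bounded_sphere)
  let ?I = "\<integral>\<^sup>+\<theta>\<in>{0..2 * pi}. e2ennreal (ereal C - u (a + cis \<theta> *s b)) \<partial>lborel"
  have cg: "continuous_on A (\<lambda>\<theta>. g k (cis \<theta>))" for k A
    by (rule continuous_on_compose2[OF g(1)]) (auto intro!: continuous_intros)
  have sup: "(SUP k. ennreal (C - g k (cis \<theta>))) = e2ennreal (ereal C - w (cis \<theta>))" for \<theta>
  proof (rule antisym)
    show "(SUP k. ennreal (C - g k (cis \<theta>))) \<le> e2ennreal (ereal C - w (cis \<theta>))"
    proof (rule SUP_least)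
      fix k
      have "ereal (C - g k (cis \<theta>)) \<le> ereal C - w (cis \<theta>)"
        using g(3)[of "cis \<theta>" k] by (cases "w (cis \<theta>)") auto
      from e2ennreal_mono[OF this] show "ennreal (C - g k (cis \<theta>)) \<le> e2ennreal (ereal C - w (cis \<theta>))" by simp
    qed
    show "e2ennreal (ereal C - w (cis \<theta>)) \<le> (SUP k. ennreal (C - g k (cis \<theta>)))"
    proof (rule dense_le)
      fix y assume y: "y < e2ennreal (ereal C - w (cis \<theta>))"
      then obtain r where r: "y = ennreal r" "r \<ge> 0" by (cases y) auto
      have "ereal r < ereal C - w (cis \<theta>)"
      proof (rule ccontr)
        assume "\<not> ?thesis"
        then have "e2ennreal (ereal C - w (cis \<theta>)) \<le> e2ennreal (ereal r)" by (intro e2ennreal_mono) auto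
        then show False using y r by auto
      qed
      then have "w (cis \<theta>) < ereal (C - r)" by (cases "w (cis \<theta>)") auto
      then obtain k where "g k (cis \<theta>) \<le> C - r" using g(5) by fastforce
      then have "y \<le> ennreal (C - g k (cis \<theta>))" unfolding r(1) by (intro ennreal_leI) simp
      also have "\<dots> \<le> (SUP k. ennreal (C - g k (cis \<theta>)))" by (rule SUP_upper) simp
      finally show "y \<le> (SUP k. ennreal (C - g k (cis \<theta>)))" .
    qed
  qed
  have "?I = (\<integral>\<^sup>+\<theta>. (SUP k. ennreal (C - g k (cis \<theta>)) * indicator {0..2 * pi} \<theta>) \<partial>lborel)"
    by (intro nn_integral_cong) (auto simp: sup[unfolded w_def] split: split_indicator)
  also have "\<dots> = (SUP k. \<integral>\<^sup>+\<theta>. (ennreal (C - g k (cis \<theta>)) * indicator {0..2 * pi} \<theta>) \<partial>lborel)"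
  proof (rule nn_integral_monotone_convergence_SUP)
    show "incseq (\<lambda>k \<theta>. ennreal (C - g k (cis \<theta>)) * indicator {0..2 * pi} \<theta>)"
      by (intro incseq_SucI le_funI mult_right_mono ennreal_leI) (use g(4) in auto)
    fix k
    have "(\<lambda>\<theta>. g k (cis \<theta>)) \<in> borel_measurable borel"
      by (rule borel_measurable_continuous_onI[OF cg])
    then show "(\<lambda>\<theta>. ennreal (C - g k (cis \<theta>)) * indicator {0..2 * pi} \<theta>) \<in> borel_measurable lborel"
      by measurable
  qed
  finally have I: "?I = (SUP k. \<integral>\<^sup>+\<theta>\<in>{0..2 * pi}. ennreal (C - g k (cis \<theta>)) \<partial>lborel)" .
  have "circle_mean u a b = ereal C - enn2ereal ?I / ereal (2 * pi)"
    using circle_mean_eq[OF usc_on_circle[OF u(1) u3] C(1)] C(2) by (simp add: w_def)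
  then have "ereal (2 * pi * (C - x)) < enn2ereal ?I"
    using less by (cases "enn2ereal ?I") (auto simp: field_simps)
  then have "ennreal (2 * pi * (C - x)) < ?I \<or> 2 * pi * (C - x) < 0"
    by (cases "2 * pi * (C - x) < 0") (auto simp: less_ennreal.rep_eq enn2ereal_ennreal)
  then have "\<exists>k. ennreal (2 * pi * (C - x)) < (\<integral>\<^sup>+\<theta>\<in>{0..2 * pi}. ennreal (C - g k (cis \<theta>)) \<partial>lborel) \<or> 2 * pi * (C - x) < 0"
    unfolding I less_SUP_iff by blast
  then obtain k where k: "ennreal (2 * pi * (C - x)) < (\<integral>\<^sup>+\<theta>\<in>{0..2 * pi}. ennreal (C - g k (cis \<theta>)) \<partial>lborel) \<or> 2 * pi * (C - x) < 0"
    by blast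
  have "(\<lambda>\<theta>. g k (cis \<theta>)) integrable_on {0..2 * pi}"
    by (rule integrable_continuous_real[OF cg])
  then obtain G where G: "((\<lambda>\<theta>. g k (cis \<theta>)) has_integral G) {0..2 * pi}" by (auto simp: integrable_on_def)
  have gC: "\<And>\<theta>. g k (cis \<theta>) \<le> C" using g(2) by auto
  have "G < 2 * pi * x"
    using k nn_integral_const_minus[OF G gC]
    proof (cases "C < x")
    case True
    then have "2 * pi * C < 2 * pi * x" by simp
    then show ?thesis using nn_integral_const_minus(2)[OF G gC] by linarith
  next
    case False
    then have nonneg: "0 \<le> 2 * pi * (C - x)" by simp
    then have "ennreal (2 * pi * (C - x)) < ennreal (2 * pi * C - G)"
      using k unfolding nn_integral_const_minus(1)[OF G gC] by simp
    then show ?thesis using nonneg by (simp add: ennreal_less_iff right_diff_distrib)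
  qed
  then show ?thesis using that[of "g k" G] g G by (auto simp: w_def)
qed

section \<open>Touching functions and the submean inequality\<close>

text \<open>Subharmonicity at \<open>0\<close> in the viscosity sense: \<open>f\<close> cannot be touched from above at \<open>0\<close> by a function of the form
  \<open>Re h - \<epsilon> \<bar>\<zeta>\<bar>\<^sup>2\<close>, which is strictly superharmonic.\<close>

definition visc_subharmonic0 :: "(complex \<Rightarrow> ereal) \<Rightarrow> bool" where
  "visc_subharmonic0 f \<longleftrightarrow> (\<forall>h r \<epsilon>. 0 < r \<longrightarrow> h holomorphic_on ball 0 r \<longrightarrow> 0 < \<epsilon> \<longrightarrow> f 0 \<noteq> - \<infinity> \<longrightarrow>
     (\<exists>\<zeta>\<in>ball 0 r. \<not> f \<zeta> \<le> f 0 + ereal (Re (h \<zeta> - h 0) - \<epsilon> * (cmod \<zeta>)\<^sup>2)))"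

lemma psh_on_usc: "psh_on \<Omega> u \<Longrightarrow> usc_on \<Omega> u"
  by (simp add: psh_on_def usc_on_open)

text \<open>A touching function would have a mean over small circles that falls short of its value at the centre by
  \<open>\<epsilon> \<rho>\<^sup>2\<close>, because the mean of \<open>Re h\<close> is \<open>Re (h 0)\<close>.\<close>

lemma submean_imp_visc_subharmonic:
  assumes psh: "psh_on \<Omega> u" and a: "a \<in> \<Omega>"
  shows "visc_subharmonic0 (\<lambda>\<zeta>. u (a + \<zeta> *s b))"
  unfolding visc_subharmonic0_def
proof (intro allI impI, rule ccontr)
  fix h :: "complex \<Rightarrow> complex" and r \<epsilon> :: real
  assume r: "0 < r" and h: "h holomorphic_on ball 0 r" and e: "0 < \<epsilon>" and fin: "u (a + 0 *s b) \<noteq> - \<infinity>"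
    and "\<not> (\<exists>\<zeta>\<in>ball 0 r. \<not> u (a + \<zeta> *s b) \<le> u (a + 0 *s b) + ereal (Re (h \<zeta> - h 0) - \<epsilon> * (cmod \<zeta>)\<^sup>2))"
  then have touch: "\<And>\<zeta>. \<zeta> \<in> ball 0 r \<Longrightarrow> u (a + \<zeta> *s b) \<le> u a + ereal (Re (h \<zeta> - h 0) - \<epsilon> * (cmod \<zeta>)\<^sup>2)"
    by auto
  have op: "open \<Omega>" and ltinf: "\<And>z. z \<in> \<Omega> \<Longrightarrow> u z < \<infinity>" using psh by (auto simp: psh_on_def)
  obtain x where x: "u a = ereal x" using fin ltinf[OF a] by (cases "u a") auto
  have "open ((\<lambda>\<zeta>. a + \<zeta> *s b) -` \<Omega>)"
    using op by (intro open_vimage continuous_intros)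
  moreover have "0 \<in> (\<lambda>\<zeta>. a + \<zeta> *s b) -` \<Omega>" using a by simp
  ultimately obtain d where d: "d > 0" "ball 0 d \<subseteq> (\<lambda>\<zeta>. a + \<zeta> *s b) -` \<Omega>"
    using openE by blast
  define \<rho> where "\<rho> = min r d / 2"
  have \<rho>: "0 < \<rho>" "\<rho> < r" "\<rho> < d" using r d by (auto simp: \<rho>_def)
  have disc: "a + \<zeta> *s (of_real \<rho> *s b) \<in> \<Omega>" if "cmod \<zeta> \<le> 1" for \<zeta>
  proof -
    have "cmod \<zeta> * \<rho> \<le> 1 * \<rho>" using that \<rho> by (intro mult_right_mono) auto
    moreover have "cmod (\<zeta> * of_real \<rho>) = cmod \<zeta> * \<rho>" using \<rho> by (simp add: norm_mult)
    ultimately have "cmod (\<zeta> * of_real \<rho>) < d" using \<rho> by linarith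
    then show ?thesis using d(2) by (auto simp: vector_smult_assoc)
  qed
  define g where "g \<theta> = x + (Re (h (of_real \<rho> * cis \<theta>)) - Re (h 0) - \<epsilon> * \<rho>\<^sup>2)" for \<theta>
  have h': "h holomorphic_on cball 0 \<rho>" using h \<rho> by (auto intro: holomorphic_on_subset)
  have G: "(g has_integral (2 * pi * (x - \<epsilon> * \<rho>\<^sup>2))) {0..2 * pi}"
  proof -
    have "((\<lambda>\<theta>. Re (h (of_real \<rho> * cis \<theta>)) + (x - Re (h 0) - \<epsilon> * \<rho>\<^sup>2)) has_integral
        (2 * pi * Re (h 0) + 2 * pi * (x - Re (h 0) - \<epsilon> * \<rho>\<^sup>2))) {0..2 * pi}"
      using has_integral_add[OF mean_value_Re_holomorphic[OF h' \<rho>(1)]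
        has_integral_const_real[of "x - Re (h 0) - \<epsilon> * \<rho>\<^sup>2" 0 "2 * pi"]] by simp
    then show ?thesis by (simp add: g_def[abs_def] algebra_simps)
  qed
  have "continuous_on {0..2 * pi} (\<lambda>\<theta>. h (of_real \<rho> * cis \<theta>))"
    by (rule continuous_on_compose2[OF holomorphic_on_imp_continuous_on[OF h']])
      (use \<rho> in \<open>auto intro!: continuous_intros simp: norm_mult\<close>)
  then have gc: "continuous_on {0..2 * pi} g" unfolding g_def by (intro continuous_intros)
  have "u a \<le> circle_mean u a (of_real \<rho> *s b)"
    using psh disc by (auto simp: psh_on_def)
  also have "\<dots> \<le> ereal (2 * pi * (x - \<epsilon> * \<rho>\<^sup>2) / (2 * pi))"
  proof (rule circle_mean_le_integral[OF psh_on_usc[OF psh] ltinf _ G gc])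
    show "a + cis \<theta> *s (of_real \<rho> *s b) \<in> \<Omega>" for \<theta> using disc by simp
    show "u (a + cis \<theta> *s (of_real \<rho> *s b)) \<le> ereal (g \<theta>)" for \<theta>
      using touch[of "of_real \<rho> * cis \<theta>"] \<rho>
      by (simp add: vector_smult_assoc norm_mult x g_def mult.commute)
  qed
  finally have "\<epsilon> * \<rho>\<^sup>2 \<le> 0" using x by simp
  moreover have "\<epsilon> * \<rho>\<^sup>2 > 0" using e \<rho> by simp
  ultimately show False by linarith
qed

text \<open>On the unit circle the conjugate of \<open>\<zeta>\<close> is \<open>1 / \<zeta>\<close>, so products of polynomials with conjugates of polynomials
  reduce to sums of powers of \<open>\<zeta>\<close> and of conjugates of such powers; both have real parts of polynomials.\<close>

lemma poly_times_cnj_on_circle: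
  "\<exists>r. \<forall>\<zeta>. cmod \<zeta> = 1 \<longrightarrow> Re (poly p \<zeta> * cnj (poly q \<zeta>)) = Re (poly r \<zeta>)"
proof (induction p arbitrary: q)
  case 0
  then show ?case by (intro exI[of _ 0]) auto
next
  case (pCons a p)
  show ?case
  proof (cases q)
    case (pCons b q')
    obtain r where r: "\<And>\<zeta>. cmod \<zeta> = 1 \<Longrightarrow> Re (poly p \<zeta> * cnj (poly q' \<zeta>)) = Re (poly r \<zeta>)"
      using pCons.IH by blast
    show ?thesis
    proof (intro exI allI impI)
      fix \<zeta> :: complex assume \<zeta>: "cmod \<zeta> = 1"
      have z: "\<zeta> * cnj \<zeta> = 1" using \<zeta> complex_norm_square[of \<zeta>] by simp
      have "poly (pCons a p) \<zeta> * cnj (poly q \<zeta>) =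
          a * cnj b + cnj (cnj a * \<zeta> * poly q' \<zeta>) + cnj b * \<zeta> * poly p \<zeta>
          + (\<zeta> * cnj \<zeta>) * (poly p \<zeta> * cnj (poly q' \<zeta>))"
        by (simp add: pCons algebra_simps)
      then show "Re (poly (pCons a p) \<zeta> * cnj (poly q \<zeta>)) =
          Re (poly ([:a * cnj b:] + smult (cnj a) (pCons 0 q') + smult (cnj b) (pCons 0 p) + r) \<zeta>)"
        unfolding z using r[OF \<zeta>] by (simp add: algebra_simps)
    qed
  qed
qed

text \<open>This makes real parts of complex polynomials dense among the continuous functions on the circle, and
  so provides harmonic majorants. Products are handled by
  \<open>2 Re P Re Q = Re (P Q) + Re (P Q*)\<close> with \<open>Q*\<close> the conjugate of \<open>Q\<close>.\<close>

lemma real_polynomial_on_circle: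
  fixes g :: "complex \<Rightarrow> real"
  assumes "real_polynomial_function g"
  shows "\<exists>p. \<forall>\<zeta>. cmod \<zeta> = 1 \<longrightarrow> g \<zeta> = Re (poly p \<zeta>)"
  using assms
proof induction
  case (linear f)
  interpret bounded_linear f by fact
  have "f \<zeta> = Re (poly [:0, Complex (f 1) (- f \<i>):] \<zeta>)" for \<zeta>
  proof -
    have "f \<zeta> = f (Re \<zeta> *\<^sub>R 1 + Im \<zeta> *\<^sub>R \<i>)"
      by (rule arg_cong[of _ _ f]) (simp add: complex_eq_iff)
    also have "\<dots> = Re \<zeta> * f 1 + Im \<zeta> * f \<i>" by (simp only: add scaleR real_scaleR_def)
    finally show ?thesis by simp
  qed
  then show ?case by blast
next
  case (const c)
  show ?case by (intro exI[of _ "[:of_real c:]"]) simp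
next
  case (add f g)
  then obtain p q where "\<forall>\<zeta>. cmod \<zeta> = 1 \<longrightarrow> f \<zeta> = Re (poly p \<zeta>)" "\<forall>\<zeta>. cmod \<zeta> = 1 \<longrightarrow> g \<zeta> = Re (poly q \<zeta>)" by blast
  then show ?case by (intro exI[of _ "p + q"]) simp
next
  case (mult f g)
  then obtain p q where pq: "\<forall>\<zeta>. cmod \<zeta> = 1 \<longrightarrow> f \<zeta> = Re (poly p \<zeta>)" "\<forall>\<zeta>. cmod \<zeta> = 1 \<longrightarrow> g \<zeta> = Re (poly q \<zeta>)" by blast
  obtain r where r: "\<forall>\<zeta>. cmod \<zeta> = 1 \<longrightarrow> Re (poly p \<zeta> * cnj (poly q \<zeta>)) = Re (poly r \<zeta>)"
    using poly_times_cnj_on_circle by blast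
  show ?case
  proof (intro exI allI impI)
    fix \<zeta> :: complex assume \<zeta>: "cmod \<zeta> = 1"
    have prod: "Re P * Re Q = (Re (P * Q) + Re (P * cnj Q)) / 2" for P Q by simp
    have half: "Re ((1/2) * (A + B)) = (Re A + Re B) / 2" for A B by simp
    have "f \<zeta> * g \<zeta> = (Re (poly p \<zeta> * poly q \<zeta>) + Re (poly r \<zeta>)) / 2"
      using pq \<zeta> prod[of "poly p \<zeta>" "poly q \<zeta>"] r by metis
    then show "f \<zeta> * g \<zeta> = Re (poly (smult (1/2) (p * q + r)) \<zeta>)"
      unfolding poly_smult poly_add poly_mult half .
  qed
qed

lemma harmonic_majorant_on_circle:
  assumes g: "continuous_on (sphere 0 1) g" "((\<lambda>\<theta>. g (cis \<theta>)) has_integral G) {0..2 * pi}" "G < 2 * pi * x"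
  obtains p :: "complex poly" where "\<And>\<zeta>. cmod \<zeta> = 1 \<Longrightarrow> g \<zeta> \<le> Re (poly p \<zeta>)" "Re (poly p 0) < x"
proof -
  \<comment> \<open>Approximating within \<open>\<delta>\<close> and shifting up by \<open>\<delta>\<close> raises the mean by at most \<open>2 \<delta>\<close>, half of the available gap.\<close>
  define \<delta> where "\<delta> = (x - G / (2 * pi)) / 4"
  have "G / (2 * pi) < x" using g(3) by (simp add: field_simps)
  then have \<delta>: "\<delta> > 0" by (simp add: \<delta>_def)
  obtain s where s: "real_polynomial_function s" "\<And>\<zeta>. \<zeta> \<in> sphere 0 1 \<Longrightarrow> \<bar>g \<zeta> - s \<zeta>\<bar> < \<delta>"
    using Stone_Weierstrass_real_polynomial_function[OF _ g(1) \<delta>] by auto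
  then obtain p0 where p0: "\<And>\<zeta>. cmod \<zeta> = 1 \<Longrightarrow> s \<zeta> = Re (poly p0 \<zeta>)" using real_polynomial_on_circle by blast
  define p where "p = p0 + [:of_real \<delta>:]"
  have p: "Re (poly p \<zeta>) = Re (poly p0 \<zeta>) + \<delta>" for \<zeta> by (simp add: p_def)
  have between: "g \<zeta> \<le> Re (poly p \<zeta>)" "Re (poly p \<zeta>) \<le> g \<zeta> + 2 * \<delta>" if "cmod \<zeta> = 1" for \<zeta>
    using s(2)[of \<zeta>] p0[OF that] that unfolding p by auto
  have "((\<lambda>\<theta>. Re (poly p (cis \<theta>))) has_integral (2 * pi * Re (poly p 0))) {0..2 * pi}"
  proof -
    have "(\<lambda>z. poly p z) holomorphic_on cball 0 1" by (intro holomorphic_intros)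
    from mean_value_Re_holomorphic[OF this] show ?thesis by simp
  qed
  moreover have "((\<lambda>\<theta>. g (cis \<theta>) + 2 * \<delta>) has_integral (G + 2 * pi * (2 * \<delta>))) {0..2 * pi}"
    using has_integral_add[OF g(2) has_integral_const_real[of "2 * \<delta>" 0 "2 * pi"]] by simp
  ultimately have "2 * pi * Re (poly p 0) \<le> G + 2 * pi * (2 * \<delta>)"
    by (rule has_integral_le) (use between(2) in auto)
  also have "\<dots> < 2 * pi * x" using g(3) by (simp add: \<delta>_def field_simps)
  finally have "Re (poly p 0) < x" by simp
  then show ?thesis using that between(1) by blast
qed

text \<open>If the submean inequality fails, some \<open>Re p\<close> with \<open>p\<close> a polynomial dominates \<open>u\<close> on the circle but is smaller
  than \<open>u\<close> at the centre. Then \<open>u - Re p + \<epsilon> \<bar>\<zeta>\<bar>\<^sup>2\<close> attains its maximum over the disc in the interior, and at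
  that point \<open>u\<close> is touched from above by a forbidden function.\<close>

lemma visc_subharmonic_imp_submean:
  fixes u :: "complex ^ 'n::finite \<Rightarrow> ereal"
  assumes usc: "usc_on \<Omega> u" and ltinf: "\<And>z. z \<in> \<Omega> \<Longrightarrow> u z < \<infinity>"
    and visc: "\<And>a. a \<in> \<Omega> \<Longrightarrow> visc_subharmonic0 (\<lambda>\<zeta>. u (a + \<zeta> *s b))"
    and disc: "\<And>\<zeta>. cmod \<zeta> \<le> 1 \<Longrightarrow> a + \<zeta> *s b \<in> \<Omega>"
  shows "u a \<le> circle_mean u a b"
proof (rule ccontr)
  assume "\<not> u a \<le> circle_mean u a b"
  then obtain x where x: "circle_mean u a b < ereal x" "ereal x < u a"
    using ereal_dense2 by (metis not_le)
  obtain g G where g: "continuous_on (sphere 0 1) g" "\<And>\<zeta>. cmod \<zeta> = 1 \<Longrightarrow> u (a + \<zeta> *s b) \<le> ereal (g \<zeta>)"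
    "((\<lambda>\<theta>. g (cis \<theta>)) has_integral G) {0..2 * pi}" "G < 2 * pi * x"
    using circle_mean_less_continuous[OF usc ltinf _ x(1)] disc by auto
  obtain p where p: "\<And>\<zeta>. cmod \<zeta> = 1 \<Longrightarrow> g \<zeta> \<le> Re (poly p \<zeta>)" "Re (poly p 0) < x"
    using harmonic_majorant_on_circle[OF g(1,3,4)] by blast
  \<comment> \<open>Small enough that \<open>F\<close> below is at most \<open>\<epsilon>\<close> on the circle but exceeds \<open>2 \<epsilon>\<close> at the centre.\<close>
  define \<epsilon> where "\<epsilon> = (x - Re (poly p 0)) / 2"
  have e: "\<epsilon> > 0" using p(2) by (simp add: \<epsilon>_def)
  define F where "F \<zeta> = u (a + \<zeta> *s b) + ereal (\<epsilon> * (cmod \<zeta>)\<^sup>2 - Re (poly p \<zeta>))" for \<zeta>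
  have "usc_on (cball 0 1) F"
    unfolding F_def
  proof (rule usc_on_add)
    show "usc_on (cball 0 1) (\<lambda>\<zeta>. u (a + \<zeta> *s b))"
      by (rule usc_on_compose[OF usc]) (use disc in \<open>auto intro!: continuous_intros\<close>)
    show "usc_on (cball 0 1) (\<lambda>\<zeta>. ereal (\<epsilon> * (cmod \<zeta>)\<^sup>2 - Re (poly p \<zeta>)))"
      by (intro usc_on_continuous continuous_intros)
  qed (use ltinf disc in auto)
  then obtain z0 where z0: "z0 \<in> cball 0 1" "\<And>\<zeta>. \<zeta> \<in> cball 0 1 \<Longrightarrow> F \<zeta> \<le> F z0"
    using usc_on_attains_max[of "cball 0 1" F] by auto
  have "ereal (2 * \<epsilon>) < F 0" using x(2) by (cases "u a") (auto simp: F_def \<epsilon>_def)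
  then have F0: "ereal (2 * \<epsilon>) < F z0" using z0(2)[of 0] by (auto intro: less_le_trans)
  have "cmod z0 < 1"
  proof (rule ccontr)
    assume "\<not> cmod z0 < 1"
    then have n: "cmod z0 = 1" using z0(1) by auto
    have "u (a + z0 *s b) \<le> ereal (Re (poly p z0))" using g(2)[OF n] p(1)[OF n] by (meson ereal_less_eq(3) order_trans)
    then have "F z0 \<le> ereal \<epsilon>" unfolding F_def n by (cases "u (a + z0 *s b)") auto
    then show False using F0 e by (cases "F z0") auto
  qed
  obtain y where y: "u (a + z0 *s b) = ereal y"
    using F0 ltinf[OF disc, of z0] z0(1) unfolding F_def by (cases "u (a + z0 *s b)") auto
  \<comment> \<open>Recentring \<open>\<epsilon> \<bar>\<zeta>\<bar>\<^sup>2\<close> at \<open>z0\<close> leaves a linear term, which is the real part of a holomorphic function.\<close>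
  define h where "h \<zeta> = poly p (z0 + \<zeta>) - 2 * of_real \<epsilon> * cnj z0 * \<zeta>" for \<zeta>
  have "h holomorphic_on ball 0 (1 - cmod z0)" unfolding h_def by (intro holomorphic_intros)
  moreover have "visc_subharmonic0 (\<lambda>\<zeta>. u ((a + z0 *s b) + \<zeta> *s b))"
    using visc[OF disc] z0(1) by simp
  moreover have "u ((a + z0 *s b) + 0 *s b) = ereal y" using y by simp
  ultimately have "\<exists>\<zeta>\<in>ball 0 (1 - cmod z0). \<not> u ((a + z0 *s b) + \<zeta> *s b)
      \<le> u ((a + z0 *s b) + 0 *s b) + ereal (Re (h \<zeta> - h 0) - \<epsilon> * (cmod \<zeta>)\<^sup>2)"
    using e \<open>cmod z0 < 1\<close> unfolding visc_subharmonic0_def by simp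
  then obtain \<zeta> where \<zeta>: "\<zeta> \<in> ball 0 (1 - cmod z0)"
    "\<not> u ((a + z0 *s b) + \<zeta> *s b) \<le> ereal y + ereal (Re (h \<zeta> - h 0) - \<epsilon> * (cmod \<zeta>)\<^sup>2)"
    using y by auto
  have in_disc: "z0 + \<zeta> \<in> cball 0 1"
    using \<zeta>(1) norm_triangle_ineq[of z0 \<zeta>] by simp
  have "F (z0 + \<zeta>) \<le> F z0" using z0(2) in_disc by blast
  moreover have "(a + z0 *s b) + \<zeta> *s b = a + (z0 + \<zeta>) *s b"
    by (simp add: vector_sadd_rdistrib)
  moreover have "(cmod (z0 + \<zeta>))\<^sup>2 = (cmod z0)\<^sup>2 + (cmod \<zeta>)\<^sup>2 + 2 * Re (cnj z0 * \<zeta>)"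
    unfolding cmod_power2 by (simp add: power2_eq_square algebra_simps)
  then have "\<epsilon> * (cmod (z0 + \<zeta>))\<^sup>2 = \<epsilon> * (cmod z0)\<^sup>2 + \<epsilon> * (cmod \<zeta>)\<^sup>2 + 2 * \<epsilon> * Re (cnj z0 * \<zeta>)"
    by (simp add: algebra_simps)
  ultimately show False
    using \<zeta>(2) y unfolding F_def
    by (cases "u (a + (z0 + \<zeta>) *s b)") (auto simp: h_def algebra_simps)
qed

theorem psh_on_iff_visc:
  "psh_on \<Omega> u \<longleftrightarrow> open \<Omega> \<and> (\<forall>z\<in>\<Omega>. u z < \<infinity>) \<and> usc_on \<Omega> u \<and>
     (\<forall>a\<in>\<Omega>. \<forall>b. visc_subharmonic0 (\<lambda>\<zeta>. u (a + \<zeta> *s b)))"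
proof
  assume psh: "psh_on \<Omega> u"
  show "open \<Omega> \<and> (\<forall>z\<in>\<Omega>. u z < \<infinity>) \<and> usc_on \<Omega> u \<and>
     (\<forall>a\<in>\<Omega>. \<forall>b. visc_subharmonic0 (\<lambda>\<zeta>. u (a + \<zeta> *s b)))"
    using submean_imp_visc_subharmonic[OF psh] psh_on_usc[OF psh] psh unfolding psh_on_def by blast
next
  assume R: "open \<Omega> \<and> (\<forall>z\<in>\<Omega>. u z < \<infinity>) \<and> usc_on \<Omega> u \<and>
     (\<forall>a\<in>\<Omega>. \<forall>b. visc_subharmonic0 (\<lambda>\<zeta>. u (a + \<zeta> *s b)))"
  then show "psh_on \<Omega> u"
    unfolding psh_on_def using visc_subharmonic_imp_submean[of \<Omega> u]
    by (auto simp: usc_on_open dist_norm)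
qed

text \<open>A touching function would give \<open>Re h\<close> a strict local minimum at \<open>0\<close>, contradicting the mean value property.\<close>

lemma visc_subharmonic0_const: "visc_subharmonic0 (\<lambda>_. ereal c)"
  unfolding visc_subharmonic0_def
proof (intro allI impI, rule ccontr)
  fix h :: "complex \<Rightarrow> complex" and r \<epsilon> :: real
  assume r: "0 < r" and h: "h holomorphic_on ball 0 r" and e: "0 < \<epsilon>"
    and "\<not> (\<exists>\<zeta>\<in>ball 0 r. \<not> ereal c \<le> ereal c + ereal (Re (h \<zeta> - h 0) - \<epsilon> * (cmod \<zeta>)\<^sup>2))"
  then have touch: "\<And>\<zeta>. cmod \<zeta> < r \<Longrightarrow> Re (h 0) + \<epsilon> * (cmod \<zeta>)\<^sup>2 \<le> Re (h \<zeta>)" by force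
  define \<rho> where "\<rho> = r / 2"
  have \<rho>: "0 < \<rho>" "\<rho> < r" using r by (auto simp: \<rho>_def)
  have "((\<lambda>\<theta>. Re (h 0) + \<epsilon> * \<rho>\<^sup>2) has_integral (2 * pi * (Re (h 0) + \<epsilon> * \<rho>\<^sup>2))) {0..2 * pi}"
    using has_integral_const_real[of "Re (h 0) + \<epsilon> * \<rho>\<^sup>2" 0 "2 * pi"] by simp
  moreover have "((\<lambda>\<theta>. Re (h (of_real \<rho> * cis \<theta>))) has_integral (2 * pi * Re (h 0))) {0..2 * pi}"
    using h \<rho> by (intro mean_value_Re_holomorphic) (auto intro: holomorphic_on_subset)
  ultimately have "2 * pi * (Re (h 0) + \<epsilon> * \<rho>\<^sup>2) \<le> 2 * pi * Re (h 0)"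
  proof (rule has_integral_le)
    fix \<theta>
    show "Re (h 0) + \<epsilon> * \<rho>\<^sup>2 \<le> Re (h (of_real \<rho> * cis \<theta>))"
      using touch[of "of_real \<rho> * cis \<theta>"] \<rho> by (simp add: norm_mult)
  qed
  then have "\<epsilon> * \<rho>\<^sup>2 \<le> 0" by simp
  moreover have "\<epsilon> * \<rho>\<^sup>2 > 0" using e \<rho> by simp
  ultimately show False by linarith
qed

text \<open>The form in which the viscosity condition is passed on: if every bound \<open>t\<close> on the growth of \<open>g\<close> gives the
  same bound for \<open>f\<close>, up to the real part of a holomorphic function and an error \<open>\<delta> \<bar>\<zeta>\<bar>\<^sup>2\<close>, then a function touching
  \<open>g\<close> yields one touching \<open>f\<close>, half of \<open>\<epsilon>\<close> being spent on the error.\<close>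

lemma visc_subharmonic0_compare:
  assumes f: "visc_subharmonic0 f" and fin: "g 0 \<noteq> - \<infinity> \<Longrightarrow> f 0 \<noteq> - \<infinity>"
    and cmp: "\<And>\<delta>. 0 < \<delta> \<Longrightarrow> \<exists>R k. 0 < R \<and> k holomorphic_on ball 0 R \<and>
      (\<forall>\<zeta>\<in>ball 0 R. \<forall>t. g \<zeta> \<le> g 0 + ereal t \<longrightarrow>
         f \<zeta> \<le> f 0 + ereal (t + Re (k \<zeta> - k 0) + \<delta> * (cmod \<zeta>)\<^sup>2))"
  shows "visc_subharmonic0 g"
  unfolding visc_subharmonic0_def
proof (intro allI impI, rule ccontr)
  fix h :: "complex \<Rightarrow> complex" and r \<epsilon> :: real
  assume r: "0 < r" and h: "h holomorphic_on ball 0 r" and e: "0 < \<epsilon>" and "g 0 \<noteq> - \<infinity>"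
    and "\<not> (\<exists>\<zeta>\<in>ball 0 r. \<not> g \<zeta> \<le> g 0 + ereal (Re (h \<zeta> - h 0) - \<epsilon> * (cmod \<zeta>)\<^sup>2))"
  then have touch: "\<And>\<zeta>. \<zeta> \<in> ball 0 r \<Longrightarrow> g \<zeta> \<le> g 0 + ereal (Re (h \<zeta> - h 0) - \<epsilon> * (cmod \<zeta>)\<^sup>2)"
    by blast
  have "0 < \<epsilon> / 2" using e by simp
  from cmp[OF this] obtain R k where R: "0 < R" and k: "k holomorphic_on ball 0 R" and
    imp: "\<And>\<zeta> t. \<zeta> \<in> ball 0 R \<Longrightarrow> g \<zeta> \<le> g 0 + ereal t \<Longrightarrow>
         f \<zeta> \<le> f 0 + ereal (t + Re (k \<zeta> - k 0) + \<epsilon> / 2 * (cmod \<zeta>)\<^sup>2)"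
    by blast
  have hk: "(\<lambda>\<zeta>. h \<zeta> + k \<zeta>) holomorphic_on ball 0 (min r R)"
    using h k by (intro holomorphic_on_add) (auto intro: holomorphic_on_subset)
  have "0 < min r R" using r R by simp
  with f hk \<open>0 < \<epsilon> / 2\<close> fin[OF \<open>g 0 \<noteq> - \<infinity>\<close>] obtain \<zeta> where \<zeta>: "\<zeta> \<in> ball 0 (min r R)"
    "\<not> f \<zeta> \<le> f 0 + ereal (Re (h \<zeta> + k \<zeta> - (h 0 + k 0)) - \<epsilon> / 2 * (cmod \<zeta>)\<^sup>2)"
    unfolding visc_subharmonic0_def by blast
  have "f \<zeta> \<le> f 0 + ereal ((Re (h \<zeta> - h 0) - \<epsilon> * (cmod \<zeta>)\<^sup>2) + Re (k \<zeta> - k 0) + \<epsilon> / 2 * (cmod \<zeta>)\<^sup>2)"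
    using \<zeta>(1) by (intro imp touch) auto
  also have "(Re (h \<zeta> - h 0) - \<epsilon> * (cmod \<zeta>)\<^sup>2) + Re (k \<zeta> - k 0) + \<epsilon> / 2 * (cmod \<zeta>)\<^sup>2
    = Re (h \<zeta> + k \<zeta> - (h 0 + k 0)) - \<epsilon> / 2 * (cmod \<zeta>)\<^sup>2" by simp
  finally show False using \<zeta>(2) by blast
qed

text \<open>Passing between homogeneous and affine coordinates reparametrises complex lines by maps of this kind. The
  viscosity condition is invariant because a biholomorphic change of parameter preserves holomorphic functions and
  changes \<open>\<bar>\<zeta>\<bar>\<^sup>2\<close> by a factor that is bounded away from \<open>0\<close>.\<close>

lemma visc_subharmonic0_moebius:
  assumes f: "visc_subharmonic0 f"
  shows "visc_subharmonic0 (\<lambda>\<zeta>. f (\<zeta> / (1 + \<beta> * \<zeta>)))"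
  unfolding visc_subharmonic0_def
proof (intro allI impI, rule ccontr)
  fix h :: "complex \<Rightarrow> complex" and r \<epsilon> :: real
  assume r: "0 < r" and h: "h holomorphic_on ball 0 r" and e: "0 < \<epsilon>"
    and fin: "f (0 / (1 + \<beta> * 0)) \<noteq> - \<infinity>"
    and "\<not> (\<exists>\<zeta>\<in>ball 0 r. \<not> f (\<zeta> / (1 + \<beta> * \<zeta>)) \<le> f (0 / (1 + \<beta> * 0)) + ereal (Re (h \<zeta> - h 0) - \<epsilon> * (cmod \<zeta>)\<^sup>2))"
  then have touch: "\<And>\<zeta>. \<zeta> \<in> ball 0 r \<Longrightarrow> f (\<zeta> / (1 + \<beta> * \<zeta>)) \<le> f 0 + ereal (Re (h \<zeta> - h 0) - \<epsilon> * (cmod \<zeta>)\<^sup>2)"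
    by auto
  \<comment> \<open>\<open>q\<close> inverts the change of parameter; on the ball of radius \<open>r'\<close> its denominator lies between \<open>1/2\<close> and \<open>2\<close>.\<close>
  define r' where "r' = min (r / 2) (1 / (2 * (cmod \<beta> + 1)))"
  have r': "0 < r'" using r by (auto simp: r'_def intro!: divide_pos_pos add_nonneg_pos)
  define q where "q \<mu> = \<mu> / (1 - \<beta> * \<mu>)" for \<mu>
  have small: "cmod (\<beta> * \<mu>) \<le> 1 / 2" if "\<mu> \<in> ball 0 r'" for \<mu>
  proof -
    have "cmod \<mu> \<le> 1 / (2 * (cmod \<beta> + 1))" using that by (simp add: r'_def)
    then have "cmod \<beta> * cmod \<mu> \<le> cmod \<beta> * (1 / (2 * (cmod \<beta> + 1)))" by (intro mult_left_mono) auto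
    also have "\<dots> \<le> (cmod \<beta> + 1) * (1 / (2 * (cmod \<beta> + 1)))" by (intro mult_right_mono) auto
    also have "\<dots> = 1 / 2"
    proof -
      have "cmod \<beta> + 1 \<noteq> 0" using norm_ge_zero[of \<beta>] by linarith
      then show ?thesis by simp
    qed
    finally show ?thesis by (simp add: norm_mult)
  qed
  have bounds: "1 / 2 \<le> cmod (1 - \<beta> * \<mu>)" "cmod (1 - \<beta> * \<mu>) \<le> 2" "1 - \<beta> * \<mu> \<noteq> 0" if "\<mu> \<in> ball 0 r'" for \<mu>
  proof -
    show "1 / 2 \<le> cmod (1 - \<beta> * \<mu>)" using small[OF that] norm_triangle_ineq2[of 1 "\<beta> * \<mu>"] by simp
    then show "1 - \<beta> * \<mu> \<noteq> 0" by auto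
    show "cmod (1 - \<beta> * \<mu>) \<le> 2" using small[OF that] norm_triangle_ineq4[of 1 "\<beta> * \<mu>"] by simp
  qed
  have q_ball: "q \<mu> \<in> ball 0 r" if \<mu>: "\<mu> \<in> ball 0 r'" for \<mu>
  proof -
    have "cmod (q \<mu>) = cmod \<mu> / cmod (1 - \<beta> * \<mu>)" by (simp add: q_def norm_divide)
    also have "\<dots> \<le> cmod \<mu> / (1 / 2)" using bounds[OF \<mu>] by (intro divide_left_mono) auto
    also have "\<dots> < r" using \<mu> by (simp add: r'_def)
    finally show ?thesis by simp
  qed
  have q_hol: "q holomorphic_on ball 0 r'"
    unfolding q_def using bounds by (intro holomorphic_intros) auto
  have "h \<circ> q holomorphic_on ball 0 r'"
    using q_hol h q_ball by (intro holomorphic_on_compose_gen) auto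
  with f r' e fin obtain \<mu> where \<mu>: "\<mu> \<in> ball 0 r'"
    "\<not> f \<mu> \<le> f 0 + ereal (Re ((h \<circ> q) \<mu> - (h \<circ> q) 0) - \<epsilon> / 4 * (cmod \<mu>)\<^sup>2)"
    unfolding visc_subharmonic0_def by (metis div_0 divide_pos_pos zero_less_numeral)
  have "q \<mu> / (1 + \<beta> * q \<mu>) = \<mu>"
    using bounds(3)[OF \<mu>(1)] by (simp add: q_def field_simps)
  then have "f \<mu> \<le> f 0 + ereal (Re (h (q \<mu>) - h 0) - \<epsilon> * (cmod (q \<mu>))\<^sup>2)"
    using touch[OF q_ball[OF \<mu>(1)]] by simp
  also have "\<dots> \<le> f 0 + ereal (Re ((h \<circ> q) \<mu> - (h \<circ> q) 0) - \<epsilon> / 4 * (cmod \<mu>)\<^sup>2)"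
  proof -
    have "cmod \<mu> / 2 \<le> cmod \<mu> / cmod (1 - \<beta> * \<mu>)"
      using bounds[OF \<mu>(1)] by (intro divide_left_mono) auto
    then have "(cmod \<mu> / 2)\<^sup>2 \<le> (cmod (q \<mu>))\<^sup>2"
      by (intro power_mono) (auto simp: q_def norm_divide)
    then have "\<epsilon> * (cmod \<mu> / 2)\<^sup>2 \<le> \<epsilon> * (cmod (q \<mu>))\<^sup>2" using e by simp
    moreover have "q 0 = 0" by (simp add: q_def)
    ultimately show ?thesis by (intro add_left_mono) (simp add: power_divide)
  qed
  finally show False using \<mu>(2) by blast
qed

lemma visc_subharmonic0_cmult:
  assumes "visc_subharmonic0 f" "0 < c" "c < \<infinity>"
  shows "visc_subharmonic0 (\<lambda>\<zeta>. c * f \<zeta>)"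
  unfolding visc_subharmonic0_def
proof (intro allI impI, rule ccontr)
  fix h :: "complex \<Rightarrow> complex" and r \<epsilon> :: real
  assume r: "0 < r" and h: "h holomorphic_on ball 0 r" and e: "0 < \<epsilon>" and fin: "c * f 0 \<noteq> - \<infinity>"
    and "\<not> (\<exists>\<zeta>\<in>ball 0 r. \<not> c * f \<zeta> \<le> c * f 0 + ereal (Re (h \<zeta> - h 0) - \<epsilon> * (cmod \<zeta>)\<^sup>2))"
  then have touch: "\<And>\<zeta>. \<zeta> \<in> ball 0 r \<Longrightarrow> c * f \<zeta> \<le> c * f 0 + ereal (Re (h \<zeta> - h 0) - \<epsilon> * (cmod \<zeta>)\<^sup>2)"
    by blast
  obtain x where x: "c = ereal x" "x > 0" using assms(2,3) by (cases c) auto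
  have "(\<lambda>\<zeta>. h \<zeta> / of_real x) holomorphic_on ball 0 r" "0 < \<epsilon> / x" "f 0 \<noteq> - \<infinity>"
    using h x e fin by (auto intro!: holomorphic_intros)
  with assms(1) r obtain \<zeta> where \<zeta>: "\<zeta> \<in> ball 0 r"
    "\<not> f \<zeta> \<le> f 0 + ereal (Re (h \<zeta> / of_real x - h 0 / of_real x) - \<epsilon> / x * (cmod \<zeta>)\<^sup>2)"
    unfolding visc_subharmonic0_def by blast
  define T where "T = Re (h \<zeta> - h 0) - \<epsilon> * (cmod \<zeta>)\<^sup>2"
  have T: "Re (h \<zeta> / of_real x - h 0 / of_real x) - \<epsilon> / x * (cmod \<zeta>)\<^sup>2 = T / x"
    by (simp add: T_def diff_divide_distrib)
  have "F \<le> F0 + T / x" if "x * F \<le> x * F0 + T" for F F0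
    using pos_le_divide_eq[OF x(2), of "F - F0" T] that by (simp add: algebra_simps)
  then have "f \<zeta> \<le> f 0 + ereal (T / x)"
    using touch[OF \<zeta>(1), folded T_def] x by (cases "f \<zeta>"; cases "f 0") auto
  then show False using \<zeta>(2) unfolding T by blast
qed

section \<open>Operations on plurisubharmonic functions\<close>

lemma psh_on_cong:
  assumes "psh_on \<Omega> u" "\<And>z. z \<in> \<Omega> \<Longrightarrow> u z = v z"
  shows "psh_on \<Omega> v"
proof -
  have "{z \<in> \<Omega>. v z < c} = {z \<in> \<Omega>. u z < c}" for c using assms(2) by auto
  moreover have "circle_mean v a b = circle_mean u a b" if "\<forall>\<zeta>\<in>cball 0 1. a + \<zeta> *s b \<in> \<Omega>" for a b
  proof -
    have "u (a + cis \<theta> *s b) = v (a + cis \<theta> *s b)" for \<theta> using that by (intro assms(2)) auto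
    then show ?thesis by (simp add: circle_mean_def)
  qed
  moreover have "a \<in> \<Omega>" if "\<forall>\<zeta>\<in>cball 0 1. a + \<zeta> *s b \<in> \<Omega>" for a b
    using that[rule_format, of 0] by simp
  ultimately show ?thesis using assms unfolding psh_on_def by simp
qed

lemma psh_on_cmult:
  assumes "psh_on \<Omega> u" "0 < c" "c < \<infinity>"
  shows "psh_on \<Omega> (\<lambda>z. c * u z)"
proof -
  obtain x where x: "c = ereal x" "x > 0" using assms(2,3) by (cases c) auto
  have u: "open \<Omega>" "\<And>z. z \<in> \<Omega> \<Longrightarrow> u z < \<infinity>" "usc_on \<Omega> u"
    "\<And>a b. a \<in> \<Omega> \<Longrightarrow> visc_subharmonic0 (\<lambda>\<zeta>. u (a + \<zeta> *s b))"
    using assms(1) by (auto simp: psh_on_iff_visc)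
  have "{z \<in> \<Omega>. c * u z < d} = {z \<in> \<Omega>. u z < d / c}" for d
    using x ereal_less_divide_pos[of c _ d] by (auto simp: mult.commute)
  then have "usc_on \<Omega> (\<lambda>z. c * u z)" using u(3) by (simp add: usc_on_def)
  moreover have "c * u z < \<infinity>" if "z \<in> \<Omega>" for z using u(2)[OF that] x by (cases "u z") auto
  ultimately show ?thesis
    using u visc_subharmonic0_cmult[OF u(4) assms(2,3)] by (auto simp: psh_on_iff_visc)
qed

text \<open>The viscosity condition is not visibly additive; the integral form of the submean inequality is.\<close>

lemma psh_on_add:
  fixes u v :: "complex ^ 'n::finite \<Rightarrow> ereal"
  assumes u: "psh_on \<Omega> u" and v: "psh_on \<Omega> v"
  shows "psh_on \<Omega> (\<lambda>z. u z + v z)"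
proof -
  have op: "open \<Omega>" and fin: "\<And>z. z \<in> \<Omega> \<Longrightarrow> u z < \<infinity>" "\<And>z. z \<in> \<Omega> \<Longrightarrow> v z < \<infinity>"
    using u v by (auto simp: psh_on_def)
  have usc: "usc_on \<Omega> (\<lambda>z. u z + v z)"
    by (rule usc_on_add[OF psh_on_usc[OF u] psh_on_usc[OF v] fin])
  have lt: "u z + v z < \<infinity>" if "z \<in> \<Omega>" for z
    using fin[OF that] by (cases "u z"; cases "v z") auto
  have "u a + v a \<le> circle_mean (\<lambda>z. u z + v z) a b" if disc: "\<forall>\<zeta>\<in>cball 0 1. a + \<zeta> *s b \<in> \<Omega>" for a b
  proof -
    have circ: "\<And>\<theta>. a + cis \<theta> *s b \<in> \<Omega>" using disc by simp
    obtain C1 where C1: "C1 \<ge> 0" "\<And>\<theta>. u (a + cis \<theta> *s b) \<le> ereal C1"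
      using usc_on_circle_bounded[OF psh_on_usc[OF u] fin(1) circ] by blast
    obtain C2 where C2: "C2 \<ge> 0" "\<And>\<theta>. v (a + cis \<theta> *s b) \<le> ereal C2"
      using usc_on_circle_bounded[OF psh_on_usc[OF v] fin(2) circ] by blast
    note mu = usc_on_circle[OF psh_on_usc[OF u] circ] and mv = usc_on_circle[OF psh_on_usc[OF v] circ]
    note [measurable] = mu mv
    let ?Iu = "\<integral>\<^sup>+\<theta>\<in>{0..2 * pi}. e2ennreal (ereal C1 - u (a + cis \<theta> *s b)) \<partial>lborel"
    let ?Iv = "\<integral>\<^sup>+\<theta>\<in>{0..2 * pi}. e2ennreal (ereal C2 - v (a + cis \<theta> *s b)) \<partial>lborel"
    have pt: "e2ennreal (ereal (C1 + C2) - (u (a + cis \<theta> *s b) + v (a + cis \<theta> *s b)))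
        = e2ennreal (ereal C1 - u (a + cis \<theta> *s b)) + e2ennreal (ereal C2 - v (a + cis \<theta> *s b))" for \<theta>
      using C1(2)[of \<theta>] C2(2)[of \<theta>]
      by (cases "u (a + cis \<theta> *s b)"; cases "v (a + cis \<theta> *s b)")
        (auto simp flip: ennreal_plus simp: algebra_simps)
    have sum: "(\<integral>\<^sup>+\<theta>\<in>{0..2 * pi}. e2ennreal (ereal (C1 + C2) - (u (a + cis \<theta> *s b) + v (a + cis \<theta> *s b))) \<partial>lborel)
        = ?Iu + ?Iv"
      unfolding pt distrib_right by (subst nn_integral_add) auto
    have "circle_mean (\<lambda>z. u z + v z) a b = ereal (C1 + C2) - enn2ereal (?Iu + ?Iv) / ereal (2 * pi)"
      unfolding sum[symmetric]
    proof (rule circle_mean_eq)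
      show "u (a + cis \<theta> *s b) + v (a + cis \<theta> *s b) \<le> ereal (C1 + C2)" for \<theta>
        using add_mono[OF C1(2)[of \<theta>] C2(2)[of \<theta>]] by simp
    qed (use C1 C2 in \<open>auto intro: usc_on_circle[OF usc circ]\<close>)
    moreover have "u a \<le> circle_mean u a b" "v a \<le> circle_mean v a b"
      using u v disc unfolding psh_on_def by blast+
    moreover from this have "u a \<le> ereal C1 - enn2ereal ?Iu / ereal (2 * pi)"
      using circle_mean_eq[OF mu C1] by simp
    moreover from calculation have "v a \<le> ereal C2 - enn2ereal ?Iv / ereal (2 * pi)"
      using circle_mean_eq[OF mv C2] by simp
    ultimately show ?thesis
      using add_mono[of "u a" "ereal C1 - enn2ereal ?Iu / ereal (2 * pi)"
          "v a" "ereal C2 - enn2ereal ?Iv / ereal (2 * pi)"]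
      by (cases ?Iu; cases ?Iv)
        (auto simp: enn2ereal_ennreal add_divide_distrib algebra_simps simp flip: ennreal_plus)
  qed
  then show ?thesis using op usc lt by (auto simp: psh_on_def usc_on_open)
qed

text \<open>Monotone convergence for the integrals of \<open>C - u n\<close>.\<close>

lemma psh_on_decseq_INF:
  fixes u :: "nat \<Rightarrow> complex ^ 'n::finite \<Rightarrow> ereal"
  assumes u: "\<And>n. psh_on \<Omega> (u n)" and dec: "\<And>n z. z \<in> \<Omega> \<Longrightarrow> u (Suc n) z \<le> u n z"
  shows "psh_on \<Omega> (\<lambda>z. INF n. u n z)"
proof -
  let ?v = "\<lambda>z. INF n. u n z"
  have op: "open \<Omega>" and fin: "\<And>n z. z \<in> \<Omega> \<Longrightarrow> u n z < \<infinity>"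
    using u by (auto simp: psh_on_def)
  have "{z \<in> \<Omega>. ?v z < c} = (\<Union>n. {z \<in> \<Omega>. u n z < c})" for c by (auto simp: INF_less_iff)
  then have usc: "usc_on \<Omega> ?v" using u op by (auto simp: psh_on_def usc_on_open)
  have lt: "?v z < \<infinity>" if "z \<in> \<Omega>" for z
    using fin[OF that, of 0] INF_lower[of 0 UNIV "\<lambda>n. u n z"] by (auto intro: le_less_trans)
  have "?v a \<le> circle_mean ?v a b" if disc: "\<forall>\<zeta>\<in>cball 0 1. a + \<zeta> *s b \<in> \<Omega>" for a b
  proof (rule dense_ge)
    have circ: "\<And>\<theta>. a + cis \<theta> *s b \<in> \<Omega>" using disc by simp
    obtain C where C: "C \<ge> 0" "\<And>\<theta>. u 0 (a + cis \<theta> *s b) \<le> ereal C"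
      using usc_on_circle_bounded[OF psh_on_usc[OF u] fin circ] by blast
    have anti: "decseq (\<lambda>n. u n (a + cis \<theta> *s b))" for \<theta>
      using dec circ by (intro decseq_SucI) auto
    have Cn: "u n (a + cis \<theta> *s b) \<le> ereal C" for n \<theta>
      using decseqD[OF anti, of 0 n \<theta>] C(2)[of \<theta>] by (auto intro: order_trans)
    have Cv: "?v (a + cis \<theta> *s b) \<le> ereal C" for \<theta>
      using Cn[of 0 \<theta>] INF_lower[of 0 UNIV "\<lambda>n. u n (a + cis \<theta> *s b)"] by (auto intro: order_trans)
    have meas: "(\<lambda>\<theta>. u n (a + cis \<theta> *s b)) \<in> borel_measurable borel" for n
      by (rule usc_on_circle[OF psh_on_usc[OF u] circ])
    note [measurable] = meas
    let ?I = "\<lambda>n. \<integral>\<^sup>+\<theta>\<in>{0..2 * pi}. e2ennreal (ereal C - u n (a + cis \<theta> *s b)) \<partial>lborel"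
    let ?J = "\<integral>\<^sup>+\<theta>\<in>{0..2 * pi}. e2ennreal (ereal C - ?v (a + cis \<theta> *s b)) \<partial>lborel"
    have "?J = (SUP n. ?I n)"
    proof -
      have "(SUP n. e2ennreal (ereal C - u n (a + cis \<theta> *s b))) = e2ennreal (ereal C - ?v (a + cis \<theta> *s b))" for \<theta>
      proof -
        have "incseq (\<lambda>n. e2ennreal (ereal C - u n (a + cis \<theta> *s b)))"
          using decseqD[OF anti] by (intro incseq_def[THEN iffD2] allI impI e2ennreal_mono ereal_minus_mono) auto
        then have "(\<lambda>n. e2ennreal (ereal C - u n (a + cis \<theta> *s b))) \<longlonglongrightarrow> (SUP n. e2ennreal (ereal C - u n (a + cis \<theta> *s b)))"
          by (rule LIMSEQ_SUP)
        moreover have "(\<lambda>n. e2ennreal (ereal C - u n (a + cis \<theta> *s b))) \<longlonglongrightarrow> e2ennreal (ereal C - ?v (a + cis \<theta> *s b))"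
          by (intro tendsto_intros LIMSEQ_INF[OF anti]) auto
        ultimately show ?thesis by (rule LIMSEQ_unique)
      qed
      then have "?J = (\<integral>\<^sup>+\<theta>. (SUP n. e2ennreal (ereal C - u n (a + cis \<theta> *s b)) * indicator {0..2 * pi} \<theta>) \<partial>lborel)"
        by (intro nn_integral_cong) (auto split: split_indicator)
      also have "\<dots> = (SUP n. ?I n)"
      proof (rule nn_integral_monotone_convergence_SUP)
        show "incseq (\<lambda>n \<theta>. e2ennreal (ereal C - u n (a + cis \<theta> *s b)) * indicator {0..2 * pi} \<theta>)"
          using decseqD[OF anti]
          by (intro incseq_SucI le_funI mult_right_mono e2ennreal_mono ereal_minus_mono) auto
      qed measurable
      finally show ?thesis .
    qed
    fix y assume y: "circle_mean ?v a b < y"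
    show "?v a \<le> y"
    proof (rule ccontr)
      assume "\<not> ?v a \<le> y"
      then obtain s where s: "y < ereal s" "ereal s < ?v a" using ereal_dense2 by (metis not_le)
      have In: "?I n \<le> ennreal (2 * pi * (C - s))" "s \<le> C" for n
      proof -
        have "ereal s \<le> u n a" using s(2) INF_lower[of n UNIV "\<lambda>n. u n a"] by (auto intro: order.strict_trans2 less_imp_le)
        also have "\<dots> \<le> circle_mean (u n) a b" using u disc by (auto simp: psh_on_def)
        also have "\<dots> = ereal C - enn2ereal (?I n) / ereal (2 * pi)"
          by (rule circle_mean_eq[OF meas C(1) Cn])
        finally have *: "ereal s \<le> ereal C - enn2ereal (?I n) / ereal (2 * pi)" .
        then obtain i where i: "?I n = ennreal i" "i \<ge> 0" by (cases "?I n") auto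
        then have "s \<le> C - i / (2 * pi)" using * by (simp add: enn2ereal_ennreal)
        moreover have "0 \<le> i / (2 * pi)" using i(2) by simp
        ultimately have "s \<le> C" "i / (2 * pi) \<le> C - s" by linarith+
        then have "i \<le> 2 * pi * (C - s)" "s \<le> C" by (auto simp: pos_divide_le_eq mult.commute)
        then show "?I n \<le> ennreal (2 * pi * (C - s))" "s \<le> C" using i by (auto intro: ennreal_leI)
      qed
      then have "?J \<le> ennreal (2 * pi * (C - s))" unfolding \<open>?J = (SUP n. ?I n)\<close> by (intro SUP_least)
      then have "enn2ereal ?J \<le> ereal (2 * pi * (C - s))"
        using In(2) by (simp add: less_eq_ennreal.rep_eq enn2ereal_ennreal)
      moreover have "s \<le> C - j / (2 * pi)" if "j \<le> 2 * pi * (C - s)" for j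
        using that pos_divide_le_eq[of "2 * pi" j "C - s"] by (simp add: mult.commute)
      ultimately have "ereal s \<le> ereal C - enn2ereal ?J / ereal (2 * pi)"
        by (cases "enn2ereal ?J") auto
      also have "\<dots> = circle_mean ?v a b"
        by (rule circle_mean_eq[OF usc_on_circle[OF usc circ] C(1) Cv, symmetric])
      finally show False using s(1) y by auto
    qed
  qed
  then show ?thesis using op usc lt by (auto simp: psh_on_def usc_on_open)
qed

section \<open>Smooth functions and the operator ddc\<close>

abbreviation fd :: "('a::real_normed_vector \<Rightarrow> 'b::real_normed_vector) \<Rightarrow> 'a \<Rightarrow> 'a \<Rightarrow> 'b" where
  "fd f x v \<equiv> frechet_derivative f (at x) v"

lemma frechet_derivative_cong_open:
  assumes "open S" "x \<in> S" "\<And>y. y \<in> S \<Longrightarrow> f y = g y"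
  shows "frechet_derivative f (at x) = frechet_derivative g (at x)"
    "f differentiable (at x) \<longleftrightarrow> g differentiable (at x)"
proof -
  have "(f has_derivative D) (at x) \<longleftrightarrow> (g has_derivative D) (at x)" for D
    using assms by (intro iffI; elim has_derivative_transform_within_open) auto
  then show "frechet_derivative f (at x) = frechet_derivative g (at x)"
    "f differentiable (at x) \<longleftrightarrow> g differentiable (at x)"
    unfolding frechet_derivative_def differentiable_def by auto
qed

lemma Ck_on_cong:
  assumes "open S" "\<And>x. x \<in> S \<Longrightarrow> f x = g x"
  shows "Ck_on k S f \<longleftrightarrow> Ck_on k S g"
  using assms(2)
proof (induction k arbitrary: f g)
  case 0
  then show ?case using continuous_on_cong[OF refl 0] by simp
next
  case (Suc k)
  have *: "x \<in> S \<Longrightarrow> frechet_derivative f (at x) = frechet_derivative g (at x)"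
    "x \<in> S \<Longrightarrow> f differentiable (at x) \<longleftrightarrow> g differentiable (at x)" for x
    using frechet_derivative_cong_open[OF assms(1)] Suc.prems by blast+
  then have "Ck_on k S (\<lambda>x. fd f x v) \<longleftrightarrow> Ck_on k S (\<lambda>x. fd g x v)" for v
    by (intro Suc.IH) simp
  then show ?case using * by simp
qed

lemma Ck_on_Suc_imp: "Ck_on (Suc k) S f \<Longrightarrow> Ck_on k S f"
proof (induction k arbitrary: f)
  case 0
  then show ?case
    by (auto intro!: continuous_at_imp_continuous_on differentiable_imp_continuous_within)
next
  case (Suc k)
  then show ?case by (metis Ck_on.simps(2))
qed

text \<open>Reduces the recursive clause, which refers to \<open>frechet_derivative\<close>, to any formula \<open>D\<close> for the derivative.\<close>

lemma Ck_on_SucI: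
  assumes "open S" "\<And>x. x \<in> S \<Longrightarrow> (f has_derivative D x) (at x)" "\<And>v. Ck_on k S (\<lambda>x. D x v)"
  shows "Ck_on (Suc k) S f"
proof -
  have "fd f x v = D x v" if "x \<in> S" for x v
    using frechet_derivative_at[OF assms(2)[OF that]] by simp
  then have "Ck_on k S (\<lambda>x. fd f x v)" for v
    using Ck_on_cong[OF assms(1), of "\<lambda>x. fd f x v" "\<lambda>x. D x v"] assms(3) by simp
  then show ?thesis using assms(2) by (auto simp: differentiable_def)
qed

lemma Ck_on_SucD:
  assumes "Ck_on (Suc k) S f"
  shows "x \<in> S \<Longrightarrow> (f has_derivative fd f x) (at x)" "Ck_on k S (\<lambda>x. fd f x v)"
  using assms by (auto simp: frechet_derivative_works)

lemma Ck_on_const: "open S \<Longrightarrow> Ck_on k S (\<lambda>_. c)"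
proof (induction k arbitrary: c)
  case (Suc k)
  show ?case by (rule Ck_on_SucI[where D = "\<lambda>_ _. 0"]) (use Suc in auto)
qed simp

lemma Ck_on_linear:
  assumes "open S" "bounded_linear f"
  shows "Ck_on k S f"
proof (cases k)
  case 0
  then show ?thesis using assms(2) by (simp add: linear_continuous_on)
next
  case (Suc k')
  show ?thesis unfolding Suc
    by (rule Ck_on_SucI[where D = "\<lambda>_. f"])
      (use assms Ck_on_const bounded_linear_imp_has_derivative in auto)
qed

lemma Ck_on_add:
  assumes "open S" "Ck_on k S f" "Ck_on k S g"
  shows "Ck_on k S (\<lambda>x. f x + g x)"
  using assms(2,3)
proof (induction k arbitrary: f g)
  case (Suc k)
  show ?case
    by (rule Ck_on_SucI[where D = "\<lambda>x v. fd f x v + fd g x v"])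
      (use assms Suc Ck_on_SucD[OF Suc.prems(1)] Ck_on_SucD[OF Suc.prems(2)] has_derivative_add in auto)
qed (simp add: continuous_on_add)

lemma Ck_on_bilinear:
  fixes pr :: "'b::real_normed_vector \<Rightarrow> 'c::real_normed_vector \<Rightarrow> 'd::real_normed_vector"
  assumes "bounded_bilinear pr" "open S" "Ck_on k S f" "Ck_on k S g"
  shows "Ck_on k S (\<lambda>x. pr (f x) (g x))"
  using assms(3,4)
proof (induction k arbitrary: f g)
  case 0
  then show ?case using bounded_bilinear.continuous_on[OF assms(1)] by simp
next
  case (Suc k)
  note f = Ck_on_SucD[OF Suc.prems(1)] and g = Ck_on_SucD[OF Suc.prems(2)]
  show ?case
  proof (rule Ck_on_SucI[where D = "\<lambda>x v. pr (f x) (fd g x v) + pr (fd f x v) (g x)"])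
    show "((\<lambda>x. pr (f x) (g x)) has_derivative (\<lambda>v. pr (f x) (fd g x v) + pr (fd f x v) (g x))) (at x)"
      if "x \<in> S" for x
      by (rule bounded_bilinear.FDERIV[OF assms(1)]) (use f(1) g(1) that in auto)
    show "Ck_on k S (\<lambda>x. pr (f x) (fd g x v) + pr (fd f x v) (g x))" for v
      using f(2) g(2) Suc.prems[THEN Ck_on_Suc_imp] by (intro Ck_on_add assms Suc.IH) auto
  qed (rule assms)
qed

text \<open>The derivative of \<open>1 / f\<close> is a product of the derivative of \<open>f\<close> and copies of \<open>1 / f\<close>, which lets the induction
  hypothesis apply to \<open>1 / f\<close> itself.\<close>

lemma Ck_on_inverse:
  fixes f :: "'a::real_normed_vector \<Rightarrow> real"
  assumes "open S" "Ck_on k S f" "\<And>x. x \<in> S \<Longrightarrow> f x \<noteq> 0"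
  shows "Ck_on k S (\<lambda>x. inverse (f x))"
  using assms(2,3)
proof (induction k)
  case 0
  then show ?case by (auto intro!: continuous_intros)
next
  case (Suc k)
  note f = Ck_on_SucD[OF Suc.prems(1)]
  show ?case
  proof (rule Ck_on_SucI[where D = "\<lambda>x v. - (inverse (f x) * fd f x v * inverse (f x))"])
    show "((\<lambda>x. inverse (f x)) has_derivative (\<lambda>v. - (inverse (f x) * fd f x v * inverse (f x)))) (at x)"
      if "x \<in> S" for x by (rule Deriv.has_derivative_inverse[where f = f, OF Suc.prems(2)[OF that] f(1)[OF that]])
    fix v
    have i: "Ck_on k S (\<lambda>x. inverse (f x))" using Suc Ck_on_Suc_imp by blast
    have "Ck_on k S (\<lambda>x. (- 1) * (inverse (f x) * fd f x v * inverse (f x)))"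
      by (intro Ck_on_bilinear[OF bounded_bilinear_mult] i f(2) assms(1) Ck_on_const)
    then show "Ck_on k S (\<lambda>x. - (inverse (f x) * fd f x v * inverse (f x)))" by simp
  qed (rule assms)
qed

lemma Ck_on_ln:
  fixes f :: "'a::real_normed_vector \<Rightarrow> real"
  assumes "open S" "Ck_on k S f" "\<And>x. x \<in> S \<Longrightarrow> f x > 0"
  shows "Ck_on k S (\<lambda>x. ln (f x))"
proof (cases k)
  case 0
  have "\<forall>x\<in>S. f x \<noteq> 0" using assms(3) by force
  then show ?thesis using assms 0 by (auto intro!: continuous_intros)
next
  case (Suc k')
  have f: "Ck_on (Suc k') S f" using assms(2) Suc by simp
  show ?thesis unfolding Suc
  proof (rule Ck_on_SucI[where D = "\<lambda>x v. fd f x v * inverse (f x)"])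
    show "((\<lambda>x. ln (f x)) has_derivative (\<lambda>v. fd f x v * inverse (f x))) (at x)" if "x \<in> S" for x
      using Ck_on_SucD(1)[OF f that] assms(3)[OF that]
      by (auto intro!: derivative_eq_intros simp: divide_inverse mult.commute)
    have "\<And>x. x \<in> S \<Longrightarrow> f x \<noteq> 0" using assms(3) by force
    then show "Ck_on k' S (\<lambda>x. fd f x v * inverse (f x))" for v
      by (intro Ck_on_bilinear[OF bounded_bilinear_mult] Ck_on_inverse Ck_on_SucD(2)[OF f] assms(1)
          Ck_on_Suc_imp[OF f]) auto
  qed (rule assms)
qed

text \<open>The norm is smooth away from \<open>0\<close> because \<open>ln \<bar>x\<bar>\<close> is half the logarithm of the inner product of \<open>x\<close> with itself.\<close>

lemma Ck_on_ln_norm: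
  fixes f :: "'a::real_normed_vector \<Rightarrow> 'b::real_inner"
  assumes "open S" "Ck_on k S f" "\<And>x. x \<in> S \<Longrightarrow> f x \<noteq> 0"
  shows "Ck_on k S (\<lambda>x. ln (norm (f x)))"
proof -
  have "Ck_on k S (\<lambda>x. (1/2) * ln (inner (f x) (f x)))"
    by (intro Ck_on_bilinear[OF bounded_bilinear_mult] Ck_on_const Ck_on_ln
        Ck_on_bilinear[OF bounded_bilinear_inner] assms) (use assms(3) in auto)
  moreover have "(1/2) * ln (inner (f x) (f x)) = ln (norm (f x))" if "x \<in> S" for x
    using assms(3)[OF that] by (simp add: dot_square_norm ln_realpow)
  ultimately show ?thesis using Ck_on_cong[OF assms(1)] by (metis (no_types, lifting))
qed

text \<open>The derivative in direction \<open>v\<close> of the derivative in direction \<open>w\<close>.\<close>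

definition D2 :: "('a::real_normed_vector \<Rightarrow> real) \<Rightarrow> 'a \<Rightarrow> 'a \<Rightarrow> 'a \<Rightarrow> real" where
  "D2 g p v w = fd (\<lambda>q. fd g q w) p v"

lemma D2_cong:
  assumes "open S" "p \<in> S" "\<And>x. x \<in> S \<Longrightarrow> f x = g x"
  shows "D2 f p v w = D2 g p v w"
  unfolding D2_def
proof (rule fun_cong[of _ _ v], rule frechet_derivative_cong_open(1)[OF assms(1,2)])
  fix q assume "q \<in> S"
  from frechet_derivative_cong_open(1)[OF assms(1) this] assms(3) show "fd f q w = fd g q w" by metis
qed

lemma D2_diff:
  assumes "open S" "p \<in> S" "Ck_on 2 S f" "Ck_on 2 S g"
  shows "D2 (\<lambda>x. f x - g x) p v w = D2 f p v w - D2 g p v w"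
proof -
  have f: "Ck_on (Suc (Suc 0)) S f" and g: "Ck_on (Suc (Suc 0)) S g"
    using assms by (simp_all add: numeral_2_eq_2)
  have "fd (\<lambda>x. f x - g x) q w = fd f q w - fd g q w" if "q \<in> S" for q
    using has_derivative_diff[OF Ck_on_SucD(1)[OF f that] Ck_on_SucD(1)[OF g that]]
    by (simp add: frechet_derivative_at[symmetric])
  then have "D2 (\<lambda>x. f x - g x) p v w = fd (\<lambda>q. fd f q w - fd g q w) p v"
    unfolding D2_def using frechet_derivative_cong_open(1)[OF assms(1,2)]
    by (metis (no_types, lifting))
  also have "\<dots> = D2 f p v w - D2 g p v w"
    using has_derivative_diff[OF Ck_on_SucD(1)[OF Ck_on_SucD(2)[OF f, where v = w] assms(2)]
        Ck_on_SucD(1)[OF Ck_on_SucD(2)[OF g, where v = w] assms(2)]]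
    unfolding D2_def by (simp add: frechet_derivative_at[symmetric])
  finally show ?thesis .
qed

lemma ddc_eq_D2:
  fixes g :: "complex ^ 'n::finite \<Rightarrow> real"
  assumes S: "open S" "p \<in> S" and g: "Ck_on 2 S g"
  shows "ddc (\<lambda>x. of_real (g x)) p v w =
    of_real (- (1 / (2 * pi)) * (D2 g p v (\<i> *s w) - D2 g p w (\<i> *s v)))"
proof -
  have g': "Ck_on (Suc (Suc 0)) S g" using g by (simp add: numeral_2_eq_2)
  have dc: "dc (\<lambda>x. of_real (g x)) q v = of_real (- (1 / (2 * pi)) * fd g q (\<i> *s v))" if "q \<in> S" for q v
  proof -
    have "((\<lambda>x. complex_of_real (g x)) has_derivative (\<lambda>v. of_real (fd g q v))) (at q)"
      by (rule has_derivative_of_real[OF Ck_on_SucD(1)[OF g' that]])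
    then have "fd (\<lambda>x. complex_of_real (g x)) q v = of_real (fd g q v)" for v
      by (simp add: frechet_derivative_at[symmetric])
    then show ?thesis
      unfolding dc_def dolbeault_del_def dolbeault_delbar_def
      by (simp add: diff_divide_distrib[symmetric])
  qed
  have "fd (\<lambda>q. dc (\<lambda>x. of_real (g x)) q w) p v = of_real (- (1 / (2 * pi)) * D2 g p v (\<i> *s w))" for v w
  proof -
    have "((\<lambda>q. fd g q (\<i> *s w)) has_derivative (\<lambda>v. D2 g p v (\<i> *s w))) (at p)"
      unfolding D2_def by (rule Ck_on_SucD(1)[OF Ck_on_SucD(2)[OF g'] S(2)])
    then have "((\<lambda>q. complex_of_real (- (1 / (2 * pi)) * fd g q (\<i> *s w))) has_derivative
        (\<lambda>v. of_real (- (1 / (2 * pi)) * D2 g p v (\<i> *s w)))) (at p)"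
      by (intro has_derivative_of_real has_derivative_mult_right)
    then have "fd (\<lambda>q. complex_of_real (- (1 / (2 * pi)) * fd g q (\<i> *s w))) p v
        = of_real (- (1 / (2 * pi)) * D2 g p v (\<i> *s w))"
      by (simp add: frechet_derivative_at[symmetric])
    moreover have "frechet_derivative (\<lambda>q. dc (\<lambda>x. of_real (g x)) q w) (at p)
      = frechet_derivative (\<lambda>q. complex_of_real (- (1 / (2 * pi)) * fd g q (\<i> *s w))) (at p)"
      by (rule frechet_derivative_cong_open(1)[OF S dc])
    ultimately show ?thesis by simp
  qed
  then show ?thesis unfolding ddc_def ext_deriv_def
    by (simp add: algebra_simps)
qed

text \<open>For a complex linear \<open>L\<close> the result is symmetric and complex bilinear in \<open>v\<close> and \<open>w\<close>, so by \<open>ddc_eq_D2\<close> it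
  contributes nothing to \<open>ddc\<close>: the logarithm of the modulus of an affine function is pluriharmonic.\<close>

lemma D2_ln_cmod:
  fixes L :: "complex ^ 'n::finite \<Rightarrow> complex"
  assumes L: "bounded_linear L" and p: "c + L p \<noteq> 0"
  shows "D2 (\<lambda>x. ln (cmod (c + L x))) p v w = - Re (L v * L w / (c + L p)\<^sup>2)"
proof -
  define S where "S = {x. c + L x \<noteq> 0}"
  have "open ((\<lambda>x. c + L x) -` (- {0}))"
    by (intro open_vimage continuous_intros linear_continuous_on L)
  then have S: "open S" "p \<in> S" using p by (auto simp: S_def vimage_def)
  have D: "((\<lambda>x. c + L x) has_derivative L) (at q)" for q
    using has_derivative_add[OF has_derivative_const bounded_linear_imp_has_derivative[OF L], of c] by simp
  have "fd (\<lambda>x. ln (cmod (c + L x))) q w = Re (L w / (c + L q))" if "q \<in> S" for q w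
  proof -
    have nz: "c + L q \<noteq> 0" using that by (simp add: S_def)
    have "((\<lambda>x. cmod (c + L x)) has_derivative (\<lambda>v. inner (L v) (sgn (c + L q)))) (at q)"
      by (rule has_derivative_compose[OF D, of norm]) (use has_derivative_norm[OF nz] in simp)
    moreover have "(ln has_derivative (\<lambda>h. h / cmod (c + L q))) (at (cmod (c + L q)))"
      using nz by (auto intro!: derivative_eq_intros simp: divide_inverse)
    ultimately have "((\<lambda>x. ln (cmod (c + L x))) has_derivative (\<lambda>v. inner (L v) (sgn (c + L q)) / cmod (c + L q))) (at q)"
      by (rule has_derivative_compose)
    then have "fd (\<lambda>x. ln (cmod (c + L x))) q w = inner (L w) (sgn (c + L q)) / cmod (c + L q)"
      by (simp add: frechet_derivative_at[symmetric])
    also have "\<dots> = Re (L w / (c + L q))"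
    proof -
      have "inner a (sgn u) / cmod u = (Re a * Re u + Im a * Im u) / (cmod u)\<^sup>2" for a u
        by (simp add: inner_complex_def sgn_div_norm power2_eq_square divide_inverse algebra_simps)
      then show ?thesis unfolding Re_divide cmod_power2 .
    qed
    finally show ?thesis .
  qed
  then have "D2 (\<lambda>x. ln (cmod (c + L x))) p v w = fd (\<lambda>q. Re (L w / (c + L q))) p v"
    unfolding D2_def using frechet_derivative_cong_open(1)[OF S] by (metis (no_types, lifting))
  also have "\<dots> = - Re (L v * L w / (c + L p)\<^sup>2)"
  proof -
    have "((\<lambda>q. L w / (c + L q)) has_derivative (\<lambda>v. - L w * (inverse (c + L p) * L v * inverse (c + L p)))) (at p)"
      using has_derivative_divide'[OF has_derivative_const D p, of "L w"]
      by (simp add: divide_inverse power2_eq_square mult_ac)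
    from has_derivative_Re[OF this]
    show ?thesis by (simp add: frechet_derivative_at[symmetric] divide_inverse power2_eq_square mult_ac)
  qed
  finally show ?thesis .
qed

text \<open>If the Laplacian on the complex line through \<open>p\<close> in direction \<open>b\<close> vanishes at the single point \<open>p\<close>, the second
  order Taylor polynomial along that line is the real part of a holomorphic polynomial. A difference of two potentials
  of the same form is thus invisible to the viscosity condition. The remainder is estimated by the mean value theorem
  on the segment from \<open>p\<close> to \<open>p + \<zeta> b\<close> and the differentiability of the first derivatives at \<open>p\<close>.\<close>

lemma taylor_on_complex_line:
  fixes g :: "complex ^ 'n::finite \<Rightarrow> real"
  assumes S: "open S" "p \<in> S" and g: "Ck_on 2 S g"
    and lap: "D2 g p b b + D2 g p (\<i> *s b) (\<i> *s b) = 0" and \<delta>: "0 < \<delta>"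
  shows "\<exists>R k. 0 < R \<and> k holomorphic_on ball 0 R \<and>
     (\<forall>\<zeta>\<in>ball 0 R. p + \<zeta> *s b \<in> S \<and> \<bar>g (p + \<zeta> *s b) - g p - Re (k \<zeta> - k 0)\<bar> \<le> \<delta> * (cmod \<zeta>)\<^sup>2)"
proof -
  have g': "Ck_on (Suc (Suc 0)) S g" using g by (simp add: numeral_2_eq_2)
  define H1 where "H1 q = fd g q b" for q
  define H2 where "H2 q = fd g q (\<i> *s b)" for q
  have D1: "(H1 has_derivative (\<lambda>v. D2 g p v b)) (at p)"
    unfolding D2_def H1_def by (rule Ck_on_SucD(1)[OF Ck_on_SucD(2)[OF g'] S(2)])
  have D2': "(H2 has_derivative (\<lambda>v. D2 g p v (\<i> *s b))) (at p)"
    unfolding D2_def H2_def by (rule Ck_on_SucD(1)[OF Ck_on_SucD(2)[OF g'] S(2)])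
  have split: "\<zeta> *s b = Re \<zeta> *\<^sub>R b + Im \<zeta> *\<^sub>R (\<i> *s b)" for \<zeta>
    by (simp add: vec_eq_iff complex_eq_iff)
  define A where "A = D2 g p b b"
  define B where "B = D2 g p (\<i> *s b) b"
  define C where "C = D2 g p b (\<i> *s b)"
  have lin1: "D2 g p (\<zeta> *s b) b = Re \<zeta> * A + Im \<zeta> * B" for \<zeta>
    unfolding split[of \<zeta>] A_def B_def
    by (simp add: linear_add[OF has_derivative_linear[OF D1]] linear_scale[OF has_derivative_linear[OF D1]])
  have lin2: "D2 g p (\<zeta> *s b) (\<i> *s b) = Re \<zeta> * C - Im \<zeta> * A" for \<zeta>
  proof -
    have "D2 g p (\<i> *s b) (\<i> *s b) = - A" using lap by (simp add: A_def)
    then show ?thesis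
      unfolding split[of \<zeta>] C_def
      by (simp add: linear_add[OF has_derivative_linear[OF D2']] linear_scale[OF has_derivative_linear[OF D2']])
  qed
  define e where "e = \<delta> / (2 * (norm b + 1))"
  have e: "e > 0" using \<delta> by (auto simp: e_def intro!: divide_pos_pos add_nonneg_pos)
  obtain d1 where d1: "d1 > 0" "\<And>q. norm (q - p) < d1 \<Longrightarrow> \<bar>H1 q - H1 p - D2 g p (q - p) b\<bar> \<le> e * norm (q - p)"
    using D1 e unfolding has_derivative_at_alt real_norm_def by blast
  obtain d2 where d2: "d2 > 0" "\<And>q. norm (q - p) < d2 \<Longrightarrow> \<bar>H2 q - H2 p - D2 g p (q - p) (\<i> *s b)\<bar> \<le> e * norm (q - p)"
    using D2' e unfolding has_derivative_at_alt real_norm_def by blast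
  obtain d3 where d3: "d3 > 0" "ball p d3 \<subseteq> S" using S openE by blast
  define d where "d = min d1 (min d2 d3)"
  have d: "d > 0" using d1 d2 d3 by (simp add: d_def)
  define R where "R = d / (norm b + 1)"
  have b1: "0 < norm b + 1" by (simp add: add_nonneg_pos)
  have R: "R > 0" using d b1 by (simp add: R_def)
  \<comment> \<open>With \<open>\<zeta> = x + i y\<close>: the vanishing Laplacian makes the pure second derivatives \<open>A\<close> and \<open>-A\<close>, so the quadratic part is
      \<open>(A (x\<^sup>2 - y\<^sup>2) + (B + C) x y) / 2\<close>, the real part of a multiple of \<open>\<zeta>\<^sup>2\<close>.\<close>
  define k where "k \<zeta> = Complex (H1 p) (- H2 p) * \<zeta> + Complex (A / 2) (- (B + C) / 4) * \<zeta>\<^sup>2" for \<zeta>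
  have near: "norm (\<zeta> *s b) < d" if "\<zeta> \<in> ball 0 R" for \<zeta>
  proof -
    have "norm (\<zeta> *s b) \<le> cmod \<zeta> * (norm b + 1)" by (simp add: norm_smult mult_left_mono)
    also have "\<dots> < R * (norm b + 1)" using that b1 by (intro mult_strict_right_mono) auto
    finally show ?thesis using b1 by (simp add: R_def)
  qed
  have "\<bar>g (p + \<zeta> *s b) - g p - Re (k \<zeta> - k 0)\<bar> \<le> \<delta> * (cmod \<zeta>)\<^sup>2" if \<zeta>: "\<zeta> \<in> ball 0 R" for \<zeta>
  proof -
    define x y where "x = Re \<zeta>" and "y = Im \<zeta>"
    define a1 where "a1 = x * H1 p + y * H2 p"
    define a2 where "a2 = (x * (x * A + y * B) + y * (x * C - y * A)) / 2"
    have k: "Re (k \<zeta> - k 0) = a1 + a2"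
      by (simp add: k_def a1_def a2_def x_def y_def power2_eq_square field_simps)
    define \<phi> where "\<phi> s = g (p + s *\<^sub>R (\<zeta> *s b)) - s * a1 - s\<^sup>2 * a2" for s
    define \<phi>' where "\<phi>' s = (x * H1 (p + s *\<^sub>R (\<zeta> *s b)) + y * H2 (p + s *\<^sub>R (\<zeta> *s b))) - a1 - 2 * s * a2" for s
    have near_s: "norm (s *\<^sub>R (\<zeta> *s b)) < d" if "0 \<le> s" "s \<le> 1" for s
      using near[OF \<zeta>] that mult_left_le_one_le[of "norm (\<zeta> *s b)" s] by simp
    have der: "(\<phi> has_real_derivative \<phi>' s) (at s)" if s: "0 \<le> s" "s \<le> 1" for s
    proof -
      have "p + s *\<^sub>R (\<zeta> *s b) \<in> S" using near_s[OF s] d3 by (auto simp: d_def dist_norm)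
      note Dg = Ck_on_SucD(1)[OF g' this]
      have "((\<lambda>s. p + s *\<^sub>R (\<zeta> *s b)) has_derivative (\<lambda>h. h *\<^sub>R (\<zeta> *s b))) (at s)"
        by (auto intro!: derivative_eq_intros)
      from has_derivative_compose[OF this Dg]
      have "((\<lambda>s. g (p + s *\<^sub>R (\<zeta> *s b))) has_derivative (\<lambda>h. fd g (p + s *\<^sub>R (\<zeta> *s b)) (h *\<^sub>R (\<zeta> *s b)))) (at s)" .
      moreover have "fd g (p + s *\<^sub>R (\<zeta> *s b)) (h *\<^sub>R (\<zeta> *s b)) =
          (x * H1 (p + s *\<^sub>R (\<zeta> *s b)) + y * H2 (p + s *\<^sub>R (\<zeta> *s b))) * h" for h
        using linear_add[OF has_derivative_linear[OF Dg]] linear_scale[OF has_derivative_linear[OF Dg]]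
        unfolding split[of \<zeta>] H1_def H2_def x_def y_def by (simp add: algebra_simps)
      ultimately have "((\<lambda>s. g (p + s *\<^sub>R (\<zeta> *s b))) has_real_derivative
          (x * H1 (p + s *\<^sub>R (\<zeta> *s b)) + y * H2 (p + s *\<^sub>R (\<zeta> *s b)))) (at s)"
        by (simp add: has_field_derivative_def)
      then show ?thesis unfolding \<phi>_def \<phi>'_def
        by (auto intro!: derivative_eq_intros)
    qed
    obtain s where s: "0 < s" "s < 1" "\<phi> 1 - \<phi> 0 = (1 - 0) * \<phi>' s"
      using MVT2[of 0 1 \<phi> \<phi>'] der by auto
    define q where "q = p + s *\<^sub>R (\<zeta> *s b)"
    have qp: "q - p = (of_real s * \<zeta>) *s b" "norm (q - p) = s * cmod \<zeta> * norm b"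
    proof -
      show qp: "q - p = (of_real s * \<zeta>) *s b"
        by (simp add: q_def vec_eq_iff) (simp add: scaleR_conv_of_real)
      show "norm (q - p) = s * cmod \<zeta> * norm b" unfolding qp norm_smult norm_mult using s by simp
    qed
    have nq: "norm (q - p) < d1" "norm (q - p) < d2" using near_s[of s] s by (auto simp: q_def d_def)
    define E1 where "E1 = H1 q - H1 p - D2 g p (q - p) b"
    define E2 where "E2 = H2 q - H2 p - D2 g p (q - p) (\<i> *s b)"
    have "\<phi>' s = x * E1 + y * E2"
      unfolding E1_def E2_def qp(1) lin1 lin2 \<phi>'_def q_def[symmetric] a1_def a2_def
      by (simp add: x_def y_def field_simps)
    moreover have "\<bar>x * E1 + y * E2\<bar> \<le> \<delta> * (cmod \<zeta>)\<^sup>2"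
    proof -
      have n: "norm (q - p) \<le> cmod \<zeta> * (norm b + 1)"
      proof -
        have "s * (cmod \<zeta> * norm b) \<le> 1 * (cmod \<zeta> * (norm b + 1))"
          using s by (intro mult_mono) (auto intro!: mult_left_mono mult_nonneg_nonneg)
        then show ?thesis unfolding qp(2) by (simp add: mult.assoc)
      qed
      have "\<bar>E1\<bar> \<le> e * norm (q - p)" "\<bar>E2\<bar> \<le> e * norm (q - p)"
        unfolding E1_def E2_def using d1(2)[OF nq(1)] d2(2)[OF nq(2)] by auto
      moreover have "e * norm (q - p) \<le> e * (cmod \<zeta> * (norm b + 1))" using n e by (intro mult_left_mono) auto
      moreover have "e * (cmod \<zeta> * (norm b + 1)) = \<delta> / 2 * cmod \<zeta>" using b1 by (simp add: e_def field_simps)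
      ultimately have E: "\<bar>E1\<bar> \<le> \<delta> / 2 * cmod \<zeta>" "\<bar>E2\<bar> \<le> \<delta> / 2 * cmod \<zeta>" by linarith+
      have "\<bar>x * E1 + y * E2\<bar> \<le> \<bar>x\<bar> * \<bar>E1\<bar> + \<bar>y\<bar> * \<bar>E2\<bar>" by (metis abs_mult abs_triangle_ineq)
      also have "\<dots> \<le> cmod \<zeta> * (\<delta> / 2 * cmod \<zeta>) + cmod \<zeta> * (\<delta> / 2 * cmod \<zeta>)"
        unfolding x_def y_def by (intro add_mono mult_mono abs_Re_le_cmod abs_Im_le_cmod E) auto
      also have "\<dots> = \<delta> * (cmod \<zeta>)\<^sup>2" by (simp add: power2_eq_square)
      finally show ?thesis .
    qed
    moreover have "\<phi> 1 - \<phi> 0 = g (p + \<zeta> *s b) - g p - Re (k \<zeta> - k 0)" using k by (simp add: \<phi>_def)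
    ultimately show ?thesis using s(3) by simp
  qed
  moreover have "k holomorphic_on ball 0 R" unfolding k_def by (intro holomorphic_intros)
  moreover have "p + \<zeta> *s b \<in> S" if "\<zeta> \<in> ball 0 R" for \<zeta>
    using near[OF that] d3(2) by (auto simp: d_def dist_norm)
  ultimately show ?thesis using R by blast
qed

section \<open>Omega-plurisubharmonic functions and their lifts to the cone\<close>

lemma abs_cproj_rep [simp]: "abs_cproj (rep_cproj Z) = Z"
  by (rule Quotient3_abs_rep[OF Quotient3_cproj])

lemma rep_cproj_nonzero [simp]: "rep_cproj Z \<noteq> 0"
  using Quotient3_rep_reflp[OF Quotient3_cproj, of Z] by (simp add: homog_eq_def)

lemma abs_cproj_smult:
  assumes "z \<noteq> 0" "c \<noteq> 0"
  shows "abs_cproj (c *s z) = abs_cproj z"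
proof -
  have "homog_eq z (c *s z)" using assms by (auto simp: homog_eq_def)
  then show ?thesis using Quotient3_rel[OF Quotient3_cproj, of z "c *s z"] by metis
qed

lemma rep_abs_cproj:
  assumes "z \<noteq> 0"
  obtains c where "c \<noteq> 0" "rep_cproj (abs_cproj z) = c *s z"
proof -
  have "homog_eq z z" using assms by (auto simp: homog_eq_def intro: exI[of _ 1])
  moreover have "homog_eq (rep_cproj (abs_cproj z)) (rep_cproj (abs_cproj z))"
    by (rule Quotient3_rep_reflp[OF Quotient3_cproj])
  ultimately have "homog_eq z (rep_cproj (abs_cproj z))"
    using Quotient3_rel[OF Quotient3_cproj, of z "rep_cproj (abs_cproj z)"] by simp
  then obtain c where "rep_cproj (abs_cproj z) = c *s z" by (auto simp: homog_eq_def)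
  moreover from this have "c \<noteq> 0" using rep_cproj_nonzero[of "abs_cproj z"] by auto
  ultimately show ?thesis using that by blast
qed

lemma open_cproj_iff: "open U \<longleftrightarrow> open {z. z \<noteq> 0 \<and> abs_cproj z \<in> U}"
  by (rule open_cproj_def)

text \<open>The linear part of the affine map \<open>affine_vec j\<close>.\<close>

definition affine_lin :: "'n::finite option \<Rightarrow> complex ^ 'n \<Rightarrow> complex ^ ('n option)" where
  "affine_lin j w = (\<chi> i. if i = j then 0
     else (case i of Some l \<Rightarrow> w $ l | None \<Rightarrow> w $ (the j)))"

lemma affine_vec_add: "affine_vec j (p + w) = affine_vec j p + affine_lin j w"
  by (simp add: affine_vec_def affine_lin_def vec_eq_iff split: option.split)

lemma affine_lin_smult: "affine_lin j (c *s w) = c *s affine_lin j w"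
  by (simp add: affine_lin_def vec_eq_iff split: option.split)

lemma bounded_linear_affine_lin: "bounded_linear (affine_lin j)"
  unfolding linear_conv_bounded_linear[symmetric]
  by (rule linearI) (simp_all add: affine_lin_def vec_eq_iff split: option.split)

lemma affine_vec_eq: "affine_vec j w = affine_vec j 0 + affine_lin j w"
  using affine_vec_add[of j 0 w] by simp

lemma affine_vec_index [simp]: "affine_vec j w $ j = 1"
  by (simp add: affine_vec_def)

lemma affine_vec_nonzero [simp]: "affine_vec j w \<noteq> 0"
  using affine_vec_index[of j w] by (metis zero_index zero_neq_one)

lemma continuous_on_affine_vec: "continuous_on S (affine_vec j)"
proof -
  have "continuous_on S (\<lambda>w. affine_vec j 0 + affine_lin j w)"
    by (intro continuous_intros linear_continuous_on bounded_linear_affine_lin)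
  then show ?thesis by (simp flip: affine_vec_eq)
qed

lemma open_affine_chart_vimage:
  assumes "open U"
  shows "open (affine_chart j -` U)"
proof -
  have eq: "affine_chart j -` U = affine_vec j -` {z. z \<noteq> 0 \<and> abs_cproj z \<in> U}"
    by (auto simp: affine_chart_def)
  show ?thesis
    unfolding eq using assms by (intro open_vimage continuous_on_affine_vec) (simp add: open_cproj_iff)
qed

text \<open>The inverse of the chart \<open>affine_vec j\<close>, up to scaling by the \<open>j\<close>-th coordinate.\<close>

definition affine_coord :: "'n::finite option \<Rightarrow> complex ^ ('n option) \<Rightarrow> complex ^ 'n" where
  "affine_coord j z = (\<chi> l. (if Some l = j then z $ None else z $ Some l) / z $ j)"

lemma affine_vec_coord: "z $ j \<noteq> 0 \<Longrightarrow> z = (z $ j) *s affine_vec j (affine_coord j z)"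
  by (auto simp: affine_vec_def affine_coord_def vec_eq_iff split: option.split)

lemma continuous_on_affine_coord: "continuous_on {z :: complex ^ 'a::finite option. z $ j \<noteq> 0} (affine_coord j)"
  unfolding affine_coord_def
proof (intro continuous_on_vec_lambda)
  fix l
  show "continuous_on {z :: complex ^ 'a option. z $ j \<noteq> 0} (\<lambda>z. (if Some l = j then z $ None else z $ Some l) / z $ j)"
  proof -
    have c: "continuous_on A (\<lambda>x :: complex ^ 'a option. x $ i)" for A i by (intro continuous_intros)
    have "continuous_on {z :: complex ^ 'a option. z $ j \<noteq> 0} (\<lambda>z. z $ i / z $ j)" for i
      by (rule continuous_on_divide[OF c c]) simp
    then show ?thesis by (cases "Some l = j") simp_all
  qed
qed

text \<open>A complex line in homogeneous coordinates becomes a complex line in the chart, run through with a Moebius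
  parameter.\<close>

lemma affine_coord_on_line:
  assumes a: "a $ j \<noteq> 0" and nz: "1 + b $ j / a $ j * \<zeta> \<noteq> 0"
  shows "affine_coord j (a + \<zeta> *s b) = affine_coord j a + (\<zeta> / (1 + b $ j / a $ j * \<zeta>)) *s
    (\<chi> l. ((if Some l = j then b $ None else b $ Some l) * a $ j
         - (if Some l = j then a $ None else a $ Some l) * b $ j) / (a $ j)\<^sup>2)"
proof -
  have nz': "a $ j + \<zeta> * b $ j \<noteq> 0" using a nz by (simp add: field_simps)
  have "(x + \<zeta> * y) / (a $ j + \<zeta> * b $ j) =
     x / a $ j + \<zeta> / (1 + b $ j / a $ j * \<zeta>) * ((y * a $ j - x * b $ j) / (a $ j)\<^sup>2)" for x y
  proof -
    have "1 + b $ j / a $ j * \<zeta> = (a $ j + \<zeta> * b $ j) / a $ j" using a by (simp add: field_simps)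
    then have "x / a $ j + \<zeta> / (1 + b $ j / a $ j * \<zeta>) * ((y * a $ j - x * b $ j) / (a $ j)\<^sup>2)
      = x / a $ j + \<zeta> * (y * a $ j - x * b $ j) / ((a $ j + \<zeta> * b $ j) * a $ j)"
      using a by (simp add: power2_eq_square)
    also have "\<dots> = (x * (a $ j + \<zeta> * b $ j) + \<zeta> * (y * a $ j - x * b $ j)) / ((a $ j + \<zeta> * b $ j) * a $ j)"
      using a nz' by (simp add: add_divide_distrib)
    also have "\<dots> = (x + \<zeta> * y) * a $ j / ((a $ j + \<zeta> * b $ j) * a $ j)" by (simp add: algebra_simps)
    also have "\<dots> = (x + \<zeta> * y) / (a $ j + \<zeta> * b $ j)" using a by simp
    finally show ?thesis by simp
  qed
  then show ?thesis by (simp add: affine_coord_def vec_eq_iff)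
qed

text \<open>\<open>\<phi>\<close> is \<open>\<omega>\<close>-plurisubharmonic exactly if this logarithmically homogeneous function on the cone is
  plurisubharmonic, since \<open>log \<bar>z\<bar>\<close> is the potential of the pullback of \<open>\<omega>\<close>.\<close>

definition log_lift :: "('n::finite cproj \<Rightarrow> ereal) \<Rightarrow> complex ^ ('n option) \<Rightarrow> ereal" where
  "log_lift \<phi> z = \<phi> (abs_cproj z) + ereal (ln (norm z))"

lemma log_lift_smult:
  assumes "z \<noteq> 0" "c \<noteq> 0"
  shows "log_lift \<phi> (c *s z) = log_lift \<phi> z + ereal (ln (cmod c))"
proof -
  have "ln (norm (c *s z)) = ln (norm z) + ln (cmod c)" using assms by (simp add: norm_smult ln_mult)
  then show ?thesis
    unfolding log_lift_def abs_cproj_smult[OF assms] by (cases "\<phi> (abs_cproj z)") auto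
qed

text \<open>The potential \<open>log (\<bar>Z\<bar> / \<bar>Z\<^sub>j\<bar>)\<close> of the Fubini--Study form off the hyperplane \<open>Z\<^sub>j = 0\<close>.\<close>

definition hyperplane_potential :: "'n::finite option \<Rightarrow> 'n cproj \<Rightarrow> real" where
  "hyperplane_potential j Z = ln (norm (rep_cproj Z)) - ln (cmod (rep_cproj Z $ j))"

lemma hyperplane_potential_abs:
  assumes "z $ j \<noteq> 0"
  shows "hyperplane_potential j (abs_cproj z) = ln (norm z) - ln (cmod (z $ j))"
proof -
  have "z \<noteq> 0" using assms by auto
  then obtain c where c: "c \<noteq> 0" "rep_cproj (abs_cproj z) = c *s z" by (rule rep_abs_cproj)
  then show ?thesis using assms \<open>z \<noteq> 0\<close>
    by (simp add: hyperplane_potential_def norm_smult norm_mult ln_mult)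
qed

lemma hyperplane_complement:
  assumes "z \<noteq> 0"
  shows "abs_cproj z \<in> {Z. rep_cproj Z $ j \<noteq> 0} \<longleftrightarrow> z $ j \<noteq> 0"
proof -
  obtain c where "c \<noteq> 0" "rep_cproj (abs_cproj z) = c *s z" by (rule rep_abs_cproj[OF assms])
  then show ?thesis by simp
qed

lemma open_hyperplane_complement: "open {Z :: 'a::finite cproj. rep_cproj Z $ j \<noteq> 0}"
proof -
  have "{z. z \<noteq> 0 \<and> abs_cproj z \<in> {Z. rep_cproj Z $ j \<noteq> 0}} = (\<lambda>z. z $ j) -` (- {0})"
  proof (rule set_eqI)
    fix x :: "complex ^ 'a option"
    show "x \<in> {z. z \<noteq> 0 \<and> abs_cproj z \<in> {Z. rep_cproj Z $ j \<noteq> 0}} \<longleftrightarrow> x \<in> (\<lambda>z. z $ j) -` (- {0})"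
    proof (cases "x = 0")
      case False
      then show ?thesis using hyperplane_complement[OF False, of j] by simp
    qed simp
  qed
  moreover have "open ((\<lambda>z :: complex ^ _. z $ j) -` (- {0}))"
    by (intro open_vimage continuous_intros)
  ultimately show ?thesis by (simp add: open_cproj_iff)
qed

lemma Ck_on_affine_vec: "open S \<Longrightarrow> Ck_on k S (affine_vec j)"
proof -
  assume S: "open S"
  have "Ck_on k S (\<lambda>w. affine_vec j 0 + affine_lin j w)"
    by (intro Ck_on_add Ck_on_const Ck_on_linear S bounded_linear_affine_lin)
  then show ?thesis by (simp flip: affine_vec_eq)
qed

text \<open>In the \<open>k\<close>-th chart the potential differs from \<open>log \<bar>affine_vec k w\<bar>\<close>, whose \<open>ddc\<close> is the Fubini--Study form by
  definition, by the logarithm of the modulus of an affine function.\<close>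

lemma fs_potential_hyperplane: "fs_potential_on {Z. rep_cproj Z $ j \<noteq> 0} (hyperplane_potential j)"
  unfolding fs_potential_on_def
proof (intro conjI allI ballI)
  show "open {Z :: 'a cproj. rep_cproj Z $ j \<noteq> 0}" by (rule open_hyperplane_complement)
  fix k :: "'a option"
  define S where "S = affine_chart k -` {Z. rep_cproj Z $ j \<noteq> 0}"
  have S: "open S" unfolding S_def by (rule open_affine_chart_vimage[OF open_hyperplane_complement])
  have Sj: "affine_vec k w $ j \<noteq> 0" if "w \<in> S" for w
    using that hyperplane_complement[of "affine_vec k w" j] by (simp add: S_def affine_chart_def)
  define c where "c = affine_vec k 0 $ j"
  define L where "L w = affine_lin k w $ j" for w
  have L: "bounded_linear L"
    unfolding L_def by (intro bounded_linear_compose[OF bounded_linear_vec_nth bounded_linear_affine_lin])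
  have cL: "affine_vec k w $ j = c + L w" for w
    using affine_vec_eq[of k w] by (simp add: c_def L_def)
  have L_i: "L (\<i> *s v) = \<i> * L v" for v by (simp add: L_def affine_lin_smult)
  define g1 where "g1 w = ln (norm (affine_vec k w))" for w
  define g2 where "g2 w = ln (cmod (c + L w))" for w
  have eq: "hyperplane_potential j (affine_chart k w) = g1 w - g2 w" if "w \<in> S" for w
    using hyperplane_potential_abs[OF Sj[OF that]] by (simp add: affine_chart_def g1_def g2_def cL)
  have C1: "Ck_on m S g1" for m
    unfolding g1_def by (intro Ck_on_ln_norm Ck_on_affine_vec S) auto
  have C2: "Ck_on m S g2" for m
    unfolding g2_def by (intro Ck_on_ln_norm Ck_on_add Ck_on_const Ck_on_linear S L) (use Sj cL in auto)
  have "Ck_on m S (\<lambda>w. g1 w + (- 1) * g2 w)" for m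
    by (intro Ck_on_add Ck_on_bilinear[OF bounded_bilinear_mult] Ck_on_const S C1 C2)
  then have C: "Ck_on m S (\<lambda>w. g1 w - g2 w)" for m by simp
  have C': "Ck_on m S (\<lambda>w. hyperplane_potential j (affine_chart k w))" for m
  proof -
    have "Ck_on m S (\<lambda>w. hyperplane_potential j (affine_chart k w)) \<longleftrightarrow> Ck_on m S (\<lambda>w. g1 w - g2 w)"
      by (rule Ck_on_cong[OF S eq])
    then show ?thesis using C by blast
  qed
  then show "smooth_on (affine_chart k -` {Z. rep_cproj Z $ j \<noteq> 0}) (hyperplane_potential j \<circ> affine_chart k)"
    unfolding smooth_on_def S_def[symmetric] o_def by blast
  fix p assume "p \<in> affine_chart k -` {Z. rep_cproj Z $ j \<noteq> 0}"
  then have p: "p \<in> S" by (simp add: S_def)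
  show "ddc (\<lambda>w. of_real (hyperplane_potential j (affine_chart k w))) p = fubini_study k p"
  proof (intro ext)
    fix v w
    have D: "D2 (\<lambda>w. hyperplane_potential j (affine_chart k w)) p v w = D2 g1 p v w - D2 g2 p v w" for v w
    proof -
      have "D2 (\<lambda>w. hyperplane_potential j (affine_chart k w)) p v w = D2 (\<lambda>w. g1 w - g2 w) p v w"
        by (rule D2_cong[OF S p eq])
      then show ?thesis unfolding D2_diff[OF S p C1 C2] .
    qed
    have z: "D2 g2 p v (\<i> *s w) = D2 g2 p w (\<i> *s v)"
      unfolding g2_def using Sj[OF p] by (simp add: D2_ln_cmod[OF L] cL L_i mult_ac)
    have "D2 (\<lambda>w. hyperplane_potential j (affine_chart k w)) p v (\<i> *s w)
        - D2 (\<lambda>w. hyperplane_potential j (affine_chart k w)) p w (\<i> *s v)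
        = D2 g1 p v (\<i> *s w) - D2 g1 p w (\<i> *s v)"
      unfolding D z by simp
    then show "ddc (\<lambda>w. of_real (hyperplane_potential j (affine_chart k w))) p v w = fubini_study k p v w"
      unfolding fubini_study_def ddc_eq_D2[OF S p C'] g1_def[symmetric] ddc_eq_D2[OF S p C1] by simp
  qed
qed

text \<open>Near \<open>0\<close> the function \<open>k\<close> is \<open>- Ln (1 + \<beta> \<zeta>)\<close>; on the given ball the argument has positive real part and so stays
  off the branch cut.\<close>

lemma holomorphic_log_affine:
  obtains R k where "0 < R" "k holomorphic_on ball 0 R"
    "\<And>\<zeta>. \<zeta> \<in> ball 0 R \<Longrightarrow> 1 + \<beta> * \<zeta> \<noteq> 0"
    "\<And>\<zeta>. \<zeta> \<in> ball 0 R \<Longrightarrow> Re (k \<zeta> - k 0) = - ln (cmod (1 + \<beta> * \<zeta>))"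
proof -
  define R where "R = 1 / (cmod \<beta> + 1)"
  have b1: "cmod \<beta> + 1 > 0" by (simp add: add_nonneg_pos)
  have R: "R > 0" using b1 by (simp add: R_def)
  have re: "0 < Re (1 + \<beta> * \<zeta>)" if "\<zeta> \<in> ball 0 R" for \<zeta>
  proof -
    have "cmod (\<beta> * \<zeta>) \<le> (cmod \<beta> + 1) * cmod \<zeta>" by (simp add: norm_mult mult_right_mono)
    also have "\<dots> < (cmod \<beta> + 1) * R" using that b1 by (intro mult_strict_left_mono) auto
    also have "\<dots> = 1" using b1 by (simp add: R_def)
    finally show ?thesis using abs_Re_le_cmod[of "\<beta> * \<zeta>"] by simp
  qed
  have nz: "1 + \<beta> * \<zeta> \<noteq> 0" if "\<zeta> \<in> ball 0 R" for \<zeta>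
    using re[OF that] by (metis less_irrefl zero_complex.sel(1))
  have slit: "1 + \<beta> * \<zeta> \<notin> \<real>\<^sub>\<le>\<^sub>0" if "\<zeta> \<in> ball 0 R" for \<zeta>
    using re[OF that] unfolding complex_nonpos_Reals_iff by linarith
  show ?thesis
  proof (rule that[OF R _ nz])
    show "(\<lambda>\<zeta>. - Ln (1 + \<beta> * \<zeta>)) holomorphic_on ball 0 R"
      using slit by (intro holomorphic_intros) auto
  qed (use nz in auto)
qed

text \<open>Near a point with \<open>a\<^sub>j \<noteq> 0\<close> the lift is the sum of \<open>\<phi>\<close> plus the hyperplane potential, evaluated in the \<open>j\<close>-th
  chart, and of \<open>log \<bar>z\<^sub>j\<bar>\<close>. Along a complex line the chart is entered with a Moebius parameter, and \<open>log \<bar>z\<^sub>j\<bar>\<close> is the real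
  part of a holomorphic function; the viscosity condition tolerates both.\<close>

theorem PSH_omega_log_lift:
  fixes \<phi> :: "'n::finite cproj \<Rightarrow> ereal"
  assumes \<phi>: "\<phi> \<in> PSH_omega"
  shows "psh_on (- {0}) (log_lift \<phi>)"
proof -
  let ?u = "log_lift \<phi>"
  have fin: "\<phi> Z \<noteq> \<infinity>" for Z using \<phi> by (simp add: PSH_omega_def)
  have fin': "?u z < \<infinity>" for z using fin[of "abs_cproj z"] by (cases "\<phi> (abs_cproj z)") (auto simp: log_lift_def)
  have chart: "psh_on UNIV (\<lambda>w. ?u (affine_vec j w))" for j
  proof -
    have "cproj_psh_on {Z. rep_cproj Z $ j \<noteq> 0} (\<lambda>Z. \<phi> Z + ereal (hyperplane_potential j Z))"
      using \<phi> fs_potential_hyperplane unfolding PSH_omega_def by blast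
    then have "psh_on (affine_chart j -` {Z. rep_cproj Z $ j \<noteq> 0})
        ((\<lambda>Z. \<phi> Z + ereal (hyperplane_potential j Z)) \<circ> affine_chart j)"
      unfolding cproj_psh_on_def by blast
    moreover have "affine_chart j -` {Z. rep_cproj Z $ j \<noteq> 0} = UNIV"
      using hyperplane_complement[of "affine_vec j _" j] by (auto simp: affine_chart_def)
    moreover have "((\<lambda>Z. \<phi> Z + ereal (hyperplane_potential j Z)) \<circ> affine_chart j) w = ?u (affine_vec j w)" for w
      by (simp add: affine_chart_def log_lift_def hyperplane_potential_abs)
    ultimately show ?thesis by (auto intro: psh_on_cong)
  qed
  have shift: "?u z = ?u (affine_vec j (affine_coord j z)) + ereal (ln (cmod (z $ j)))" if "z $ j \<noteq> 0" for j z
    using log_lift_smult[OF affine_vec_nonzero that, of \<phi> j "affine_coord j z"] affine_vec_coord[OF that] by simp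
  have op: "open {z :: complex ^ 'n option. z $ j \<noteq> 0}" for j
  proof -
    have "{z :: complex ^ 'n option. z $ j \<noteq> 0} = (\<lambda>z. z $ j) -` (- {0})" by auto
    also have "open \<dots>" by (intro open_vimage continuous_intros)
    finally show ?thesis .
  qed
  have ex: "\<exists>j. z $ j \<noteq> 0" if "z \<noteq> 0" for z :: "complex ^ 'n option"
    using that by (auto simp: vec_eq_iff)
  have usc: "usc_on (- {0}) ?u"
  proof (rule usc_on_locally)
    fix x :: "complex ^ 'n option" assume "x \<in> - {0}"
    then obtain j where j: "x $ j \<noteq> 0" using ex by auto
    have "usc_on {z. z $ j \<noteq> 0} (\<lambda>z. ?u (affine_vec j (affine_coord j z)) + ereal (ln (cmod (z $ j))))"
    proof (rule usc_on_add)
      show "usc_on {z. z $ j \<noteq> 0} (\<lambda>z. ?u (affine_vec j (affine_coord j z)))"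
        by (rule usc_on_compose[OF psh_on_usc[OF chart] continuous_on_affine_coord]) auto
      show "usc_on {z. z $ j \<noteq> 0} (\<lambda>z. ereal (ln (cmod (z $ j))))"
        by (intro usc_on_continuous continuous_intros) auto
    qed (use fin' in auto)
    then have "usc_on {z. z $ j \<noteq> 0} ?u"
      using usc_on_cong[of "{z. z $ j \<noteq> 0}" ?u "\<lambda>z. ?u (affine_vec j (affine_coord j z)) + ereal (ln (cmod (z $ j)))"] shift
      by blast
    then show "\<exists>T. open T \<and> x \<in> T \<and> T \<subseteq> - {0} \<and> usc_on T ?u"
      using op j by (intro exI[of _ "{z. z $ j \<noteq> 0}"]) auto
  qed auto
  have "visc_subharmonic0 (\<lambda>\<zeta>. ?u (a + \<zeta> *s b))" if a: "a \<noteq> 0" for a b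
  proof -
    obtain j where j: "a $ j \<noteq> 0" using ex[OF a] by auto
    define \<beta> where "\<beta> = b $ j / a $ j"
    define B where "B = (\<chi> l. ((if Some l = j then b $ None else b $ Some l) * a $ j
         - (if Some l = j then a $ None else a $ Some l) * b $ j) / (a $ j)\<^sup>2)"
    define f where "f \<zeta> = ?u (affine_vec j (affine_coord j a + (\<zeta> / (1 + \<beta> * \<zeta>)) *s B))" for \<zeta>
    have f: "visc_subharmonic0 f"
      unfolding f_def using chart[of j]
      by (intro visc_subharmonic0_moebius[of "\<lambda>\<zeta>. ?u (affine_vec j (affine_coord j a + \<zeta> *s B))"])
        (simp add: psh_on_iff_visc)
    have line: "?u (a + \<zeta> *s b) = f \<zeta> + ereal (ln (cmod (a $ j)) + ln (cmod (1 + \<beta> * \<zeta>)))"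
      if nz: "1 + \<beta> * \<zeta> \<noteq> 0" for \<zeta>
    proof -
      have j': "(a + \<zeta> *s b) $ j = a $ j * (1 + \<beta> * \<zeta>)" using j by (simp add: \<beta>_def field_simps)
      have "?u (a + \<zeta> *s b) = f \<zeta> + ereal (ln (cmod (a $ j * (1 + \<beta> * \<zeta>))))"
        using shift[of "a + \<zeta> *s b" j] affine_coord_on_line[OF j nz[unfolded \<beta>_def]] j nz
        unfolding j' f_def B_def \<beta>_def by simp
      then show ?thesis using j nz by (simp add: norm_mult ln_mult)
    qed
    show ?thesis
    proof (rule visc_subharmonic0_compare[OF f])
      show "f 0 \<noteq> - \<infinity>" if "?u (a + 0 *s b) \<noteq> - \<infinity>"
        using that line[of 0] by auto
      fix \<delta> :: real assume \<delta>: "0 < \<delta>"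
      obtain R k where R: "0 < R" and k: "k holomorphic_on ball 0 R" and
        Re_k: "\<And>\<zeta>. \<zeta> \<in> ball 0 R \<Longrightarrow> 1 + \<beta> * \<zeta> \<noteq> 0"
          "\<And>\<zeta>. \<zeta> \<in> ball 0 R \<Longrightarrow> Re (k \<zeta> - k 0) = - ln (cmod (1 + \<beta> * \<zeta>))"
        by (rule holomorphic_log_affine) blast
      have "f \<zeta> \<le> f 0 + ereal (t + Re (k \<zeta> - k 0) + \<delta> * (cmod \<zeta>)\<^sup>2)"
        if \<zeta>: "\<zeta> \<in> ball 0 R" and le: "?u (a + \<zeta> *s b) \<le> ?u (a + 0 *s b) + ereal t" for \<zeta> t
      proof -
        have "0 \<le> \<delta> * (cmod \<zeta>)\<^sup>2" using \<delta> by simp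
        then show ?thesis
          using le line[OF Re_k(1)[OF \<zeta>]] line[of 0] Re_k(2)[OF \<zeta>]
          by (cases "f \<zeta>"; cases "f 0") auto
      qed
      then show "\<exists>R k. 0 < R \<and> k holomorphic_on ball 0 R \<and>
        (\<forall>\<zeta>\<in>ball 0 R. \<forall>t. ?u (a + \<zeta> *s b) \<le> ?u (a + 0 *s b) + ereal t \<longrightarrow>
           f \<zeta> \<le> f 0 + ereal (t + Re (k \<zeta> - k 0) + \<delta> * (cmod \<zeta>)\<^sup>2))"
        using R k by blast
    qed
  qed
  then show ?thesis using usc fin' by (auto simp: psh_on_iff_visc)
qed

lemma D2_minus_right:
  assumes "open S" "p \<in> S" "Ck_on 2 S g"
  shows "D2 g p v (- w) = - D2 g p v w"
proof -
  have g: "Ck_on (Suc (Suc 0)) S g" using assms by (simp add: numeral_2_eq_2)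
  have "fd g q (- w) = - fd g q w" if "q \<in> S" for q
    using linear_neg[OF has_derivative_linear[OF Ck_on_SucD(1)[OF g that]]] .
  then have "D2 g p v (- w) = fd (\<lambda>q. - fd g q w) p v"
    unfolding D2_def using frechet_derivative_cong_open(1)[OF assms(1,2)] by (metis (no_types, lifting))
  also have "\<dots> = - D2 g p v w"
    using has_derivative_minus[OF Ck_on_SucD(1)[OF Ck_on_SucD(2)[OF g, where v = w] assms(2)]]
    unfolding D2_def by (simp add: frechet_derivative_at[symmetric])
  finally show ?thesis .
qed

text \<open>In a chart, \<open>\<phi> + \<psi>\<close> is the restriction of the lift to an affine hyperplane plus a smooth function with vanishing
  \<open>ddc\<close>. That function is absorbed by its Taylor expansion along complex lines.\<close>

theorem log_lift_PSH_omega: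
  fixes \<phi> :: "'n::finite cproj \<Rightarrow> ereal"
  assumes fin: "\<And>Z. \<phi> Z \<noteq> \<infinity>" and psh: "psh_on (- {0}) (log_lift \<phi>)"
  shows "\<phi> \<in> PSH_omega"
proof -
  let ?u = "log_lift \<phi>"
  have "psh_on (affine_chart j -` U) ((\<lambda>Z. \<phi> Z + ereal (\<psi> Z)) \<circ> affine_chart j)"
    if pot: "fs_potential_on U \<psi>" for U \<psi> j
  proof -
    define S where "S = affine_chart j -` U"
    have S: "open S" unfolding S_def using pot by (intro open_affine_chart_vimage) (simp add: fs_potential_on_def)
    define g where "g w = \<psi> (affine_chart j w)" for w
    define l where "l w = ln (norm (affine_vec j w))" for w
    define h where "h w = g w - l w" for w
    have Cg: "Ck_on m S g" for m
      using pot unfolding fs_potential_on_def smooth_on_def o_def g_def S_def by blast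
    have Cl: "Ck_on m S l" for m
      unfolding l_def by (intro Ck_on_ln_norm Ck_on_affine_vec S) auto
    have "Ck_on m S (\<lambda>w. g w + (- 1) * l w)" for m
      by (intro Ck_on_add Ck_on_bilinear[OF bounded_bilinear_mult] Ck_on_const S Cg Cl)
    then have Ch: "Ck_on m S h" for m by (simp add: h_def[abs_def])
    let ?v = "(\<lambda>Z. \<phi> Z + ereal (\<psi> Z)) \<circ> affine_chart j"
    have v: "?v w = ?u (affine_vec j w) + ereal (h w)" for w
      by (cases "\<phi> (affine_chart j w)") (auto simp: log_lift_def affine_chart_def h_def g_def l_def)
    have fin': "?u z < \<infinity>" for z
      using fin[of "abs_cproj z"] by (cases "\<phi> (abs_cproj z)") (auto simp: log_lift_def)
    have "usc_on S (\<lambda>w. ?u (affine_vec j w) + ereal (h w))"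
    proof (rule usc_on_add)
      show "usc_on S (\<lambda>w. ?u (affine_vec j w))"
        by (rule usc_on_compose[OF psh_on_usc[OF psh] continuous_on_affine_vec]) auto
      show "usc_on S (\<lambda>w. ereal (h w))" using Ch[of 0] by (intro usc_on_continuous) simp
    qed (use fin' in auto)
    then have usc: "usc_on S ?v" unfolding v[abs_def] by simp
    have lt: "?v w < \<infinity>" for w using fin'[of "affine_vec j w"] unfolding v by (cases "?u (affine_vec j w)") auto
    have visc: "visc_subharmonic0 (\<lambda>\<zeta>. ?v (p + \<zeta> *s b))" if p: "p \<in> S" for p b
    proof -
      \<comment> \<open>Evaluated on the pair \<open>b\<close>, \<open>i b\<close>, the equality of \<open>ddc\<close> says that the Laplacian of \<open>h\<close> along the line is \<open>0\<close>.\<close>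
      have "ddc (\<lambda>w. of_real (g w)) p b (\<i> *s b) = ddc (\<lambda>w. of_real (l w)) p b (\<i> *s b)"
        using pot p unfolding fs_potential_on_def fubini_study_def S_def g_def l_def by simp
      then have "D2 g p b (\<i> *s (\<i> *s b)) - D2 g p (\<i> *s b) (\<i> *s b)
          = D2 l p b (\<i> *s (\<i> *s b)) - D2 l p (\<i> *s b) (\<i> *s b)"
        unfolding ddc_eq_D2[OF S p Cg] ddc_eq_D2[OF S p Cl] of_real_eq_iff by simp
      moreover have "\<i> *s (\<i> *s b) = - b" by (simp add: vec_eq_iff)
      moreover have "D2 h p x y = D2 g p x y - D2 l p x y" for x y
        unfolding h_def[abs_def] by (rule D2_diff[OF S p Cg Cl])
      ultimately have "D2 h p b (- b) - D2 h p (\<i> *s b) (\<i> *s b) = 0" by simp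
      then have lap: "D2 h p b b + D2 h p (\<i> *s b) (\<i> *s b) = 0"
        unfolding D2_minus_right[OF S p Ch] by simp
      define f where "f \<zeta> = ?u (affine_vec j p + \<zeta> *s affine_lin j b)" for \<zeta>
      have f: "visc_subharmonic0 f" unfolding f_def using psh by (simp add: psh_on_iff_visc)
      have line: "?v (p + \<zeta> *s b) = f \<zeta> + ereal (h (p + \<zeta> *s b))" for \<zeta>
        unfolding v f_def affine_vec_add affine_lin_smult ..
      show ?thesis
      proof (rule visc_subharmonic0_compare[OF f])
        show "f 0 \<noteq> - \<infinity>" if "?v (p + 0 *s b) \<noteq> - \<infinity>"
          using that unfolding line by auto
        fix \<delta> :: real assume \<delta>: "0 < \<delta>"
        obtain R k where R: "0 < R" and k: "k holomorphic_on ball 0 R" and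
          T: "\<And>\<zeta>. \<zeta> \<in> ball 0 R \<Longrightarrow> \<bar>h (p + \<zeta> *s b) - h p - Re (k \<zeta> - k 0)\<bar> \<le> \<delta> * (cmod \<zeta>)\<^sup>2"
          using taylor_on_complex_line[OF S p Ch lap \<delta>] by blast
        have "f \<zeta> \<le> f 0 + ereal (t + Re (- k \<zeta> - (- k 0)) + \<delta> * (cmod \<zeta>)\<^sup>2)"
          if "\<zeta> \<in> ball 0 R" "?v (p + \<zeta> *s b) \<le> ?v (p + 0 *s b) + ereal t" for \<zeta> t
          using that(2) T[OF that(1)] unfolding line by (cases "f \<zeta>"; cases "f 0") auto
        moreover have "(\<lambda>\<zeta>. - k \<zeta>) holomorphic_on ball 0 R" using k by (intro holomorphic_intros)
        ultimately show "\<exists>R k. 0 < R \<and> k holomorphic_on ball 0 R \<and>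
          (\<forall>\<zeta>\<in>ball 0 R. \<forall>t. ?v (p + \<zeta> *s b) \<le> ?v (p + 0 *s b) + ereal t \<longrightarrow>
             f \<zeta> \<le> f 0 + ereal (t + Re (k \<zeta> - k 0) + \<delta> * (cmod \<zeta>)\<^sup>2))"
          using R by (intro exI[of _ R] exI[of _ "\<lambda>\<zeta>. - k \<zeta>"]) blast
      qed
    qed
    show ?thesis using S usc lt visc unfolding S_def[symmetric] psh_on_iff_visc by blast
  qed
  then show ?thesis using fin by (auto simp: PSH_omega_def cproj_psh_on_def)
qed

section \<open>Operations on omega-plurisubharmonic functions\<close>

lemma usc_on_const: "usc_on S (\<lambda>_. c)"
  unfolding usc_on_def
proof
  fix d
  show "openin (top_of_set S) {x \<in> S. c < d}" by (cases "c < d") auto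
qed

lemma PSH_omega_iff:
  "\<phi> \<in> PSH_omega \<longleftrightarrow> (\<forall>Z. \<phi> Z \<noteq> \<infinity>) \<and> psh_on (- {0}) (log_lift \<phi>)"
proof -
  have "\<phi> \<in> PSH_omega \<Longrightarrow> \<phi> Z \<noteq> \<infinity>" for Z by (simp add: PSH_omega_def)
  then show ?thesis using PSH_omega_log_lift[of \<phi>] log_lift_PSH_omega[of \<phi>] by blast
qed

text \<open>By the Cauchy--Schwarz inequality, \<open>log \<bar>z\<bar>\<close> is minorised by \<open>log \<bar>a\<bar> + log \<bar>\<Lambda> z\<bar>\<close> with equality at \<open>a\<close>, where
  \<open>\<Lambda>\<close> is the linear functional dual to \<open>a\<close> and \<open>log \<bar>\<Lambda> z\<bar>\<close> is pluriharmonic near \<open>a\<close>.\<close>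

lemma psh_on_ln_norm: "psh_on (- {0}) (\<lambda>z :: complex ^ 'n::finite. ereal (ln (norm z)))"
  unfolding psh_on_iff_visc
proof (intro conjI ballI allI)
  show "usc_on (- {0}) (\<lambda>z :: complex ^ 'n. ereal (ln (norm z)))"
    by (intro usc_on_continuous continuous_intros) auto
  fix a b :: "complex ^ 'n" assume "a \<in> - {0}"
  then have a: "norm a > 0" by simp
  define \<Lambda> where "\<Lambda> z = (\<Sum>i\<in>UNIV. cnj (a $ i) * z $ i) / of_real ((norm a)\<^sup>2)" for z :: "complex ^ 'n"
  have aa: "\<Lambda> a = 1"
  proof -
    have "(\<Sum>i\<in>UNIV. cnj (a $ i) * a $ i) = of_real (\<Sum>i\<in>UNIV. (cmod (a $ i))\<^sup>2)"
      unfolding of_real_sum complex_norm_square by (simp add: mult.commute)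
    also have "(\<Sum>i\<in>UNIV. (cmod (a $ i))\<^sup>2) = (norm a)\<^sup>2"
      by (simp add: norm_vec_def L2_set_def sum_nonneg)
    finally show ?thesis using a by (simp add: \<Lambda>_def)
  qed
  have le: "norm a * cmod (\<Lambda> z) \<le> norm z" for z
  proof -
    have "cmod (\<Sum>i\<in>UNIV. cnj (a $ i) * z $ i) \<le> (\<Sum>i\<in>UNIV. \<bar>cmod (a $ i)\<bar> * \<bar>cmod (z $ i)\<bar>)"
      by (rule order_trans[OF norm_sum]) (simp add: norm_mult)
    also have "\<dots> \<le> norm a * norm z" unfolding norm_vec_def by (rule L2_set_mult_ineq)
    finally have "cmod (\<Sum>i\<in>UNIV. cnj (a $ i) * z $ i) / norm a \<le> norm z"
      using a by (simp add: pos_divide_le_eq mult.commute)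
    moreover have "norm a * cmod (\<Lambda> z) = cmod (\<Sum>i\<in>UNIV. cnj (a $ i) * z $ i) / norm a"
      using a by (simp add: \<Lambda>_def norm_divide norm_mult power2_eq_square)
    ultimately show ?thesis by simp
  qed
  have lin: "\<Lambda> (a + \<zeta> *s b) = 1 + \<Lambda> b * \<zeta>" for \<zeta>
  proof -
    have "\<Lambda> (a + \<zeta> *s b) = \<Lambda> a + \<zeta> * \<Lambda> b"
      by (simp add: \<Lambda>_def distrib_left sum.distrib sum_distrib_left add_divide_distrib mult_ac)
    then show ?thesis by (simp add: aa mult.commute)
  qed
  obtain R k where R: "0 < R" and k: "k holomorphic_on ball 0 R" and
    Re_k: "\<And>\<zeta>. \<zeta> \<in> ball 0 R \<Longrightarrow> 1 + \<Lambda> b * \<zeta> \<noteq> 0"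
      "\<And>\<zeta>. \<zeta> \<in> ball 0 R \<Longrightarrow> Re (k \<zeta> - k 0) = - ln (cmod (1 + \<Lambda> b * \<zeta>))"
    by (rule holomorphic_log_affine) blast
  show "visc_subharmonic0 (\<lambda>\<zeta>. ereal (ln (norm (a + \<zeta> *s b))))"
  proof (rule visc_subharmonic0_compare[OF visc_subharmonic0_const[of 0]])
    fix \<delta> :: real assume \<delta>: "0 < \<delta>"
    have "ereal 0 \<le> ereal 0 + ereal (t + Re (k \<zeta> - k 0) + \<delta> * (cmod \<zeta>)\<^sup>2)"
      if \<zeta>: "\<zeta> \<in> ball 0 R" and t: "ereal (ln (norm (a + \<zeta> *s b))) \<le> ereal (ln (norm (a + 0 *s b))) + ereal t" for \<zeta> t
    proof -
      have pos: "0 < norm a * cmod (1 + \<Lambda> b * \<zeta>)" using a Re_k(1)[OF \<zeta>] by simp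
      have "ln (norm a) + ln (cmod (1 + \<Lambda> b * \<zeta>)) = ln (norm a * cmod (1 + \<Lambda> b * \<zeta>))"
        using a Re_k(1)[OF \<zeta>] by (simp add: ln_mult)
      also have "\<dots> \<le> ln (norm (a + \<zeta> *s b))"
      proof -
        have "norm a * cmod (1 + \<Lambda> b * \<zeta>) \<le> norm (a + \<zeta> *s b)" using le[of "a + \<zeta> *s b"] unfolding lin .
        then show ?thesis using ln_le_cancel_iff[OF pos less_le_trans[OF pos]] by blast
      qed
      finally have "ln (cmod (1 + \<Lambda> b * \<zeta>)) \<le> t" using t by simp
      moreover have "0 \<le> \<delta> * (cmod \<zeta>)\<^sup>2" using \<delta> by simp
      ultimately show ?thesis using Re_k(2)[OF \<zeta>] by simp
    qed
    then show "\<exists>R k. 0 < R \<and> k holomorphic_on ball 0 R \<and>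
      (\<forall>\<zeta>\<in>ball 0 R. \<forall>t. ereal (ln (norm (a + \<zeta> *s b))) \<le> ereal (ln (norm (a + 0 *s b))) + ereal t \<longrightarrow>
         ereal 0 \<le> ereal 0 + ereal (t + Re (k \<zeta> - k 0) + \<delta> * (cmod \<zeta>)\<^sup>2))"
      using R k by blast
  qed simp
qed auto

lemma psh_on_const: "open \<Omega> \<Longrightarrow> psh_on \<Omega> (\<lambda>_. ereal c)"
  by (simp add: psh_on_iff_visc visc_subharmonic0_const usc_on_const)

lemma PSH_omega_zero: "(\<lambda>_. 0 :: ereal) \<in> (PSH_omega :: ('n::finite cproj \<Rightarrow> ereal) set)"
proof -
  have "log_lift (\<lambda>_ :: 'n cproj. 0) = (\<lambda>z. ereal (ln (norm z)))" by (simp add: log_lift_def fun_eq_iff)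
  then show ?thesis using psh_on_ln_norm by (simp add: PSH_omega_iff)
qed

lemma PSH_omega_add_const:
  assumes "\<phi> \<in> PSH_omega"
  shows "(\<lambda>Z. \<phi> Z + ereal c) \<in> PSH_omega"
proof -
  have fin: "\<phi> Z \<noteq> \<infinity>" for Z using assms by (simp add: PSH_omega_iff)
  have "psh_on (- {0}) (\<lambda>z. log_lift \<phi> z + ereal c)"
    using assms by (intro psh_on_add psh_on_const) (auto simp: PSH_omega_iff)
  moreover have "log_lift \<phi> z + ereal c = log_lift (\<lambda>Z. \<phi> Z + ereal c) z" for z
    by (cases "\<phi> (abs_cproj z)") (auto simp: log_lift_def)
  moreover have "\<phi> Z + ereal c \<noteq> \<infinity>" for Z using fin[of Z] by (cases "\<phi> Z") auto
  ultimately show ?thesis by (simp add: PSH_omega_iff fun_eq_iff)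
qed

text \<open>The lift of a convex combination is the convex combination of the lifts, as the weights of \<open>log \<bar>z\<bar>\<close> add up to \<open>1\<close>.\<close>

lemma PSH_omega_convex:
  assumes "\<phi> \<in> PSH_omega" "\<psi> \<in> PSH_omega" "0 < t" "t < 1"
  shows "(\<lambda>Z. ereal t * \<phi> Z + ereal (1 - t) * \<psi> Z) \<in> PSH_omega"
proof -
  have fin: "\<phi> Z \<noteq> \<infinity>" "\<psi> Z \<noteq> \<infinity>" for Z using assms by (simp_all add: PSH_omega_iff)
  have "psh_on (- {0}) (\<lambda>z. ereal t * log_lift \<phi> z + ereal (1 - t) * log_lift \<psi> z)"
    using assms by (intro psh_on_add psh_on_cmult) (auto simp: PSH_omega_iff)
  moreover have "ereal t * log_lift \<phi> z + ereal (1 - t) * log_lift \<psi> z =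
      log_lift (\<lambda>Z. ereal t * \<phi> Z + ereal (1 - t) * \<psi> Z) z" for z
    using fin[of "abs_cproj z"] assms(3,4)
    by (cases "\<phi> (abs_cproj z)"; cases "\<psi> (abs_cproj z)") (auto simp: log_lift_def algebra_simps)
  moreover have "ereal t * \<phi> Z + ereal (1 - t) * \<psi> Z \<noteq> \<infinity>" for Z
    using fin[of Z] assms(3,4) by (cases "\<phi> Z"; cases "\<psi> Z") auto
  ultimately show ?thesis by (simp add: PSH_omega_iff fun_eq_iff)
qed

lemma INF_add_ereal_real:
  fixes f :: "'a \<Rightarrow> ereal"
  shows "(INF i\<in>I. f i + ereal c) = (INF i\<in>I. f i) + ereal c"
proof (rule antisym)
  let ?L = "INF i\<in>I. f i + ereal c"
  have "?L - ereal c \<le> (INF i\<in>I. f i)"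
  proof (rule INF_greatest)
    fix i assume "i \<in> I"
    then have "?L \<le> f i + ereal c" by (rule INF_lower)
    then show "?L - ereal c \<le> f i" by (cases ?L; cases "f i") auto
  qed
  then show "?L \<le> (INF i\<in>I. f i) + ereal c" by (cases ?L; cases "INF i\<in>I. f i") auto
  show "(INF i\<in>I. f i) + ereal c \<le> ?L"
    by (intro INF_greatest add_right_mono INF_lower)
qed

lemma SUP_add_ereal_real:
  fixes f :: "'a \<Rightarrow> ereal"
  assumes "I \<noteq> {}"
  shows "(SUP i\<in>I. f i + ereal c) = (SUP i\<in>I. f i) + ereal c"
proof (rule antisym)
  let ?L = "SUP i\<in>I. f i + ereal c"
  have "(SUP i\<in>I. f i) \<le> ?L - ereal c"
  proof (rule SUP_least)
    fix i assume "i \<in> I"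
    then have "f i + ereal c \<le> ?L" by (rule SUP_upper)
    then show "f i \<le> ?L - ereal c" by (cases ?L; cases "f i") auto
  qed
  then show "(SUP i\<in>I. f i) + ereal c \<le> ?L" by (cases ?L; cases "SUP i\<in>I. f i") auto
  show "?L \<le> (SUP i\<in>I. f i) + ereal c"
    by (intro SUP_least add_right_mono SUP_upper)
qed

lemma PSH_omega_decseq_INF:
  assumes "\<And>n::nat. \<phi> n \<in> PSH_omega" "\<And>n Z. \<phi> (Suc n) Z \<le> \<phi> n Z"
  shows "(\<lambda>Z. INF n. \<phi> n Z) \<in> PSH_omega"
proof -
  have "psh_on (- {0}) (\<lambda>z. INF n. log_lift (\<phi> n) z)"
  proof (rule psh_on_decseq_INF)
    show "psh_on (- {0}) (log_lift (\<phi> n))" for n using assms(1) by (simp add: PSH_omega_iff)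
    show "log_lift (\<phi> (Suc n)) z \<le> log_lift (\<phi> n) z" for n z
      unfolding log_lift_def by (intro add_right_mono assms(2))
  qed
  moreover have "(INF n. log_lift (\<phi> n) z) = log_lift (\<lambda>Z. INF n. \<phi> n Z) z" for z
    by (simp add: log_lift_def INF_add_ereal_real)
  moreover have "(INF n. \<phi> n Z) \<noteq> \<infinity>" for Z
    using assms(1)[of 0] INF_lower[of 0 UNIV "\<lambda>n. \<phi> n Z"] by (auto simp: PSH_omega_iff)
  ultimately show ?thesis by (simp add: PSH_omega_iff fun_eq_iff)
qed

lemma log_lift_normalized: "norm z = 1 \<Longrightarrow> log_lift \<phi> z = \<phi> (abs_cproj z)"
  by (simp add: log_lift_def)

lemma cproj_unit_rep:
  obtains z where "norm z = 1" "abs_cproj z = Z"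
proof -
  define z where "z = of_real (1 / norm (rep_cproj Z)) *s rep_cproj Z"
  have "norm z = 1" by (simp add: z_def norm_smult norm_divide)
  moreover have "abs_cproj z = Z"
    unfolding z_def using abs_cproj_smult[of "rep_cproj Z" "of_real (1 / norm (rep_cproj Z))"] by simp
  ultimately show ?thesis using that by blast
qed

lemma PSH_omega_bounded_above:
  assumes "\<phi> \<in> PSH_omega"
  obtains C where "\<And>Z. \<phi> Z \<le> ereal C"
proof -
  have usc: "usc_on (sphere 0 1) (log_lift \<phi>)"
    using assms by (intro usc_on_subset[OF psh_on_usc[of "- {0}"]]) (auto simp: PSH_omega_iff)
  have "log_lift \<phi> z < \<infinity>" if "z \<in> sphere 0 1" for z
    using assms that by (auto simp: PSH_omega_iff psh_on_def)
  then obtain C where C: "\<And>z. z \<in> sphere 0 1 \<Longrightarrow> log_lift \<phi> z \<le> ereal C"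
    using usc_on_bounded_above[OF usc compact_sphere] by blast
  have "\<phi> Z \<le> ereal C" for Z
  proof -
    obtain z where z: "norm z = 1" "abs_cproj z = Z" by (rule cproj_unit_rep)
    then show ?thesis using C[of z] by (simp add: log_lift_normalized)
  qed
  then show ?thesis using that by blast
qed

lemma open_PSH_omega_less:
  assumes "\<phi> \<in> PSH_omega"
  shows "open {Z. \<phi> Z < c}"
proof -
  have psh: "psh_on (- {0}) (log_lift \<phi>)" using assms by (simp add: PSH_omega_iff)
  have "usc_on (- {0}) (\<lambda>z. log_lift \<phi> z + ereal (- ln (norm z)))"
    using psh
    by (intro usc_on_add usc_on_continuous continuous_intros psh_on_usc) (auto simp: psh_on_def)
  moreover have "log_lift \<phi> z + ereal (- ln (norm z)) = \<phi> (abs_cproj z)" for z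
    by (cases "\<phi> (abs_cproj z)") (auto simp: log_lift_def)
  ultimately have "usc_on (- {0}) (\<lambda>z. \<phi> (abs_cproj z))" by simp
  then have "open {z \<in> - {0}. \<phi> (abs_cproj z) < c}"
    by (simp only: usc_on_open[OF open_Compl[OF closed_singleton]])
  moreover have "{z \<in> - {0}. \<phi> (abs_cproj z) < c} = {z. z \<noteq> 0 \<and> abs_cproj z \<in> {Z. \<phi> Z < c}}" by auto
  ultimately show ?thesis by (simp add: open_cproj_iff)
qed

text \<open>The saturation of an open subset of the cone is the union of its multiples by nonzero scalars.\<close>

lemma open_abs_cproj_image:
  fixes T :: "(complex ^ ('n::finite option)) set"
  assumes "open T"
  shows "open (abs_cproj ` (T - {0}))"
proof -
  have "{z. z \<noteq> 0 \<and> abs_cproj z \<in> abs_cproj ` (T - {0})} = (\<Union>c\<in>-{0}. (\<lambda>z. c *s z) -` (T - {0}))"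
  proof (intro equalityI subsetI)
    fix z assume "z \<in> {z. z \<noteq> 0 \<and> abs_cproj z \<in> abs_cproj ` (T - {0})}"
    then obtain w where z: "z \<noteq> 0" and w: "w \<in> T" "w \<noteq> 0" "abs_cproj z = abs_cproj w" by auto
    obtain c where c: "c \<noteq> 0" "rep_cproj (abs_cproj z) = c *s z" by (rule rep_abs_cproj[OF z])
    obtain d where d: "d \<noteq> 0" "rep_cproj (abs_cproj w) = d *s w" by (rule rep_abs_cproj[OF w(2)])
    have "inverse d *s (d *s w) = w" using d(1) by (simp add: vector_smult_assoc)
    moreover have "d *s w = c *s z" using c d w(3) by simp
    ultimately have "inverse d *s (c *s z) = w" by simp
    then have "(c / d) *s z = w" by (simp add: vector_smult_assoc divide_inverse mult.commute)
    then show "z \<in> (\<Union>c\<in>-{0}. (\<lambda>z. c *s z) -` (T - {0}))"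
      using w c d by (intro UN_I[of "c / d"]) auto
  next
    fix z assume "z \<in> (\<Union>c\<in>-{0}. (\<lambda>z. c *s z) -` (T - {0}))"
    then obtain c where c: "c \<noteq> 0" "c *s z \<in> T - {0}" by auto
    then have z: "z \<noteq> 0" by auto
    have "abs_cproj (c *s z) \<in> abs_cproj ` (T - {0})" using c(2) by (rule imageI)
    then show "z \<in> {z. z \<noteq> 0 \<and> abs_cproj z \<in> abs_cproj ` (T - {0})}"
      using z by (simp add: abs_cproj_smult[OF z c(1)])
  qed
  moreover have "open (\<Union>c\<in>-{0}. (\<lambda>z. c *s z) -` (T - {0}))"
    using assms by (intro open_UN ballI open_vimage continuous_intros open_delete)
  ultimately show ?thesis by (simp add: open_cproj_iff)
qed

section \<open>Maxima over shears\<close>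

text \<open>The maximum of \<open>u\<close> over the images of \<open>z\<close> under the linear shears \<open>z \<mapsto> z + z\<^sub>j v\<close>, \<open>\<bar>v\<bar> \<le> r\<close>. They are linear in \<open>z\<close>, which
  preserves homogeneity and complex lines, and for \<open>z\<^sub>j \<noteq> 0\<close> they move \<open>z\<close> to every point of a neighbourhood.\<close>

definition shear_sup :: "'n::finite option \<Rightarrow> real \<Rightarrow> (complex ^ ('n option) \<Rightarrow> ereal) \<Rightarrow> complex ^ ('n option) \<Rightarrow> ereal" where
  "shear_sup j r u z = (SUP v\<in>cball 0 r. u (z + z $ j *s v))"

lemma shear_norm_le:
  fixes z v :: "complex ^ ('n::finite option)"
  assumes "norm v \<le> r"
  shows "norm (z $ j *s v) \<le> r * norm z"
proof -
  have "norm (z $ j *s v) \<le> norm z * r"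
    unfolding norm_smult using assms by (intro mult_mono Finite_Cartesian_Product.norm_nth_le) (auto intro: order_trans[OF norm_ge_zero])
  then show ?thesis by (simp add: mult.commute)
qed

lemma shear_nonzero:
  fixes z v :: "complex ^ ('n::finite option)"
  assumes "z \<noteq> 0" "norm v < 1"
  shows "z + z $ j *s v \<noteq> 0"
proof
  assume "z + z $ j *s v = 0"
  then have "norm z = norm (z $ j *s v)" by (metis add.inverse_unique norm_minus_cancel)
  also have "\<dots> \<le> norm v * norm z" by (rule shear_norm_le) simp
  also have "\<dots> < 1 * norm z" using assms by (intro mult_strict_right_mono) auto
  finally show False by simp
qed

lemma shear_sup_attained:
  assumes u: "psh_on (- {0}) u" and r: "0 \<le> r" "r < 1" and z: "z \<noteq> 0"
  obtains v where "norm v \<le> r" "shear_sup j r u z = u (z + z $ j *s v)"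
proof -
  have "usc_on (cball 0 r) (\<lambda>v. u (z + z $ j *s v))"
  proof (rule usc_on_compose[OF psh_on_usc[OF u]])
    show "continuous_on (cball 0 r) (\<lambda>v. z + z $ j *s v)" by (intro continuous_intros)
    show "(\<lambda>v. z + z $ j *s v) ` cball 0 r \<subseteq> - {0}" using shear_nonzero[OF z] r by fastforce
  qed
  then obtain v where v: "v \<in> cball 0 r" "\<And>y. y \<in> cball 0 r \<Longrightarrow> u (z + z $ j *s y) \<le> u (z + z $ j *s v)"
    using usc_on_attains_max[of "cball 0 r"] r(1) by (metis cball_eq_empty compact_cball not_less)
  have "shear_sup j r u z = u (z + z $ j *s v)"
    unfolding shear_sup_def using v by (intro antisym SUP_least SUP_upper) auto
  then show ?thesis using that v(1) by auto
qed

lemma shear_sup_upper: "norm v \<le> r \<Longrightarrow> u (z + z $ j *s v) \<le> shear_sup j r u z"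
  unfolding shear_sup_def by (intro SUP_upper) auto

text \<open>Upper semicontinuity is the tube lemma for the compact ball of shears. For the viscosity condition at \<open>a\<close>, fix the
  shear that realises the maximum at \<open>a\<close>: the composition of \<open>u\<close> with this linear map lies below \<open>shear_sup\<close> and agrees
  with it at \<open>a\<close>.\<close>

lemma psh_on_shear_sup:
  fixes u :: "complex ^ ('n::finite option) \<Rightarrow> ereal"
  assumes u: "psh_on (- {0}) u" and r: "0 \<le> r" "r < 1"
  shows "psh_on (- {0}) (shear_sup j r u)"
  unfolding psh_on_iff_visc
proof (intro conjI ballI allI)
  show op: "open (- {0 :: complex ^ ('n option)})" by (rule open_Compl[OF closed_singleton])
  show "shear_sup j r u z < \<infinity>" if z: "z \<in> - {0}" for z
  proof -
    have "z \<noteq> 0" using z by simp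
    then obtain v where v: "norm v \<le> r" "shear_sup j r u z = u (z + z $ j *s v)"
      by (rule shear_sup_attained[OF u r])
    have "z + z $ j *s v \<in> - {0}" using shear_nonzero[OF \<open>z \<noteq> 0\<close>, of v j] v(1) r by simp
    then show ?thesis using u unfolding v(2) psh_on_def by blast
  qed
  show "usc_on (- {0}) (shear_sup j r u)"
    unfolding usc_on_open[OF op]
  proof
    fix c
    define A where "A = (- {0 :: complex ^ ('n option)}) \<times> ball (0 :: complex ^ ('n option)) 1"
    have A: "open A" unfolding A_def by (intro open_Times op open_ball)
    have "usc_on A (\<lambda>p. u (fst p + fst p $ j *s snd p))"
    proof (rule usc_on_compose[OF psh_on_usc[OF u]])
      show "continuous_on A (\<lambda>p. fst p + fst p $ j *s snd p)" by (intro continuous_intros)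
      show "(\<lambda>p. fst p + fst p $ j *s snd p) ` A \<subseteq> - {0}"
      proof
        fix w assume "w \<in> (\<lambda>p. fst p + fst p $ j *s snd p) ` A"
        then obtain p where p: "p \<in> A" "w = fst p + fst p $ j *s snd p" by blast
        have "fst p \<noteq> 0" "norm (snd p) < 1" using p(1) unfolding A_def mem_Times_iff by simp_all
        then show "w \<in> - {0}" using shear_nonzero[of "fst p" "snd p" j] p(2) by simp
      qed
    qed
    then have W: "open {p \<in> A. u (fst p + fst p $ j *s snd p) < c}" (is "open ?W")
      using A by (simp add: usc_on_open)
    show "open {z \<in> - {0}. shear_sup j r u z < c}"
    proof (subst open_subopen, rule ballI)
      fix z assume "z \<in> {z \<in> - {0}. shear_sup j r u z < c}"
      then have z: "z \<noteq> 0" "shear_sup j r u z < c" by auto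
      have sub: "{z} \<times> cball (0 :: complex ^ ('n option)) r \<subseteq> ?W"
      proof
        fix p assume "p \<in> {z} \<times> cball (0 :: complex ^ ('n option)) r"
        then obtain v where p: "p = (z, v)" and "v \<in> cball 0 r" by auto
        then have v: "norm v \<le> r" by simp
        have "u (z + z $ j *s v) < c" using shear_sup_upper[OF v] z(2) by (rule le_less_trans)
        then show "p \<in> ?W" unfolding p using z(1) v r by (simp add: A_def)
      qed
      obtain X where X: "z \<in> X" "open X" "X \<times> cball 0 r \<subseteq> ?W"
        using Elementary_Topology.tube_lemma[OF compact_cball W sub] by blast
      have "X \<subseteq> {z \<in> - {0}. shear_sup j r u z < c}"
      proof
        fix x assume x: "x \<in> X"
        have "(x, 0) \<in> X \<times> cball 0 r" using x r by simp
        then have "(x, 0) \<in> ?W" using X(3) by (rule subsetD[rotated])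
        then have x0: "x \<noteq> 0" by (auto simp: A_def)
        then obtain v where v: "norm v \<le> r" "shear_sup j r u x = u (x + x $ j *s v)"
          by (rule shear_sup_attained[OF u r])
        have "(x, v) \<in> X \<times> cball 0 r" using x v(1) by simp
        then have "(x, v) \<in> ?W" using X(3) by (rule subsetD[rotated])
        then show "x \<in> {z \<in> - {0}. shear_sup j r u z < c}" using x0 v(2) by simp
      qed
      then show "\<exists>T. open T \<and> z \<in> T \<and> T \<subseteq> {z \<in> - {0}. shear_sup j r u z < c}" using X(1,2) by blast
    qed
  qed
  fix a b :: "complex ^ ('n option)" assume "a \<in> - {0}"
  then have a: "a \<noteq> 0" by simp
  obtain v where v: "norm v \<le> r" "shear_sup j r u a = u (a + a $ j *s v)"
    by (rule shear_sup_attained[OF u r a])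
  have "a + a $ j *s v \<in> - {0}" using shear_nonzero[OF a, of v j] v(1) r by simp
  then have f: "visc_subharmonic0 (\<lambda>\<zeta>. u ((a + a $ j *s v) + \<zeta> *s (b + b $ j *s v)))" (is "visc_subharmonic0 ?f")
    using u unfolding psh_on_iff_visc by blast
  have below: "?f \<zeta> \<le> shear_sup j r u (a + \<zeta> *s b)" for \<zeta>
  proof -
    have "(a + a $ j *s v) + \<zeta> *s (b + b $ j *s v) = (a + \<zeta> *s b) + (a + \<zeta> *s b) $ j *s v"
      by (simp add: vec_eq_iff algebra_simps)
    then show ?thesis using shear_sup_upper[OF v(1)] by metis
  qed
  have at0: "shear_sup j r u (a + 0 *s b) = ?f 0" using v(2) by simp
  show "visc_subharmonic0 (\<lambda>\<zeta>. shear_sup j r u (a + \<zeta> *s b))"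
  proof (rule visc_subharmonic0_compare[OF f])
    fix \<delta> :: real assume \<delta>: "0 < \<delta>"
    have "?f \<zeta> \<le> ?f 0 + ereal (t + Re (0 - 0) + \<delta> * (cmod \<zeta>)\<^sup>2)"
      if "shear_sup j r u (a + \<zeta> *s b) \<le> shear_sup j r u (a + 0 *s b) + ereal t" for \<zeta> t
    proof -
      have "?f \<zeta> \<le> ?f 0 + ereal t" using below[of \<zeta>] that unfolding at0 by (rule order_trans)
      also have "\<dots> \<le> ?f 0 + ereal (t + Re (0 - 0) + \<delta> * (cmod \<zeta>)\<^sup>2)"
        using \<delta> by (intro add_left_mono) simp
      finally show ?thesis .
    qed
    then show "\<exists>R k. 0 < R \<and> k holomorphic_on ball 0 R \<and>
      (\<forall>\<zeta>\<in>ball 0 R. \<forall>t. shear_sup j r u (a + \<zeta> *s b) \<le> shear_sup j r u (a + 0 *s b) + ereal t \<longrightarrow>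
         ?f \<zeta> \<le> ?f 0 + ereal (t + Re (k \<zeta> - k 0) + \<delta> * (cmod \<zeta>)\<^sup>2))"
      by (intro exI[of _ 1] exI[of _ "\<lambda>_. 0"]) auto
  qed (simp add: at0[unfolded vector_smult_lzero add_0_right])
qed

text \<open>The function on projective space whose lift is \<open>shear_sup j r (log_lift \<phi>)\<close>; by homogeneity the chosen
  representative is irrelevant (\<open>shear_hull_abs\<close>).\<close>

definition shear_hull :: "'n::finite option \<Rightarrow> real \<Rightarrow> ('n cproj \<Rightarrow> ereal) \<Rightarrow> 'n cproj \<Rightarrow> ereal" where
  "shear_hull j r \<phi> Z = shear_sup j r (log_lift \<phi>) (rep_cproj Z) - ereal (ln (norm (rep_cproj Z)))"

lemma shear_hull_abs:
  assumes z: "z \<noteq> 0" and r: "0 \<le> r" "r < 1"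
  shows "shear_hull j r \<phi> (abs_cproj z) = shear_sup j r (log_lift \<phi>) z - ereal (ln (norm z))"
proof -
  obtain c where c: "c \<noteq> 0" "rep_cproj (abs_cproj z) = c *s z" by (rule rep_abs_cproj[OF z])
  have "shear_sup j r (log_lift \<phi>) (c *s z) = (SUP v\<in>cball 0 r. log_lift \<phi> (z + z $ j *s v) + ereal (ln (cmod c)))"
    unfolding shear_sup_def
  proof (rule SUP_cong)
    fix v :: "complex ^ ('a option)" assume "v \<in> cball 0 r"
    then have "z + z $ j *s v \<noteq> 0" using r by (intro shear_nonzero z) auto
    moreover have "c *s z + (c *s z) $ j *s v = c *s (z + z $ j *s v)" by (simp add: vec_eq_iff algebra_simps)
    ultimately show "log_lift \<phi> (c *s z + (c *s z) $ j *s v) = log_lift \<phi> (z + z $ j *s v) + ereal (ln (cmod c))"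
      using log_lift_smult c(1) by metis
  qed simp
  also have "\<dots> = shear_sup j r (log_lift \<phi>) z + ereal (ln (cmod c))"
    unfolding shear_sup_def using r by (intro SUP_add_ereal_real) auto
  finally have "shear_sup j r (log_lift \<phi>) (c *s z) = shear_sup j r (log_lift \<phi>) z + ereal (ln (cmod c))" .
  moreover have "ln (norm (c *s z)) = ln (cmod c) + ln (norm z)" using z c by (simp add: norm_smult ln_mult)
  ultimately show ?thesis
    unfolding shear_hull_def c(2) by (cases "shear_sup j r (log_lift \<phi>) z") auto
qed

lemma PSH_omega_shear_hull:
  assumes \<phi>: "\<phi> \<in> PSH_omega" and r: "0 \<le> r" "r < 1"
  shows "shear_hull j r \<phi> \<in> PSH_omega"
proof -
  have psh: "psh_on (- {0}) (shear_sup j r (log_lift \<phi>))"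
    using \<phi> r by (intro psh_on_shear_sup) (auto simp: PSH_omega_iff)
  have "shear_sup j r (log_lift \<phi>) z = log_lift (shear_hull j r \<phi>) z" if "z \<in> - {0}" for z
    using that shear_hull_abs[of z r j \<phi>] r
    by (cases "shear_sup j r (log_lift \<phi>) z") (auto simp: log_lift_def)
  from psh_on_cong[OF psh this] have "psh_on (- {0}) (log_lift (shear_hull j r \<phi>))" .
  moreover have "shear_hull j r \<phi> Z \<noteq> \<infinity>" for Z
  proof -
    have "shear_sup j r (log_lift \<phi>) (rep_cproj Z) < \<infinity>" using psh by (auto simp: psh_on_def)
    then show ?thesis unfolding shear_hull_def by (cases "shear_sup j r (log_lift \<phi>) (rep_cproj Z)") auto
  qed
  ultimately show ?thesis by (simp add: PSH_omega_iff)
qed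

lemma shear_hull_mono:
  assumes "r \<le> r'"
  shows "shear_hull j r \<phi> Z \<le> shear_hull j r' \<phi> Z"
  unfolding shear_hull_def shear_sup_def using assms
  by (intro ereal_minus_mono SUP_subset_mono) auto

text \<open>A shear with \<open>\<bar>v\<bar> \<le> r\<close> increases the norm by a factor of at most \<open>1 + r\<close>, and \<open>log (1 + r) \<le> r\<close>.\<close>

lemma shear_hull_le:
  assumes "\<And>Z. \<phi> Z \<le> 0" "0 \<le> r" "r < 1"
  shows "shear_hull j r \<phi> Z \<le> ereal r"
proof -
  define z where "z = rep_cproj Z"
  have z: "z \<noteq> 0" by (simp add: z_def)
  have "log_lift \<phi> (z + z $ j *s v) \<le> ereal (ln (norm z) + r)" if v: "v \<in> cball 0 r" for v
  proof -
    have nz: "z + z $ j *s v \<noteq> 0" using v assms by (intro shear_nonzero z) auto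
    have "norm (z + z $ j *s v) \<le> norm z * (1 + r)"
      using norm_triangle_ineq[of z "z $ j *s v"] shear_norm_le[of v r z j] v by (simp add: algebra_simps)
    then have "ln (norm (z + z $ j *s v)) \<le> ln (norm z * (1 + r))"
      using nz z assms by (simp add: ln_le_cancel_iff)
    also have "\<dots> = ln (norm z) + ln (1 + r)" using z assms by (simp add: ln_mult)
    also have "\<dots> \<le> ln (norm z) + r" using ln_add_one_self_le_self[OF assms(2)] by simp
    finally show ?thesis
      using assms(1)[of "abs_cproj (z + z $ j *s v)"]
      unfolding log_lift_def by (cases "\<phi> (abs_cproj (z + z $ j *s v))") auto
  qed
  then have "shear_sup j r (log_lift \<phi>) z \<le> ereal (ln (norm z) + r)"
    unfolding shear_sup_def by (rule SUP_least)
  then show ?thesis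
    unfolding shear_hull_def z_def[symmetric] by (cases "shear_sup j r (log_lift \<phi>) z") auto
qed

text \<open>For small \<open>r\<close> all sheared points lie in a ball on which the lift is below the required bound.\<close>

lemma shear_hull_eventually_less:
  assumes \<phi>: "\<phi> \<in> PSH_omega" and Z: "\<phi> Z < c"
  shows "\<exists>s>0. \<forall>r. 0 \<le> r \<longrightarrow> r < s \<longrightarrow> shear_hull j r \<phi> Z < c"
proof -
  define z where "z = rep_cproj Z"
  have z: "z \<noteq> 0" "abs_cproj z = Z" by (simp_all add: z_def)
  have psh: "psh_on (- {0}) (log_lift \<phi>)" using \<phi> by (simp add: PSH_omega_iff)
  define d where "d = c + ereal (ln (norm z))"
  have "log_lift \<phi> z < d" using Z unfolding log_lift_def z(2) d_def by (cases "\<phi> Z"; cases c) auto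
  moreover have "open {w \<in> - {0}. log_lift \<phi> w < d}" using psh unfolding psh_on_def by blast
  ultimately obtain e where e: "e > 0" "ball z e \<subseteq> {w \<in> - {0}. log_lift \<phi> w < d}"
    using z(1) by (metis (mono_tags, lifting) ComplI mem_Collect_eq openE singletonD)
  show ?thesis
  proof (intro exI[of _ "min 1 (e / norm z)"] conjI allI impI)
    show "0 < min 1 (e / norm z)" using e z by simp
    fix r :: real assume r: "0 \<le> r" "r < min 1 (e / norm z)"
    then have r1: "r < 1" and rz: "r * norm z < e" using z by (auto simp: pos_less_divide_eq)
    obtain v where v: "norm v \<le> r" "shear_sup j r (log_lift \<phi>) z = log_lift \<phi> (z + z $ j *s v)"
      by (rule shear_sup_attained[OF psh r(1) r1 z(1)])
    have "z + z $ j *s v \<in> ball z e" using shear_norm_le[OF v(1), of z j] rz by (simp add: dist_norm)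
    then have "shear_sup j r (log_lift \<phi>) z < d" using e(2) v(2) by auto
    then show "shear_hull j r \<phi> Z < c"
      unfolding shear_hull_def z_def[symmetric] d_def
      by (cases "shear_sup j r (log_lift \<phi>) z"; cases c) auto
  qed
qed

text \<open>For \<open>z\<close> near \<open>z0\<close> the shear with \<open>v = (z0 - z) / z\<^sub>j\<close> carries \<open>z\<close> to \<open>z0\<close>, so the maximum over shears at \<open>z\<close> is at
  least the value of the lift at \<open>z0\<close>.\<close>

lemma shear_hull_near:
  fixes z0 :: "complex ^ ('n::finite option)"
  assumes z0: "norm z0 = 1" "z0 $ j \<noteq> 0" and r: "0 < r" "r < 1" and fin: "\<phi> (abs_cproj z0) = ereal y" and \<delta>: "0 < \<delta>"
  shows "\<exists>N. open N \<and> abs_cproj z0 \<in> N \<and> (\<forall>Z\<in>N. ereal (y - \<delta>) \<le> shear_hull j r \<phi> Z)"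
proof -
  \<comment> \<open>The second condition bounds the change of the term \<open>log \<bar>z\<bar>\<close> by \<open>\<delta>\<close>.\<close>
  define T where "T = {z. norm (z0 - z) < r * cmod (z $ j)} \<inter> {z. norm z < exp \<delta>}"
  have "open T"
    unfolding T_def by (intro open_Int open_Collect_less continuous_intros)
  then have op: "open (abs_cproj ` (T - {0}))" by (rule open_abs_cproj_image)
  have "z0 \<in> T - {0}" using z0 r \<delta> by (auto simp: T_def)
  then have mem: "abs_cproj z0 \<in> abs_cproj ` (T - {0})" by (rule imageI)
  have "ereal (y - \<delta>) \<le> shear_hull j r \<phi> (abs_cproj z)" if z: "z \<in> T - {0}" for z
  proof -
    have "0 < r * cmod (z $ j)" using z by (auto simp: T_def intro: le_less_trans[OF norm_ge_zero])
    then have zj: "z $ j \<noteq> 0" by auto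
    define v where "v = inverse (z $ j) *s (z0 - z)"
    have "norm v = norm (z0 - z) / cmod (z $ j)" 
      unfolding v_def norm_smult by (simp add: norm_inverse divide_inverse mult.commute)
    then have v: "norm v \<le> r" using z zj by (simp add: T_def pos_divide_le_eq)
    have "z + z $ j *s v = z0" using zj by (simp add: v_def vector_smult_assoc)
    then have "log_lift \<phi> z0 \<le> shear_sup j r (log_lift \<phi>) z" using shear_sup_upper[OF v] by metis
    then have 1: "ereal y \<le> shear_sup j r (log_lift \<phi>) z" using z0(1) fin by (simp add: log_lift_def)
    have "0 < norm z" "norm z \<le> exp \<delta>" using z by (auto simp: T_def)
    then have "ln (norm z) \<le> \<delta>" using ln_le_cancel_iff[of "norm z" "exp \<delta>"] by simp
    then have "ereal (y - \<delta>) \<le> shear_sup j r (log_lift \<phi>) z - ereal (ln (norm z))"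
      using 1 by (cases "shear_sup j r (log_lift \<phi>) z") auto
    then show ?thesis using shear_hull_abs[of z r j \<phi>] z r by simp
  qed
  then show ?thesis using op mem by blast
qed

section \<open>The pluripolar hull\<close>

text \<open>The sum of \<open>f k / 2\<^sup>k\<^sup>+\<^sup>1\<close> over \<open>k < n\<close>, in Horner form: each step is a convex combination with weights \<open>1/2\<close>, so
  membership in \<open>PSH_omega\<close> is immediate by induction.\<close>

primrec halving_sum :: "nat \<Rightarrow> (nat \<Rightarrow> 'a \<Rightarrow> ereal) \<Rightarrow> 'a \<Rightarrow> ereal" where
  "halving_sum 0 f = (\<lambda>_. 0)"
| "halving_sum (Suc n) f = (\<lambda>x. ereal (1/2) * f 0 x + ereal (1 - 1/2) * halving_sum n (\<lambda>k. f (Suc k)) x)"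

lemma halving_sum_PSH:
  assumes "\<And>k. f k \<in> PSH_omega"
  shows "halving_sum n f \<in> PSH_omega"
  using assms
proof (induction n arbitrary: f)
  case 0
  then show ?case using PSH_omega_zero by (simp add: zero_ereal_def)
next
  case (Suc n)
  have "halving_sum n (\<lambda>k. f (Suc k)) \<in> PSH_omega" by (rule Suc.IH) (rule Suc.prems)
  then show ?case using PSH_omega_convex[OF Suc.prems(1)[of 0], of _ "1/2"] by simp
qed

lemma halving_sum_nonpos:
  assumes "\<And>k. f k x \<le> 0"
  shows "halving_sum n f x \<le> 0"
  using assms
proof (induction n arbitrary: f)
  case (Suc n)
  have "halving_sum n (\<lambda>k. f (Suc k)) x \<le> 0" by (rule Suc.IH) (rule Suc.prems)
  then show ?case using Suc.prems[of 0]
    by (cases "f 0 x"; cases "halving_sum n (\<lambda>k. f (Suc k)) x") auto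
qed simp

lemma halving_sum_decreasing:
  assumes "\<And>k. f k x \<le> 0"
  shows "halving_sum (Suc n) f x \<le> halving_sum n f x"
  using assms
proof (induction n arbitrary: f)
  case 0
  then show ?case using "0"[of 0] by (cases "f 0 x") auto
next
  case (Suc n)
  have "halving_sum (Suc n) (\<lambda>k. f (Suc k)) x \<le> halving_sum n (\<lambda>k. f (Suc k)) x"
    by (rule Suc.IH) (rule Suc.prems)
  then show ?case
    unfolding halving_sum.simps(2)[of "Suc n" f] halving_sum.simps(2)[of n f]
    by (intro add_left_mono ereal_mult_left_mono) auto
qed

lemma halving_sum_ge:
  assumes "\<And>k. ereal (- 1) \<le> f k x"
  shows "ereal (- 1) \<le> halving_sum n f x"
  using assms
proof (induction n arbitrary: f)
  case (Suc n)
  have "ereal (- 1) \<le> halving_sum n (\<lambda>k. f (Suc k)) x" by (rule Suc.IH) (rule Suc.prems)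
  then show ?case using Suc.prems[of 0]
    by (cases "f 0 x"; cases "halving_sum n (\<lambda>k. f (Suc k)) x") auto
qed simp

lemma halving_sum_le_term:
  assumes "\<And>k. f k x \<le> 0" "f m x \<le> ereal (- c)" "m < n"
  shows "halving_sum n f x \<le> ereal (- c / 2 ^ Suc m)"
  using assms
proof (induction n arbitrary: f m)
  case (Suc n)
  have np: "halving_sum n (\<lambda>k. f (Suc k)) x \<le> 0"
    by (rule halving_sum_nonpos) (rule Suc.prems)
  show ?case
  proof (cases m)
    case 0
    then show ?thesis using np Suc.prems(2)
      by (cases "f 0 x"; cases "halving_sum n (\<lambda>k. f (Suc k)) x") auto
  next
    case (Suc m')
    define T where "T = - c / 2 ^ Suc m'"
    have T: "- c / 2 ^ Suc m = T / 2" by (simp add: T_def \<open>m = Suc m'\<close>)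
    have "halving_sum n (\<lambda>k. f (Suc k)) x \<le> ereal T"
      unfolding T_def
      using Suc.IH[of "\<lambda>k. f (Suc k)" m'] Suc.prems \<open>m = Suc m'\<close> by simp
    then show ?thesis using Suc.prems(1)[of 0] unfolding T
      by (cases "f 0 x"; cases "halving_sum n (\<lambda>k. f (Suc k)) x") auto
  qed
qed simp

text \<open>The partial sums decrease. On \<open>K\<close> the \<open>k\<close>-th summand contributes at most \<open>-4\<^sup>k / 2\<^sup>k\<^sup>+\<^sup>1\<close>, which is unbounded below,
  while at \<open>Z0\<close> the sum stays above minus the total weight.\<close>

lemma PSH_omega_infinite_sum:
  fixes f :: "nat \<Rightarrow> 'n::finite cproj \<Rightarrow> ereal"
  assumes f: "\<And>k. f k \<in> PSH_omega" "\<And>k Z. f k Z \<le> 0"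
    and K: "\<And>k Z. Z \<in> K \<Longrightarrow> f k Z \<le> ereal (- (4 ^ k))"
    and Z0: "\<And>k. ereal (- 1) \<le> f k Z0"
  shows "\<exists>\<phi>\<in>PSH_omega. (\<forall>Z\<in>K. \<phi> Z = - \<infinity>) \<and> \<phi> Z0 \<noteq> - \<infinity>"
proof (intro bexI[of _ "\<lambda>Z. INF n. halving_sum n f Z"] conjI ballI)
  show "(\<lambda>Z. INF n. halving_sum n f Z) \<in> PSH_omega"
    by (intro PSH_omega_decseq_INF halving_sum_PSH halving_sum_decreasing f)
  have "ereal (- 1) \<le> (INF n. halving_sum n f Z0)"
    by (intro INF_greatest halving_sum_ge Z0)
  then show "(INF n. halving_sum n f Z0) \<noteq> - \<infinity>" by auto
  fix Z assume Z: "Z \<in> K"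
  have "(INF n. halving_sum n f Z) \<le> ereal b" for b
  proof -
    obtain m where m: "2 * \<bar>b\<bar> < 2 ^ m" using real_arch_pow[of 2 "2 * \<bar>b\<bar>"] by auto
    have "(INF n. halving_sum n f Z) \<le> halving_sum (Suc m) f Z" by (rule INF_lower) simp
    also have "\<dots> \<le> ereal (- (4 ^ m) / 2 ^ Suc m)"
      by (rule halving_sum_le_term) (use f(2) K[OF Z] in auto)
    also have "(- (4 ^ m) / 2 ^ Suc m :: real) = - (2 ^ m / 2)"
    proof -
      have "(4 :: real) ^ m = 2 ^ m * 2 ^ m" by (simp flip: power_mult_distrib)
      then show ?thesis by simp
    qed
    also have "ereal (- (2 ^ m / 2)) \<le> ereal b" using m by simp
    finally show ?thesis .
  qed
  then show "(INF n. halving_sum n f Z) = - \<infinity>" using ereal_bot by blast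
qed

text \<open>The function \<open>\<psi>\<close> is a maximum over shears, lowered by the small amount by which it may exceed \<open>0\<close>. These maxima decrease
  with \<open>r\<close>, and their sublevel sets are open, so by compactness one \<open>r\<close> serves all of \<open>K\<close>.\<close>

lemma PSH_omega_approx_near:
  fixes K :: "'n::finite cproj set"
  assumes K: "compact K" and \<phi>: "\<phi> \<in> PSH_omega" "\<And>Z. \<phi> Z \<le> 0" "\<And>Z. Z \<in> K \<Longrightarrow> \<phi> Z < c"
    and Z0: "\<phi> Z0 = ereal y" and \<epsilon>: "0 < \<epsilon>"
  shows "\<exists>\<psi>\<in>PSH_omega. (\<forall>Z. \<psi> Z \<le> 0) \<and> (\<forall>Z\<in>K. \<psi> Z \<le> c) \<and>
    (\<exists>N. open N \<and> Z0 \<in> N \<and> (\<forall>Z\<in>N. ereal (y - \<epsilon>) \<le> \<psi> Z))"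
proof -
  obtain z0 where z0: "norm z0 = 1" "abs_cproj z0 = Z0" by (rule cproj_unit_rep)
  then have "z0 \<noteq> 0" by auto
  then obtain j where j: "z0 $ j \<noteq> 0" by (auto simp: vec_eq_iff)
  \<comment> \<open>Radii tending to \<open>0\<close>, below \<open>1\<close> so that no shear has a kernel, and at most \<open>\<epsilon> / 2\<close>: half of \<open>\<epsilon>\<close> pays for
      lowering by the radius, the other half for passing to the neighbourhood.\<close>
  define r where "r n = min 1 (\<epsilon> / 2) / (real n + 2)" for n
  have r: "0 < r n" "r n < 1" "r n \<le> \<epsilon> / 2" for n
  proof -
    show "0 < r n" using \<epsilon> by (simp add: r_def)
    have "r n \<le> min 1 (\<epsilon> / 2) / 2" unfolding r_def using \<epsilon> by (intro divide_left_mono) auto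
    then show "r n < 1" "r n \<le> \<epsilon> / 2" using \<epsilon> by auto
  qed
  have r_anti: "r n \<le> r m" if "m \<le> n" for m n
    unfolding r_def using that \<epsilon> by (intro divide_left_mono) auto
  have r_lim: "\<exists>n. r n < s" if "0 < s" for s
  proof -
    obtain n where n: "1 / s < real n" using reals_Archimedean2 by blast
    have "r n \<le> 1 / (real n + 2)" unfolding r_def by (intro divide_right_mono) auto
    also have "\<dots> < s"
    proof -
      have "1 < real n * s" using n that by (simp add: pos_divide_less_eq)
      also have "\<dots> \<le> (real n + 2) * s" using that by simp
      finally show ?thesis by (simp add: pos_divide_less_eq mult.commute add_nonneg_pos)
    qed
    finally show ?thesis by blast
  qed
  define \<Phi> where "\<Phi> n = shear_hull j (r n) \<phi>" for n
  have \<Phi>: "\<Phi> n \<in> PSH_omega" for n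
    unfolding \<Phi>_def using r[of n] by (intro PSH_omega_shear_hull \<phi>) auto
  define V where "V n = {Z. \<Phi> n Z < c}" for n
  have "K \<subseteq> (\<Union>n. V n)"
  proof
    fix Z assume "Z \<in> K"
    then obtain s where s: "s > 0" "\<And>r. 0 \<le> r \<Longrightarrow> r < s \<Longrightarrow> shear_hull j r \<phi> Z < c"
      using shear_hull_eventually_less[OF \<phi>(1)] \<phi>(3) by blast
    obtain n where "r n < s" using r_lim[OF s(1)] by blast
    then have "Z \<in> V n" using s(2)[of "r n"] r(1)[of n] by (simp add: V_def \<Phi>_def)
    then show "Z \<in> (\<Union>n. V n)" by blast
  qed
  moreover have "open (V n)" for n unfolding V_def by (rule open_PSH_omega_less[OF \<Phi>])
  ultimately obtain F where F: "finite F" "K \<subseteq> (\<Union>n\<in>F. V n)"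
    using compactE_image[OF K, of UNIV V] by auto
  define m where "m = Max (insert 0 F)"
  have K_less: "\<Phi> m Z < c" if "Z \<in> K" for Z
  proof -
    have "Z \<in> (\<Union>n\<in>F. V n)" using F(2) that by (rule subsetD)
    then obtain n where n: "n \<in> F" "\<Phi> n Z < c" unfolding V_def by blast
    have "n \<le> m" unfolding m_def using F(1) n(1) by (intro Max_ge) auto
    then have "\<Phi> m Z \<le> \<Phi> n Z" unfolding \<Phi>_def by (intro shear_hull_mono r_anti)
    then show ?thesis using n(2) by (rule le_less_trans)
  qed
  obtain N where N: "open N" "Z0 \<in> N" "\<And>Z. Z \<in> N \<Longrightarrow> ereal (y - \<epsilon> / 2) \<le> \<Phi> m Z"
    using shear_hull_near[OF z0(1) j r(1)[of m] r(2)[of m], of \<phi> y "\<epsilon> / 2"] Z0 \<epsilon> z0(2)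
    unfolding \<Phi>_def by auto
  have up: "\<Phi> m Z \<le> ereal (r m)" for Z
    unfolding \<Phi>_def using r[of m] by (intro shear_hull_le \<phi>(2)) auto
  show ?thesis
  proof (intro bexI[of _ "\<lambda>Z. \<Phi> m Z + ereal (- r m)"] conjI allI ballI exI[of _ N])
    show "(\<lambda>Z. \<Phi> m Z + ereal (- r m)) \<in> PSH_omega" by (rule PSH_omega_add_const[OF \<Phi>])
    show "\<Phi> m Z + ereal (- r m) \<le> 0" for Z using up[of Z] by (cases "\<Phi> m Z") auto
    show "\<Phi> m Z + ereal (- r m) \<le> c" if "Z \<in> K" for Z
      using K_less[OF that] r(1)[of m] by (cases "\<Phi> m Z"; cases c) auto
    show "ereal (y - \<epsilon>) \<le> \<Phi> m Z + ereal (- r m)" if "Z \<in> N" for Z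
      using N(3)[OF that] r(3)[of m] by (cases "\<Phi> m Z") auto
  qed (use N in auto)
qed

definition shallow_set :: "'n::finite cproj set \<Rightarrow> real \<Rightarrow> 'n cproj set" where
  "shallow_set K M = \<Union> {interior {Z. ereal (- 1) \<le> \<phi> Z} |\<phi>.
     \<phi> \<in> PSH_omega \<and> (\<forall>Z. \<phi> Z \<le> 0) \<and> (\<forall>Z\<in>K. \<phi> Z \<le> ereal (- M))}"

lemma open_shallow_set: "open (shallow_set K M)"
  unfolding shallow_set_def by (rule open_Union) auto

text \<open>Subtracting a bound and scaling make the given function nonpositive with value at least \<open>-1/2\<close> at \<open>Z0\<close>;
  passing to a neighbourhood costs another \<open>1/2\<close>.\<close>

lemma compl_hull_subset_shallow:
  assumes K: "compact K" and Z0: "Z0 \<notin> pluripolar_hull K"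
  shows "Z0 \<in> shallow_set K M"
proof -
  obtain \<phi> where \<phi>: "\<phi> \<in> PSH_omega" "\<And>Z. Z \<in> K \<Longrightarrow> \<phi> Z = - \<infinity>" "\<phi> Z0 \<noteq> - \<infinity>"
    using Z0 by (auto simp: pluripolar_hull_def)
  obtain C where C: "\<And>Z. \<phi> Z \<le> ereal C" using PSH_omega_bounded_above[OF \<phi>(1)] by blast
  obtain x where x: "\<phi> Z0 = ereal x" using \<phi>(3) C[of Z0] by (cases "\<phi> Z0") auto
  have xC: "x \<le> C" using C[of Z0] x by simp
  \<comment> \<open>The summand \<open>1\<close> keeps the denominator positive when \<open>x = C\<close>.\<close>
  define t where "t = 1 / (2 * (C - x + 1))"
  have t: "0 < t" "t < 1" "t * (C - x) \<le> 1 / 2"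
  proof -
    show "0 < t" using xC by (simp add: t_def)
    show "t < 1" using xC by (simp add: t_def)
    show "t * (C - x) \<le> 1 / 2" using xC by (simp add: t_def field_simps)
  qed
  define \<psi> where "\<psi> Z = ereal t * (\<phi> Z + ereal (- C)) + ereal (1 - t) * 0" for Z
  have "\<psi> \<in> PSH_omega"
    unfolding \<psi>_def[abs_def] by (intro PSH_omega_convex PSH_omega_add_const \<phi> PSH_omega_zero t)
  moreover have "\<psi> Z \<le> 0" for Z
  proof -
    have "\<phi> Z + ereal (- C) \<le> 0" using C[of Z] by (cases "\<phi> Z") auto
    then show ?thesis using t unfolding \<psi>_def by (cases "\<phi> Z") (auto simp: mult_nonneg_nonpos)
  qed
  moreover have "\<psi> Z < ereal (- M)" if "Z \<in> K" for Z
    using t \<phi>(2)[OF that] by (simp add: \<psi>_def)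
  moreover have "\<psi> Z0 = ereal (t * (x - C))" using x by (simp add: \<psi>_def)
  ultimately obtain \<eta> N where \<eta>: "\<eta> \<in> PSH_omega" "\<And>Z. \<eta> Z \<le> 0" "\<And>Z. Z \<in> K \<Longrightarrow> \<eta> Z \<le> ereal (- M)"
    and N: "open N" "Z0 \<in> N" "\<And>Z. Z \<in> N \<Longrightarrow> ereal (t * (x - C) - 1 / 2) \<le> \<eta> Z"
    using PSH_omega_approx_near[OF K, of \<psi> "ereal (- M)" Z0 "t * (x - C)" "1 / 2"] by auto
  have "ereal (- 1) \<le> \<eta> Z" if "Z \<in> N" for Z
  proof -
    have "ereal (- 1) \<le> ereal (t * (x - C) - 1 / 2)" using t(3) by (simp add: right_diff_distrib)
    then show ?thesis using N(3)[OF that] by (rule order_trans)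
  qed
  then have "Z0 \<in> interior {Z. ereal (- 1) \<le> \<eta> Z}"
    using N(1,2) by (intro interiorI[of N]) auto
  then show ?thesis using \<eta> unfolding shallow_set_def by blast
qed

lemma shallow_subset_compl_hull:
  assumes "\<And>m::nat. Z0 \<in> shallow_set K (real m)"
  shows "Z0 \<notin> pluripolar_hull K"
proof -
  have "\<exists>\<phi>. \<phi> \<in> PSH_omega \<and> (\<forall>Z. \<phi> Z \<le> 0) \<and> (\<forall>Z\<in>K. \<phi> Z \<le> ereal (- (4 ^ k))) \<and> ereal (- 1) \<le> \<phi> Z0" for k :: nat
  proof -
    have "Z0 \<in> shallow_set K (real (4 ^ k))" by (rule assms)
    then show ?thesis unfolding shallow_set_def using interior_subset by fastforce
  qed
  then obtain f where f: "\<And>k. f k \<in> PSH_omega" "\<And>k Z. f k Z \<le> 0"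
    "\<And>k Z. Z \<in> K \<Longrightarrow> f k Z \<le> ereal (- (4 ^ k))" "\<And>k. ereal (- 1) \<le> f k Z0"
    by metis
  obtain \<phi> where "\<phi> \<in> PSH_omega" "\<forall>Z\<in>K. \<phi> Z = - \<infinity>" "\<phi> Z0 \<noteq> - \<infinity>"
    using PSH_omega_infinite_sum[OF f] by blast
  then show ?thesis by (auto simp: pluripolar_hull_def)
qed

theorem theorem3p4:
  fixes K :: "'n::finite cproj set"
  assumes "compact K" and "pluripolar K"
  shows "fsigma (pluripolar_hull K)"
proof -
  have "pluripolar_hull K = (\<Union>m::nat. - shallow_set K (real m))"
    using compl_hull_subset_shallow[OF assms(1)] shallow_subset_compl_hull[of _ K] by blast
  moreover have "fsigma (\<Union>m::nat. - shallow_set K (real m))"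
    by (rule fsigma.intros) (rule closed_Compl[OF open_shallow_set])
  ultimately show ?thesis by simp
qed

end
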